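(* The Positivity problem is polynomial-time reducible to each of the following two problems. Given a finite MDP $\mathcal{M}$ with integer weight function and initial state $s_{\mathit{init}}$, and a rational $\vartheta\in(0,1)$: (1) decide whether $\Pr^{\max}_{\mathcal{M},s_{\mathit{init}}}(\lozenge(\text{accumulated weight}<0))>\vartheta$; (2) decide whether $\Pr^{\min}_{\mathcal{M},s_{\mathit{init}}}(\lozenge(\text{accumulated weight}<0))<\vartheta$.
   Context: Positivity problem: given $k\ge 2$ and rationals $\alpha_1,\dots,\alpha_k,\beta_0,\dots,\beta_{k-1}$, let $(u_n)_{n\ge0}$ be defined by $u_j=\beta_j$ for $0\le j<k$ and $u_{n+k}=\alpha_1u_{n+k-1}+\dots+\alpha_ku_n$ for $n\ge0$; decide whether $u_n\ge0$ for all $n$ (equivalently, its complement: whether some $u_n<0$). A (finite) MDP is $\mathcal{M}=(S,\mathit{Act},P,s_{\mathit{init}})$ with finite state set $S$, finite action set $\mathit{Act}$, rational transition probabilities $P\colon S\times\mathit{Act}\times S\to[0,1]\cap\mathbb{Q}$ with $\sum_tP(s,\alpha,t)\in\{0,1\}$, together with a weight function $\mathit{wgt}\colon S\times\mathit{Act}\to\mathbb{Z}$ (encoded in binary; probabilities as fractions in binary). The accumulated weight of a finite path $s_0\alpha_0s_1\dots s_n$ is $\sum_{i<n}\mathit{wgt}(s_i,\alpha_i)$. Schedulers map finite paths to probability distributions over enabled actions (randomized, history-dependent); each induces a probability measure $\Pr^{\mathfrak{S}}_{\mathcal{M},s}$ on maximal paths from $s$. $\Pr^{\max}=\sup_{\mathfrak{S}}\Pr^{\mathfrak{S}}$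 and $\Pr^{\min}=\inf_{\mathfrak{S}}\Pr^{\mathfrak{S}}$. The event $\lozenge(\text{accumulated weight}<0)$ is the set of maximal paths having a finite prefix with negative accumulated weight. *)

theory Defs
  imports
    "HOL-Probability.Probability"
    "HOL-Library.Stream"
    "HOL-Library.Sublist"
    "HOL-Computational_Algebra.Polynomial"
begin

text \<open>
  Deterministic multi-tape Turing machines. Tapes are infinite in both directions, states and tape
  symbols are natural numbers below given bounds, symbol \<open>0\<close> is the blank, state \<open>0\<close> is the
  initial state, and the machine halts when the transition function is undefined (\<open>None\<close>).
\<close>

datatype move = Move_Left | Move_Right | Stay

record tm =
  num_tapes :: nat
  num_states :: nat
  num_symbols :: nat
  delta :: "nat \<Rightarrow> nat list \<Rightarrow> (nat \<times> (nat \<times> move) list) option"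

definition turing_machine :: "tm \<Rightarrow> bool" where
  "turing_machine T \<longleftrightarrow>
     2 \<le> num_tapes T \<and> 1 \<le> num_states T \<and> 3 \<le> num_symbols T \<and>
     (\<forall>q < num_states T. \<forall>xs. length xs = num_tapes T \<longrightarrow> set xs \<subseteq> {..<num_symbols T} \<longrightarrow>
        (\<forall>q' ys. delta T q xs = Some (q', ys) \<longrightarrow>
           q' < num_states T \<and> length ys = num_tapes T \<and> fst ` set ys \<subseteq> {..<num_symbols T}))"

type_synonym tape = "(int \<Rightarrow> nat) \<times> int"
type_synonym config = "nat \<times> tape list"

fun move_head :: "move \<Rightarrow> int \<Rightarrow> int" where
  "move_head Move_Left i = i - 1"
| "move_head Move_Right i = i + 1"
| "move_head Stay i = i"

definition read_tape :: "tape \<Rightarrow> nat" where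
  "read_tape = (\<lambda>(f, i). f i)"

definition update_tape :: "nat \<times> move \<Rightarrow> tape \<Rightarrow> tape" where
  "update_tape = (\<lambda>(x, d) (f, i). (f(i := x), move_head d i))"

definition tm_step :: "tm \<Rightarrow> config \<Rightarrow> config option" where
  "tm_step T = (\<lambda>(q, ts).
     case delta T q (map read_tape ts) of
       None \<Rightarrow> None
     | Some (q', ys) \<Rightarrow> Some (q', map2 update_tape ys ts))"

text \<open>At most \<open>n\<close> steps: once the machine has halted, the configuration no longer changes.\<close>

fun tm_run :: "tm \<Rightarrow> nat \<Rightarrow> config \<Rightarrow> config" where
  "tm_run T 0 c = c"
| "tm_run T (Suc n) c = (case tm_step T c of None \<Rightarrow> c | Some c' \<Rightarrow> tm_run T n c')"

definition tape_contents :: "bool list \<Rightarrow> int \<Rightarrow> nat" where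
  "tape_contents w i =
     (if 0 \<le> i \<and> i < int (length w) then (if w ! nat i then 2 else 1) else 0)"

definition tm_init :: "tm \<Rightarrow> bool list \<Rightarrow> config" where
  "tm_init T w = (0, (tape_contents w, 0) # replicate (num_tapes T - 1) (tape_contents [], 0))"

text \<open>Tape \<open>0\<close> holds the input and tape \<open>1\<close> the output; all other tapes are scratch tapes.\<close>

definition tm_computes_within :: "tm \<Rightarrow> nat \<Rightarrow> bool list \<Rightarrow> bool list \<Rightarrow> bool" where
  "tm_computes_within T n v w \<longleftrightarrow>
     (let c = tm_run T n (tm_init T v)
      in tm_step T c = None \<and> fst (snd c ! 1) = tape_contents w)"

definition poly_time_computable_on :: "bool list set \<Rightarrow> (bool list \<Rightarrow> bool list) \<Rightarrow> bool" where
  "poly_time_computable_on D f \<longleftrightarrow>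
     (\<exists>T (p :: nat poly). turing_machine T \<and>
        (\<forall>w \<in> D. tm_computes_within T (poly p (length w)) w (f w)))"

record decision_problem =
  instances :: "bool list set"
  yes_instances :: "bool list set"

text \<open>
  A decision problem and its complement are equally hard under Turing reductions, but not necessarily
  under the many-one reductions below. Both threshold conditions considered here are existential: they
  are to correspond to the existence of a negative term of a linear recurrence sequence, and hence the
  many-one reductions start from the complement of the Positivity problem.
\<close>

definition complement_problem :: "decision_problem \<Rightarrow> decision_problem" where
  "complement_problem A = A\<lparr>yes_instances := instances A - yes_instances A\<rparr>"

definition poly_time_reducible :: "decision_problem \<Rightarrow> decision_problem \<Rightarrow> bool" where
  "poly_time_reducible A B \<longleftrightarrow>
     (\<exists>f. poly_time_computable_on (instances A) f \<and>
        (\<forall>w \<in> instances A. f w \<in> instances B \<and>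
           (w \<in> yes_instances A \<longleftrightarrow> f w \<in> yes_instances B)))"

text \<open>
  All encodings are self-delimiting, so that concatenation can be used for tuples: every list
  element is preceded by \<open>True\<close>, and the end of a list is marked by \<open>False\<close>. Numbers are in binary,
  least significant bit first; rationals are given as reduced fractions.
\<close>

fun bits :: "nat \<Rightarrow> bool list" where
  "bits n = (if n = 0 then [] else odd n # bits (n div 2))"

declare bits.simps [simp del]

definition enc_list :: "('x \<Rightarrow> bool list) \<Rightarrow> 'x list \<Rightarrow> bool list" where
  "enc_list e xs = concat (map (\<lambda>x. True # e x) xs) @ [False]"

definition enc_nat :: "nat \<Rightarrow> bool list" where
  "enc_nat n = enc_list (\<lambda>b. [b]) (bits n)"

definition enc_int :: "int \<Rightarrow> bool list" where
  "enc_int z = (z < 0) # enc_nat (nat \<bar>z\<bar>)"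

definition enc_rat :: "rat \<Rightarrow> bool list" where
  "enc_rat r = enc_int (fst (quotient_of r)) @ enc_int (snd (quotient_of r))"

text \<open>
  The order of the recurrence is \<open>k = length as\<close>; the lists are \<open>as = [\<alpha>\<^sub>1, \<dots>, \<alpha>\<^sub>k]\<close> and
  \<open>bs = [\<beta>\<^sub>0, \<dots>, \<beta>\<^sub>k\<^sub>-\<^sub>1]\<close>, so that \<open>as ! i\<close> is the coefficient of \<open>u (n - 1 - i)\<close> in \<open>u n\<close>.
\<close>

function lrs :: "rat list \<Rightarrow> rat list \<Rightarrow> nat \<Rightarrow> rat" where
  "lrs as bs n =
     (if n < length as then bs ! n else (\<Sum>i<length as. as ! i * lrs as bs (n - 1 - i)))"
  by pat_completeness auto
termination
  by (relation "Wellfounded.measure (\<lambda>(as, bs, n). n)") auto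

declare lrs.simps [simp del]

definition lrs_instance :: "rat list \<Rightarrow> rat list \<Rightarrow> bool" where
  "lrs_instance as bs \<longleftrightarrow> 2 \<le> length as \<and> length bs = length as"

definition enc_lrs :: "rat list \<Rightarrow> rat list \<Rightarrow> bool list" where
  "enc_lrs as bs = enc_list enc_rat as @ enc_list enc_rat bs"

definition positivity_problem :: decision_problem where
  "positivity_problem =
     \<lparr>instances = {enc_lrs as bs | as bs. lrs_instance as bs},
      yes_instances = {enc_lrs as bs | as bs. lrs_instance as bs \<and> (\<forall>n. 0 \<le> lrs as bs n)}\<rparr>"

record ('s, 'a) mdp =
  states :: "'s set"
  actions :: "'a set"
  tprob :: "'s \<Rightarrow> 'a \<Rightarrow> 's \<Rightarrow> rat"
  init :: 's
  wgt :: "'s \<Rightarrow> 'a \<Rightarrow> int"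

definition finite_mdp :: "('s, 'a) mdp \<Rightarrow> bool" where
  "finite_mdp M \<longleftrightarrow>
     finite (states M) \<and> finite (actions M) \<and> init M \<in> states M \<and>
     (\<forall>s \<in> states M. \<forall>a \<in> actions M.
        (\<forall>t \<in> states M. 0 \<le> tprob M s a t \<and> tprob M s a t \<le> 1) \<and>
        (\<Sum>t \<in> states M. tprob M s a t) \<in> {0, 1})"

definition enabled :: "('s, 'a) mdp \<Rightarrow> 's \<Rightarrow> 'a set" where
  "enabled M s = {a \<in> actions M. (\<Sum>t \<in> states M. tprob M s a t) = 1}"

text \<open>The finite path \<open>s\<^sub>0 a\<^sub>0 s\<^sub>1 \<dots> a\<^sub>n\<^sub>-\<^sub>1 s\<^sub>n\<close> is represented as \<open>(s\<^sub>0, [(a\<^sub>0, s\<^sub>1), \<dots>, (a\<^sub>n\<^sub>-\<^sub>1, s\<^sub>n)])\<close>.\<close>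

type_synonym ('s, 'a) fpath = "'s \<times> ('a \<times> 's) list"

definition nth_state :: "('s, 'a) fpath \<Rightarrow> nat \<Rightarrow> 's" where
  "nth_state \<pi> i = (if i = 0 then fst \<pi> else snd (snd \<pi> ! (i - 1)))"

definition nth_action :: "('s, 'a) fpath \<Rightarrow> nat \<Rightarrow> 'a" where
  "nth_action \<pi> i = fst (snd \<pi> ! i)"

definition path_length :: "('s, 'a) fpath \<Rightarrow> nat" where
  "path_length \<pi> = length (snd \<pi>)"

definition last_state :: "('s, 'a) fpath \<Rightarrow> 's" where
  "last_state \<pi> = nth_state \<pi> (path_length \<pi>)"

definition take_path :: "nat \<Rightarrow> ('s, 'a) fpath \<Rightarrow> ('s, 'a) fpath" where
  "take_path i \<pi> = (fst \<pi>, take i (snd \<pi>))"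

definition finite_paths :: "('s, 'a) mdp \<Rightarrow> 's \<Rightarrow> ('s, 'a) fpath set" where
  "finite_paths M s = {\<pi>. nth_state \<pi> 0 = s \<and> s \<in> states M \<and>
     (\<forall>i < path_length \<pi>.
        nth_action \<pi> i \<in> enabled M (nth_state \<pi> i) \<and>
        nth_state \<pi> (Suc i) \<in> states M \<and>
        0 < tprob M (nth_state \<pi> i) (nth_action \<pi> i) (nth_state \<pi> (Suc i)))}"

definition acc_weight :: "('s, 'a) mdp \<Rightarrow> ('s, 'a) fpath \<Rightarrow> int" where
  "acc_weight M \<pi> = (\<Sum>i < path_length \<pi>. wgt M (nth_state \<pi> i) (nth_action \<pi> i))"

text \<open>Maximal paths are infinite or end in a state without enabled actions.\<close>

datatype ('s, 'a) mpath =
  Finite_Path 's "('a \<times> 's) list"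
| Infinite_Path 's "('a \<times> 's) stream"

fun path_prefix :: "('s, 'a) fpath \<Rightarrow> ('s, 'a) mpath \<Rightarrow> bool" where
  "path_prefix (s, xs) (Finite_Path t ys) \<longleftrightarrow> s = t \<and> prefix xs ys"
| "path_prefix (s, xs) (Infinite_Path t w) \<longleftrightarrow> s = t \<and> xs = stake (length xs) w"

fun ends_terminal :: "('s, 'a) mdp \<Rightarrow> ('s, 'a) mpath \<Rightarrow> bool" where
  "ends_terminal M (Finite_Path s xs) \<longleftrightarrow> enabled M (last_state (s, xs)) = {}"
| "ends_terminal M (Infinite_Path s w) \<longleftrightarrow> True"

definition maximal_paths :: "('s, 'a) mdp \<Rightarrow> 's \<Rightarrow> ('s, 'a) mpath set" where
  "maximal_paths M s =
     {\<zeta>. (\<forall>\<pi>. path_prefix \<pi> \<zeta> \<longrightarrow> \<pi> \<in> finite_paths M s) \<and> ends_terminal M \<zeta>}"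

definition cylinder :: "('s, 'a) mdp \<Rightarrow> 's \<Rightarrow> ('s, 'a) fpath \<Rightarrow> ('s, 'a) mpath set" where
  "cylinder M s \<pi> = {\<zeta> \<in> maximal_paths M s. path_prefix \<pi> \<zeta>}"

type_synonym ('s, 'a) scheduler = "('s, 'a) fpath \<Rightarrow> 'a pmf"

definition schedulers :: "('s, 'a) mdp \<Rightarrow> ('s, 'a) scheduler set" where
  "schedulers M = {\<sigma>. \<forall>s \<in> states M. \<forall>\<pi> \<in> finite_paths M s.
     enabled M (last_state \<pi>) \<noteq> {} \<longrightarrow> set_pmf (\<sigma> \<pi>) \<subseteq> enabled M (last_state \<pi>)}"

definition path_prob :: "('s, 'a) mdp \<Rightarrow> ('s, 'a) scheduler \<Rightarrow> ('s, 'a) fpath \<Rightarrow> real" where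
  "path_prob M \<sigma> \<pi> = (\<Prod>i < path_length \<pi>.
     pmf (\<sigma> (take_path i \<pi>)) (nth_action \<pi> i) *
     of_rat (tprob M (nth_state \<pi> i) (nth_action \<pi> i) (nth_state \<pi> (Suc i))))"

text \<open>
  The probability measure is determined by its values on cylinder sets, because the cylinder sets
  together with the empty set are closed under intersection.
\<close>

definition path_measure ::
  "('s, 'a) mdp \<Rightarrow> ('s, 'a) scheduler \<Rightarrow> 's \<Rightarrow> ('s, 'a) mpath measure" where
  "path_measure M \<sigma> s =
     extend_measure (maximal_paths M s) (finite_paths M s) (cylinder M s)
       (\<lambda>\<pi>. ennreal (path_prob M \<sigma> \<pi>))"

definition Pr_max :: "('s, 'a) mdp \<Rightarrow> 's \<Rightarrow> ('s, 'a) mpath set \<Rightarrow> real" where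
  "Pr_max M s E = (SUP \<sigma> \<in> schedulers M. measure (path_measure M \<sigma> s) E)"

definition Pr_min :: "('s, 'a) mdp \<Rightarrow> 's \<Rightarrow> ('s, 'a) mpath set \<Rightarrow> real" where
  "Pr_min M s E = (INF \<sigma> \<in> schedulers M. measure (path_measure M \<sigma> s) E)"

definition eventually_negative :: "('s, 'a) mdp \<Rightarrow> 's \<Rightarrow> ('s, 'a) mpath set" where
  "eventually_negative M s =
     {\<zeta> \<in> maximal_paths M s. \<exists>\<pi>. path_prefix \<pi> \<zeta> \<and> acc_weight M \<pi> < 0}"

text \<open>
  Instances are presented with states \<open>{0..<n}\<close> and actions \<open>{0..<m}\<close>, which is no restriction up to
  isomorphism. The numbers \<open>n\<close> and \<open>m\<close> can be read off from the lengths of the encoded tables.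
\<close>

definition threshold_instance :: "(nat, nat) mdp \<Rightarrow> rat \<Rightarrow> bool" where
  "threshold_instance M \<theta> \<longleftrightarrow>
     finite_mdp M \<and> (\<exists>n. states M = {0..<n}) \<and> (\<exists>m. actions M = {0..<m}) \<and> 0 < \<theta> \<and> \<theta> < 1"

definition enc_mdp :: "(nat, nat) mdp \<Rightarrow> bool list" where
  "enc_mdp M =
     (let ss = [0..<card (states M)]; as = [0..<card (actions M)]
      in enc_list (\<lambda>s. enc_list (\<lambda>a. enc_int (wgt M s a) @ enc_list (\<lambda>t. enc_rat (tprob M s a t)) ss) as) ss
         @ enc_nat (init M))"

definition enc_threshold :: "(nat, nat) mdp \<Rightarrow> rat \<Rightarrow> bool list" where
  "enc_threshold M \<theta> = enc_mdp M @ enc_rat \<theta>"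

definition max_negative_weight_problem :: decision_problem where
  "max_negative_weight_problem =
     \<lparr>instances = {enc_threshold M \<theta> | M \<theta>. threshold_instance M \<theta>},
      yes_instances = {enc_threshold M \<theta> | M \<theta>. threshold_instance M \<theta> \<and>
        Pr_max M (init M) (eventually_negative M (init M)) > of_rat \<theta>}\<rparr>"

definition min_negative_weight_problem :: decision_problem where
  "min_negative_weight_problem =
     \<lparr>instances = {enc_threshold M \<theta> | M \<theta>. threshold_instance M \<theta>},
      yes_instances = {enc_threshold M \<theta> | M \<theta>. threshold_instance M \<theta> \<and>
        Pr_min M (init M) (eventually_negative M (init M)) < of_rat \<theta>}\<rparr>"

end

theory Submission
  imports Defs "HOL-Library.Nat_Bijection"
begin

text \<open>
  We scale the given recurrence \<open>u\<close> by \<open>\<lambda>\<^sup>n\<close> for a small positive \<open>\<lambda>\<close> and realise it by a Markov chain with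
  a counter, which occurs in two copies with opposite signs: after the counter has been set to \<open>n\<close>, the
  probabilities to reach a negative value in the two copies differ by a positive multiple of \<open>u n\<close>. The chain
  reads the input bit by bit: multiplication by a denominator or by a numerator, up to a power of \<open>1/2\<close>, is
  a comparison with random bits, and a coefficient \<open>\<alpha>\<^sub>l\<close> decreases the counter by \<open>l\<close>. Multiplying by all
  denominators in every unit step makes the scaling uniform. As an initial value \<open>\<beta>\<^sub>j\<close> may follow only if
  the previous index is at least the order of the recurrence, the last coefficient and the initial value are
  related by moving two pebbles simultaneously.

  The process first sets the counter to \<open>n\<close> with probability \<open>2\<^sup>-\<^sup>n\<^sup>-\<^sup>1\<close> and then lets the scheduler choose the sign.
  With probability \<open>1/2\<close> it runs instead a counter-free chain that complements the probability obtained
  from one fixed sign. Hence the fixed choice yields exactly \<open>1/2\<close>, and a better one exists if and only if \<open>u\<close> has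
  a negative term.

  The table of transition probabilities lists, for all tuples of positions of the input, a word determined
  by finitely many residuals of the input marked at these positions. A Turing machine produces it by sweeping
  over the input and incrementing the tuple like an odometer.
\<close>

section \<open>Functions with finitely many residuals\<close>

text \<open>The machine never computes with the coefficients. As the chain itself carries out the
  arithmetic at random, an entry of the transition table depends only on equality, adjacency and
  syntactic class of boundedly many positions. This is why a finite automaton can produce it and why
  the table has polynomial size.

  Each unit of the index costs one decrement, one branching probability \<open>1/4\<close> and one
  full pass. Hence all derivations from index \<open>n\<close> to an initial value carry the same
  power of the scaling factor, times the product of the selected rationals. A negative coefficient
  swaps the two copies; a counter that becomes negative too early is a hit in both of them and
  cancels in the difference.

  The probability under the fixed sign is an infinite weighted sum that offers no evident threshold.
  Averaging it with its complement replaces it by a constant that the machine can simply write down.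
  Every counter value is offered to the scheduler with positive probability, so a gain at a single
  index already makes the inequality strict.\<close>

definition regular :: "('l list \<Rightarrow> 'b) \<Rightarrow> bool" where
  "regular F \<longleftrightarrow> finite (range (\<lambda>v u. F (v @ u)))"

text \<open>A residual depends only on the state reached after \<open>v\<close>, as in the easy half
  of the Myhill-Nerode theorem, with outputs of any type. Working with residuals instead of automata
  spares the closure properties below a product construction.\<close>

lemma regular_foldl:
  assumes "finite Q" "q0 \<in> Q" "\<And>q a. q \<in> Q \<Longrightarrow> d q a \<in> Q" "\<And>v. F v = g (foldl d q0 v)"
  shows "regular F"
proof -
  have fold: "foldl d q0 v \<in> Q" for v
    by (induction v rule: rev_induct) (use assms in auto)
  have "range (\<lambda>v u. F (v @ u)) \<subseteq> (\<lambda>q u. g (foldl d q u)) ` Q"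
    using fold by (auto simp: assms(4))
  then show ?thesis
    unfolding regular_def using assms(1) by (meson finite_imageI finite_subset)
qed

lemma regular_const: "regular (\<lambda>v. c)"
  unfolding regular_def by simp

lemma regular_comp:
  assumes "regular F"
  shows "regular (\<lambda>v. g (F v))"
proof -
  have "range (\<lambda>v u. g (F (v @ u))) = (\<lambda>r u. g (r u)) ` range (\<lambda>v u. F (v @ u))"
    by auto
  then show ?thesis
    using assms unfolding regular_def by simp
qed

lemma regular_finite_range:
  assumes "regular F"
  shows "finite (range F)"
proof -
  have "range F = (\<lambda>r. r []) ` range (\<lambda>v u. F (v @ u))"
    by (auto simp: image_iff)
  then show ?thesis
    using assms unfolding regular_def by simp
qed

text \<open>The residual of the composite at \<open>v\<close> is recovered from the residual of
  \<open>F\<close> and the residuals of \<open>G y\<close> at \<open>v\<close>, for the finitely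
  many values \<open>y\<close> of \<open>F\<close>. So a regular function may choose among an
  infinite family of regular ones, as when \<open>word_slots\<close> chooses the updates to be
  counted.\<close>

lemma regular_bind:
  assumes F: "regular F" and G: "\<And>y. regular (G y)"
  shows "regular (\<lambda>v. G (F v) v)"
proof -
  let ?R = "\<lambda>F v u. F (v @ u)"
  let ?E = "PiE (range F) (\<lambda>y. range (?R (G y)))"
  have "range (?R (\<lambda>v. G (F v) v)) \<subseteq> (\<lambda>(r, s) u. s (r u) u) ` (range (?R F) \<times> ?E)"
  proof safe
    fix v
    \<comment> \<open>Restricting the family to the range of \<open>F\<close> places it in a finite
      dependent product.\<close>
    have "?R (\<lambda>v. G (F v) v) v =
        (\<lambda>(r, s) u. s (r u) u) (?R F v, restrict (\<lambda>y. ?R (G y) v) (range F))"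
      by auto
    moreover have "(?R F v, restrict (\<lambda>y. ?R (G y) v) (range F)) \<in> range (?R F) \<times> ?E"
      by auto
    ultimately show "?R (\<lambda>v. G (F v) v) v \<in> (\<lambda>(r, s) u. s (r u) u) ` (range (?R F) \<times> ?E)"
      by (rule image_eqI)
  qed
  moreover have "finite (range (?R F) \<times> ?E)"
    using F G regular_finite_range[OF F] unfolding regular_def by (auto intro!: finite_PiE)
  ultimately show ?thesis
    unfolding regular_def by (meson finite_imageI finite_subset)
qed

lemma regular_comp2:
  assumes "regular F" "regular G"
  shows "regular (\<lambda>v. g (F v) (G v))"
  using regular_bind[of F "\<lambda>y v. g y (G v)"] assms regular_comp by blast

lemma regular_map:
  assumes "\<And>x. x \<in> set xs \<Longrightarrow> regular (F x)"
  shows "regular (\<lambda>v. map (\<lambda>x. F x v) xs)"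
  using assms by (induction xs) (auto intro: regular_const regular_comp2)

section \<open>A sweeping Turing machine\<close>

type_synonym letter = "bool \<times> nat set"

definition digit :: "nat \<Rightarrow> nat \<Rightarrow> nat \<Rightarrow> nat" where
  "digit L r N = N div L ^ r mod L"

text \<open>A number below \<open>L ^ m\<close> is displayed as \<open>m\<close> pebbles on a word
  of length \<open>L\<close>: mark \<open>r\<close> sits at the position given by the
  base-\<open>L\<close> digit with index \<open>r\<close>, where index 0 is the least significant
  one.\<close>

definition mark_word :: "nat \<Rightarrow> bool list \<Rightarrow> nat \<Rightarrow> letter list" where
  "mark_word m w N = map (\<lambda>p. (w ! p, {r. r < m \<and> digit (length w) r N = p})) [0..<length w]"

lemma length_mark_word [simp]: "length (mark_word m w N) = length w"
  by (simp add: mark_word_def)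

text \<open>Incrementing at digit \<open>r\<close> keeps the marks above \<open>r\<close>, sends
  those below \<open>r\<close> to the first position and moves \<open>r\<close> one position to the
  right; \<open>carry\<close> says that the letter just passed held \<open>r\<close>. With
  \<open>r = m\<close> all marks are placed on the first letter, which initialises the
  odometer.\<close>

definition new_marks :: "nat \<Rightarrow> nat \<Rightarrow> bool \<Rightarrow> bool \<Rightarrow> nat set \<Rightarrow> nat set" where
  "new_marks m r first carry S =
     ({j \<in> S. r < j} \<union> (if first then {j. j < r} else {}) \<union> (if carry then {r} else {})) \<inter> {..<m}"

fun update_marks :: "nat \<Rightarrow> nat \<Rightarrow> bool \<Rightarrow> bool \<Rightarrow> letter list \<Rightarrow> letter list" where
  "update_marks m r first carry [] = []"
| "update_marks m r first carry (a # v) =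
     (fst a, new_marks m r first carry (snd a)) # update_marks m r False (r \<in> snd a) v"

lemma length_update_marks [simp]: "length (update_marks m r f c v) = length v"
  by (induction v arbitrary: f c) auto

lemma update_marks_eq_Nil_iff [simp]: "update_marks m r f c v = [] \<longleftrightarrow> v = []"
  by (cases v) auto

lemma nth_update_marks:
  "p < length v \<Longrightarrow> update_marks m r f c v ! p =
     (fst (v ! p), new_marks m r (f \<and> p = 0) (if p = 0 then c else r \<in> snd (v ! (p - 1))) (snd (v ! p)))"
proof (induction v arbitrary: f c p)
  case (Cons a v)
  then show ?case
    by (cases p) (auto simp: nth_Cons split: nat.splits)
qed simp

lemma power_split_less: "j < r \<Longrightarrow> L ^ r = L ^ j * (L * L ^ (r - Suc j))" for L :: nat
  by (simp flip: power_Suc power_add)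

lemma mod_power_eq_digits:
  assumes "\<And>j. j < r \<Longrightarrow> digit L j N = L - 1" "0 < L"
  shows "N mod L ^ r = L ^ r - 1"
  using assms(1)
proof (induction r)
  case (Suc r)
  have "N mod L ^ Suc r = L ^ r * (N div L ^ r mod L) + N mod L ^ r"
    by (metis mod_mult2_eq mult.commute power_Suc)
  also have "\<dots> = L ^ r * (L - 1) + (L ^ r - 1)"
    using Suc by (simp add: digit_def)
  also have "\<dots> = L ^ Suc r - 1"
    using assms(2) by (simp add: algebra_simps diff_mult_distrib2)
  finally show ?case .
qed auto

text \<open>Maximal low digits mean that \<open>N\<close> is -1 modulo \<open>L ^ r\<close>, so
  \<open>Suc N\<close> is \<open>L ^ r\<close> times \<open>Suc (N div L ^ r)\<close>; as the next
  digit is not maximal, the carry stops there.\<close>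

lemma digit_Suc:
  assumes low: "\<And>j. j < r \<Longrightarrow> digit L j N = L - 1" and neq: "digit L r N \<noteq> L - 1" and L: "0 < L"
  shows "j < r \<Longrightarrow> digit L j (Suc N) = 0"
    and "digit L r (Suc N) = Suc (digit L r N)"
    and "r < j \<Longrightarrow> digit L j (Suc N) = digit L j N"
proof -
  let ?B = "L ^ r"
  have B: "0 < ?B"
    using L by simp
  have "N mod ?B = ?B - 1"
    using mod_power_eq_digits[OF low L] .
  then have S: "Suc N = ?B * Suc (N div ?B)"
    using B by (metis Suc_pred' add_Suc_right mult_Suc_right mult_div_mod_eq add.commute)
  show "digit L j (Suc N) = 0" if "j < r"
  proof -
    have "?B = L ^ j * (L * L ^ (r - Suc j))"
      using that by (rule power_split_less)
    then show ?thesis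
      unfolding digit_def S using L by (simp add: mult.assoc)
  qed
  have d: "Suc N div ?B = Suc (N div ?B)"
    unfolding S using B by simp
  have lt: "Suc (N div ?B mod L) < L"
    using neq L mod_less_divisor[of L "N div ?B"] unfolding digit_def by linarith
  then show "digit L r (Suc N) = Suc (digit L r N)"
    unfolding digit_def d by (simp add: mod_Suc)
  show "digit L j (Suc N) = digit L j N" if "r < j"
  proof -
    have "L ^ j = ?B * (L * L ^ (j - Suc r))"
      using that by (rule power_split_less)
    then have e: "M div L ^ j = M div ?B div L div L ^ (j - Suc r)" for M
      by (simp add: div_mult2_eq)
    have "Suc (N div ?B) div L = N div ?B div L"
      using lt by (simp add: div_Suc mod_Suc)
    then show ?thesis
      unfolding digit_def e d by simp
  qed
qed

lemma update_marks_blank: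
  "update_marks m m True False (map (\<lambda>b. (b, {})) w) = mark_word m w 0"
  by (rule nth_equalityI)
    (auto simp: nth_update_marks mark_word_def new_marks_def digit_def)

text \<open>Every changed mark goes to the first letter or to its right neighbour, so one sweep from
  left to right performs the increment, provided that the digit \<open>r\<close> receiving the carry
  is known at its start.\<close>

lemma update_marks_mark_word:
  assumes "\<And>j. j < r \<Longrightarrow> digit (length w) j N = length w - 1"
    "digit (length w) r N \<noteq> length w - 1" "r < m" "w \<noteq> []"
  shows "update_marks m r True False (mark_word m w N) = mark_word m w (Suc N)"
proof -
  have L: "0 < length w"
    using assms by simp
  note D = digit_Suc[OF assms(1,2) L, simplified]
  show ?thesis
  proof (rule nth_equalityI)
    fix p
    assume "p < length (update_marks m r True False (mark_word m w N))"
    then have p: "p < length w"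
      by (simp add: mark_word_def)
    have "new_marks m r (p = 0)
        (if p = 0 then False else r \<in> {j. j < m \<and> digit (length w) j N = p - 1})
        {j. j < m \<and> digit (length w) j N = p} =
      {j. j < m \<and> digit (length w) j (Suc N) = p}" (is "?A = ?B")
    proof (intro set_eqI)
      fix j
      show "j \<in> ?A \<longleftrightarrow> j \<in> ?B"
        using D assms(3) by (cases j r rule: linorder_cases) (auto simp: new_marks_def)
    qed
    moreover have "mark_word m w M ! q = (w ! q, {j. j < m \<and> digit (length w) j M = q})"
      if "q < length w" for M q
      using that by (simp add: mark_word_def)
    ultimately show "update_marks m r True False (mark_word m w N) ! p = mark_word m w (Suc N) ! p"
      using p by (cases "p = 0") (simp_all add: nth_update_marks)
  qed (simp add: mark_word_def)
qed

text \<open>\<open>0\<close> is reserved for the blank, and an unmarked bit gets the code that it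
  already has on the input tape, so the first sweep can start on the raw input. The parity recovers
  the bit, \<open>True\<close> being even.\<close>

definition symbol_of :: "letter \<Rightarrow> nat" where
  "symbol_of a = 1 + (if fst a then 1 else 0) + 2 * set_encode (snd a)"

definition letter_of :: "nat \<Rightarrow> letter" where
  "letter_of x = (even x, set_decode ((x - 1) div 2))"

lemma letter_of_symbol_of: "finite (snd a) \<Longrightarrow> letter_of (symbol_of a) = a"
  by (cases a) (auto simp: symbol_of_def letter_of_def)

lemma symbol_of_neq_0 [simp]: "symbol_of a \<noteq> 0"
  by (simp add: symbol_of_def)

lemma symbol_of_bound:
  assumes "snd a \<subseteq> {..<m}"
  shows "symbol_of a < 2 ^ Suc m + 1"
proof -
  have "set_encode (snd a) \<le> (\<Sum>i<m. 2 ^ i)"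
    unfolding set_encode_def using assms by (intro sum_mono2) auto
  also have "\<dots> < 2 ^ m"
    by (simp add: sum_power2 atLeast0LessThan[symmetric])
  finally show ?thesis
    by (auto simp: symbol_of_def)
qed

section \<open>Finite control of the sweeping machine\<close>

datatype 'r sweep_state =
  Sweep nat bool bool 'r "nat set"
| Emit "bool list" "nat option"

text \<open>
  During a sweep, the residual function of the letters passed so far is stored in the state. In the state
  \<open>Emit [] (Some r)\<close> the head returns to the left end. The marks of the last letter are those of the digits
  with the largest value, so the least absent one is the digit to be incremented next.
\<close>

type_synonym residual = "letter list \<Rightarrow> bool list"

fun sweep_delta :: "nat \<Rightarrow> residual \<Rightarrow> bool list \<Rightarrow> residual sweep_state \<Rightarrow> nat \<Rightarrow> nat \<Rightarrow>
    (residual sweep_state \<times> (nat \<times> move) \<times> (nat \<times> move)) option" where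
  "sweep_delta m out fin (Sweep r f c q R) x y =
     (if x \<noteq> 0
      then let a = (fst (letter_of x), new_marks m r f c (snd (letter_of x)))
        in Some (Sweep r False (r \<in> snd (letter_of x)) (\<lambda>u. q (a # u)) (snd a),
             (symbol_of a, Move_Right), (y, Stay))
      else let r' = (LEAST j. j \<notin> R)
        in Some (if r' < m then Emit (q []) (Some r') else Emit (q [] @ fin) None,
             (0, Move_Left), (y, Stay)))"
| "sweep_delta m out fin (Emit (b # bs) next) x y =
     Some (Emit bs next, (x, Stay), (if b then 2 else 1, Move_Right))"
| "sweep_delta m out fin (Emit [] None) x y = None"
| "sweep_delta m out fin (Emit [] (Some r)) x y =
     (if x \<noteq> 0 then Some (Emit [] (Some r), (x, Move_Left), (y, Stay))
      else Some (Sweep r True False out {}, (x, Move_Right), (y, Stay)))"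

text \<open>A set closed under transitions that is finite by regularity: there are finitely many
  residuals, and the words still to be written are suffixes of finitely many outputs, possibly
  extended by \<open>fin\<close>.\<close>

definition sweep_states :: "nat \<Rightarrow> residual \<Rightarrow> bool list \<Rightarrow> residual sweep_state set" where
  "sweep_states m out fin =
     (\<lambda>(r, f, c, q, R). Sweep r f c q R) `
       ({..m} \<times> UNIV \<times> UNIV \<times> range (\<lambda>v u. out (v @ u)) \<times> Pow {..<m}) \<union>
     (\<lambda>(bs, next). Emit bs next) `
       ({bs. \<exists>v cs. suffix bs (out v @ cs) \<and> cs \<in> {[], fin}} \<times> insert None (Some ` {..m}))"

lemma Sweep_in_sweep_states:
  "Sweep r f c q R \<in> sweep_states m out fin \<longleftrightarrow>
     r \<le> m \<and> (\<exists>v. q = (\<lambda>u. out (v @ u))) \<and> R \<subseteq> {..<m}"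
  unfolding sweep_states_def by (auto simp: image_iff)

lemma Emit_in_sweep_states:
  "Emit bs next \<in> sweep_states m out fin \<longleftrightarrow>
     (\<exists>v cs. suffix bs (out v @ cs) \<and> cs \<in> {[], fin}) \<and> (\<forall>r. next = Some r \<longrightarrow> r \<le> m)"
  unfolding sweep_states_def by (cases "next") (auto simp: image_iff)

lemma finite_sweep_states:
  assumes "regular out"
  shows "finite (sweep_states m out fin)"
proof -
  have "{bs. \<exists>v cs. suffix bs (out v @ cs) \<and> cs \<in> {[], fin}} =
      (\<Union>xs \<in> range out. set (suffixes xs) \<union> set (suffixes (xs @ fin)))"
    by (auto simp: in_set_suffixes) (metis append_Nil2, blast)
  then have "finite {bs. \<exists>v cs. suffix bs (out v @ cs) \<and> cs \<in> {[], fin}}"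
    using regular_finite_range[OF assms] by (simp only:) (intro finite_UN_I finite_UnI finite_set)
  moreover have "finite (range (\<lambda>v u. out (v @ u)))"
    using assms unfolding regular_def .
  ultimately show ?thesis
    unfolding sweep_states_def
    by (intro finite_UnI; intro finite_imageI; intro finite_cartesian_product; simp)
qed

lemma sweep_delta_closed:
  assumes "sweep_delta m out fin q x y = Some (q', (x', d), (y', e))" "q \<in> sweep_states m out fin"
  shows "q' \<in> sweep_states m out fin"
    and "x < 2 ^ Suc m + 1 \<Longrightarrow> x' < 2 ^ Suc m + 1"
    and "y < 2 ^ Suc m + 1 \<Longrightarrow> y' < 2 ^ Suc m + 1"
proof -
  have pow: "2 < (2 :: nat) ^ Suc m + 1"
  proof -
    have "1 \<le> (2 :: nat) ^ m"
      by simp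
    then show ?thesis
      unfolding power_Suc by linarith
  qed
  have "q' \<in> sweep_states m out fin \<and> (x < 2 ^ Suc m + 1 \<longrightarrow> x' < 2 ^ Suc m + 1) \<and>
      (y < 2 ^ Suc m + 1 \<longrightarrow> y' < 2 ^ Suc m + 1)"
  proof (cases "(m, out, fin, q, x, y)" rule: sweep_delta.cases)
    case (1 m' out' fin' r f c p R x y)
    then obtain v where v: "r \<le> m" "p = (\<lambda>u. out (v @ u))" "R \<subseteq> {..<m}"
      using assms(2) by (auto simp: Sweep_in_sweep_states)
    have out_v: "Emit (out v @ cs) next \<in> sweep_states m out fin"
      if "cs \<in> {[], fin}" "\<forall>r. next = Some r \<longrightarrow> r \<le> m" for cs "next"
      using that unfolding Emit_in_sweep_states by blast
    show ?thesis
    proof (cases "x = 0")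
      case False
      let ?a = "(fst (letter_of x), new_marks m r f c (snd (letter_of x)))"
      have "new_marks m r f c (snd (letter_of x)) \<subseteq> {..<m}"
        by (auto simp: new_marks_def)
      moreover have "(\<lambda>u. p (?a # u)) = (\<lambda>u. out ((v @ [?a]) @ u))"
        by (simp add: v)
      ultimately show ?thesis
        using assms(1) 1 False v(1) symbol_of_bound[of ?a m]
        by (auto simp: Sweep_in_sweep_states Let_def simp del: append_assoc)
    next
      case True
      then show ?thesis
        using assms(1) 1 v out_v[of "[]" "Some (LEAST j. j \<notin> R)"] out_v[of fin None]
        by (auto simp: Let_def split: if_splits)
    qed
  next
    case (2 m' out' fin' b bs nxt x y)
    then show ?thesis
      using assms pow by (auto simp: Emit_in_sweep_states) (metis append_Nil2 suffix_ConsD)+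
  next
    case 3
    then show ?thesis
      using assms by auto
  next
    case (4 m' out' fin' r x y)
    moreover have "Sweep i True False out {} \<in> sweep_states m out fin" if "i \<le> m" for i
      using that by (auto simp: Sweep_in_sweep_states intro!: exI[of _ "[]"])
    ultimately show ?thesis
      using assms by (auto simp: Emit_in_sweep_states split: if_splits)
  qed
  then show "q' \<in> sweep_states m out fin"
    and "x < 2 ^ Suc m + 1 \<Longrightarrow> x' < 2 ^ Suc m + 1"
    and "y < 2 ^ Suc m + 1 \<Longrightarrow> y' < 2 ^ Suc m + 1"
    by auto
qed

section \<open>Runs of the machine and their length\<close>

fun nsteps :: "('c \<Rightarrow> 'c option) \<Rightarrow> nat \<Rightarrow> 'c \<Rightarrow> 'c \<Rightarrow> bool" where
  "nsteps f 0 c c' \<longleftrightarrow> c = c'"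
| "nsteps f (Suc n) c c' \<longleftrightarrow> (\<exists>d. f c = Some d \<and> nsteps f n d c')"

lemma nsteps_add: "nsteps f n a b \<Longrightarrow> nsteps f k b c \<Longrightarrow> nsteps f (n + k) a c"
  by (induction n arbitrary: a) auto

lemma tm_run_nsteps:
  assumes "nsteps (tm_step T) n c c'" "tm_step T c' = None" "n \<le> t"
  shows "tm_run T t c = c'"
  using assms
proof (induction n arbitrary: c t)
  case 0
  then show ?case
    by (cases t) auto
next
  case (Suc n)
  then show ?case
    by (cases t) auto
qed

type_synonym sweep_config = "residual sweep_state \<times> tape \<times> tape"

definition sweep_step :: "nat \<Rightarrow> residual \<Rightarrow> bool list \<Rightarrow> sweep_config \<Rightarrow> sweep_config option" where
  "sweep_step m out fin = (\<lambda>(q, s, t).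
     case sweep_delta m out fin q (read_tape s) (read_tape t) of
       None \<Rightarrow> None
     | Some (q', a, b) \<Rightarrow> Some (q', update_tape a s, update_tape b t))"

definition letter_tape :: "letter list \<Rightarrow> int \<Rightarrow> nat" where
  "letter_tape v i = (if 0 \<le> i \<and> i < int (length v) then symbol_of (v ! nat i) else 0)"

lemma letter_tape_blank: "letter_tape (map (\<lambda>b. (b, {})) w) = tape_contents w"
  by (auto simp: letter_tape_def tape_contents_def symbol_of_def fun_eq_iff)

lemma letter_tape_outside [simp]:
  "letter_tape v (int (length v)) = 0" "letter_tape v (- 1) = 0"
  by (auto simp: letter_tape_def)

lemma letter_tape_append: "letter_tape (pre @ a # v) (int (length pre)) = symbol_of a"
  by (simp add: letter_tape_def)

lemma letter_tape_upd:
  "(letter_tape (pre @ a # v))(int (length pre) := symbol_of b) = letter_tape (pre @ b # v)"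
  by (auto simp: letter_tape_def fun_eq_iff nth_append nth_Cons split: nat.splits)

lemma tape_contents_snoc:
  "(tape_contents bs)(int (length bs) := if b then 2 else 1) = tape_contents (bs @ [b])"
  by (auto simp: tape_contents_def fun_eq_iff nth_append)

text \<open>\<open>pre\<close> is the part already rewritten, so the induction can peel letters off
  the unread part while the residual in the state absorbs them.\<close>

lemma sweep_right:
  assumes "\<And>a. a \<in> set v \<Longrightarrow> finite (snd a)"
  shows "\<exists>f' c'. nsteps (sweep_step m out fin) (length v)
    (Sweep r f c q R, (letter_tape (pre @ v), int (length pre)), t)
    (Sweep r f' c' (\<lambda>u. q (update_marks m r f c v @ u))
       (if v = [] then R else snd (last (update_marks m r f c v))),
     (letter_tape (pre @ update_marks m r f c v), int (length pre + length v)), t)"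
  using assms
proof (induction v arbitrary: pre f c q R)
  case (Cons a v)
  let ?b = "(fst a, new_marks m r f c (snd a))"
  have un: "letter_of (symbol_of a) = a"
    using Cons.prems by (simp add: letter_of_symbol_of)
  have step: "sweep_step m out fin (Sweep r f c q R, (letter_tape (pre @ a # v), int (length pre)), t) =
      Some (Sweep r False (r \<in> snd a) (\<lambda>u. q (?b # u)) (snd ?b),
        (letter_tape ((pre @ [?b]) @ v), int (length (pre @ [?b]))), t)"
    by (cases t) (simp add: sweep_step_def read_tape_def update_tape_def letter_tape_append un Let_def
        letter_tape_upd)
  obtain f' c' where "nsteps (sweep_step m out fin) (length v)
      (Sweep r False (r \<in> snd a) (\<lambda>u. q (?b # u)) (snd ?b),
        (letter_tape ((pre @ [?b]) @ v), int (length (pre @ [?b]))), t)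
      (Sweep r f' c' (\<lambda>u. q (?b # update_marks m r False (r \<in> snd a) v @ u))
        (if v = [] then snd ?b else snd (last (update_marks m r False (r \<in> snd a) v))),
       (letter_tape ((pre @ [?b]) @ update_marks m r False (r \<in> snd a) v),
        int (length (pre @ [?b]) + length v)), t)"
    using Cons.IH[of False "r \<in> snd a" "\<lambda>u. q (?b # u)" "snd ?b" "pre @ [?b]"] Cons.prems
    by auto
  then show ?case
    using step by - (rule exI[of _ f'], rule exI[of _ c'], cases "v = []", simp_all)
qed auto

lemma emit_run:
  "nsteps (sweep_step m out fin) (length bs)
     (Emit bs next, s, (tape_contents cs, int (length cs)))
     (Emit [] next, s, (tape_contents (cs @ bs), int (length (cs @ bs))))"
proof (induction bs arbitrary: cs)
  case (Cons b bs)
  have "sweep_step m out fin (Emit (b # bs) next, s, (tape_contents cs, int (length cs))) =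
      Some (Emit bs next, s, (tape_contents (cs @ [b]), int (length (cs @ [b]))))"
    by (cases s) (simp add: sweep_step_def read_tape_def update_tape_def
        tape_contents_snoc[of cs b, simplified])
  with Cons[of "cs @ [b]"] show ?case
    by auto
qed auto

text \<open>The head starts at \<open>k - 1\<close> because the sweep has already stepped back from
  the blank behind the word; \<open>k\<close> moves reach the blank at -1, and one more step turns
  to the right.\<close>

lemma return_left:
  assumes "k \<le> length v"
  shows "nsteps (sweep_step m out fin) (Suc k)
     (Emit [] (Some r), (letter_tape v, int k - 1), t)
     (Sweep r True False out {}, (letter_tape v, 0), t)"
  using assms
proof (induction k)
  case 0
  have "(letter_tape v)(- 1 := 0) = letter_tape v"
    by (simp add: fun_upd_idem)
  then show ?case
    by (cases t) (simp add: sweep_step_def read_tape_def update_tape_def)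
next
  case (Suc k)
  have "sweep_step m out fin (Emit [] (Some r), (letter_tape v, int k), t) =
      Some (Emit [] (Some r), (letter_tape v, int k - 1), t)"
    using Suc.prems by (cases t) (auto simp: sweep_step_def read_tape_def update_tape_def letter_tape_def)
  then show ?case
    using Suc by (simp del: nsteps.simps(2) add: nsteps.simps(2)[of _ "Suc k"])
qed

lemma last_mark_word:
  "w \<noteq> [] \<Longrightarrow> snd (last (mark_word m w N)) = {r. r < m \<and> digit (length w) r N = length w - 1}"
  by (simp add: mark_word_def last_map)

lemma finite_marks: "a \<in> set (mark_word m w N) \<Longrightarrow> finite (snd a)"
  by (auto simp: mark_word_def)

text \<open>A round consists of a sweep (\<open>L + 1\<close> steps), the output (at most
  \<open>K\<close>) and the return (\<open>L + 1\<close>), whence the factor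
  \<open>2 * L + 2 + K\<close>. The tape word \<open>v\<close> at the start of a round is described
  only by what the pending update makes of it; so the raw input and the word left by an earlier
  round are treated alike.\<close>

lemma sweep_run:
  assumes w: "w \<noteq> []" and K: "\<And>v. length (out v @ fin) \<le> K"
    and N: "N < length w ^ m"
    and v: "update_marks m r True False v = mark_word m w N" "\<And>a. a \<in> set v \<Longrightarrow> finite (snd a)"
  shows "\<exists>n s i. n \<le> (length w ^ m - N) * (2 * length w + 2 + K) \<and>
    nsteps (sweep_step m out fin) n
      (Sweep r True False out {}, (letter_tape v, 0), (tape_contents cs, int (length cs)))
      (Emit [] None, s,
       (tape_contents (cs @ concat (map (\<lambda>M. out (mark_word m w M)) [N..<length w ^ m]) @ fin), i))"
  using N v
proof (induction "length w ^ m - N" arbitrary: N r v cs rule: less_induct)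
  case less
  let ?L = "length w" and ?S = "sweep_step m out fin" and ?o = "out (mark_word m w N)"
  let ?t = "(tape_contents cs, int (length cs))"
  define R where "R = {r. r < m \<and> digit ?L r N = ?L - 1}"
  have len: "length v = ?L"
    using less.prems(2) by (metis length_update_marks length_mark_word)
  then have ne: "v \<noteq> []"
    using w by auto
  obtain f' c' where 1: "nsteps ?S ?L (Sweep r True False out {}, (letter_tape v, 0), ?t)
      (Sweep r f' c' (\<lambda>u. out (mark_word m w N @ u)) R, (letter_tape (mark_word m w N), int ?L), ?t)"
    using sweep_right[OF less.prems(3), of v m out fin r True False out "{}" "[]" ?t] ne len w
    by (auto simp: less.prems(2) last_mark_word R_def)
  \<comment> \<open>\<open>R\<close> lies below \<open>m\<close>, so the least missing index is at
    most \<open>m\<close>, and it equals \<open>m\<close> only if all digits are maximal.\<close>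
  define r' where "r' = (LEAST j. j \<notin> R)"
  have r': "r' \<notin> R" "\<And>j. j < r' \<Longrightarrow> j \<in> R"
    unfolding r'_def by (rule LeastI[of _ m], simp add: R_def) (use not_less_Least in blast)
  have low: "\<And>j. j < r' \<Longrightarrow> digit ?L j N = ?L - 1"
    using r'(2) by (auto simp: R_def)
  let ?nx = "if r' < m then Emit ?o (Some r') else Emit (?o @ fin) None"
  have 2: "nsteps ?S 1
      (Sweep r f' c' (\<lambda>u. out (mark_word m w N @ u)) R, (letter_tape (mark_word m w N), int ?L), ?t)
      (?nx, (letter_tape (mark_word m w N), int ?L - 1), ?t)"
  proof -
    have "letter_tape (mark_word m w N) (int ?L) = 0"
      using letter_tape_outside(1)[of "mark_word m w N"] by simp
    moreover from this have "(letter_tape (mark_word m w N))(int ?L := 0) = letter_tape (mark_word m w N)"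
      by (metis fun_upd_triv)
    ultimately show ?thesis
      by (simp add: sweep_step_def read_tape_def update_tape_def Let_def r'_def[symmetric])
  qed
  have pos: "?L ^ m - N = Suc (?L ^ m - Suc N)"
    using less.prems(1) by simp
  have ups: "[N..<?L ^ m] = N # [Suc N..<?L ^ m]"
    using less.prems(1) by (simp add: upt_conv_Cons)
  show ?case
  proof (cases "r' < m")
    case True
    have neq: "digit ?L r' N \<noteq> ?L - 1"
      using r'(1) True by (auto simp: R_def)
    \<comment> \<open>If \<open>Suc N\<close> were \<open>?L ^ m\<close>, its digit at
      \<open>r'\<close> would be 0, but the increment makes that digit a successor.\<close>
    have sN: "Suc N < ?L ^ m"
    proof (rule ccontr)
      assume "\<not> Suc N < ?L ^ m"
      then have "Suc N = ?L ^ m"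
        using less.prems(1) by simp
      then have "Suc N = ?L ^ r' * (?L * ?L ^ (m - Suc r'))"
        using power_split_less[OF True, of ?L] by (rule trans)
      then have "Suc N div ?L ^ r' = ?L * ?L ^ (m - Suc r')"
        using w by simp
      then have "digit ?L r' (Suc N) = 0"
        by (simp add: digit_def)
      then show False
        using digit_Suc(2)[OF low neq] w by simp
    qed
    have upd: "update_marks m r' True False (mark_word m w N) = mark_word m w (Suc N)"
      using update_marks_mark_word[OF low neq True w] .
    have 3: "nsteps ?S (length ?o) (?nx, (letter_tape (mark_word m w N), int ?L - 1), ?t)
        (Emit [] (Some r'), (letter_tape (mark_word m w N), int ?L - 1),
          (tape_contents (cs @ ?o), int (length (cs @ ?o))))"
      using True emit_run by simp
    have 4: "nsteps ?S (Suc ?L) (Emit [] (Some r'), (letter_tape (mark_word m w N), int ?L - 1),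
          (tape_contents (cs @ ?o), int (length (cs @ ?o))))
        (Sweep r' True False out {}, (letter_tape (mark_word m w N), 0),
          (tape_contents (cs @ ?o), int (length (cs @ ?o))))"
      using return_left[of ?L "mark_word m w N"] by simp
    have smaller: "?L ^ m - Suc N < ?L ^ m - N"
      using pos by simp
    obtain n s i where n: "n \<le> (?L ^ m - Suc N) * (2 * ?L + 2 + K)" and
      5: "nsteps ?S n (Sweep r' True False out {}, (letter_tape (mark_word m w N), 0),
          (tape_contents (cs @ ?o), int (length (cs @ ?o))))
        (Emit [] None, s, (tape_contents ((cs @ ?o) @
           concat (map (\<lambda>M. out (mark_word m w M)) [Suc N..<?L ^ m]) @ fin), i))"
      using less.hyps[OF smaller sN upd finite_marks[of _ m w N], where cs = "cs @ ?o"] by blast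
    show ?thesis
    proof (intro exI conjI)
      show "nsteps ?S (?L + 1 + length ?o + Suc ?L + n)
          (Sweep r True False out {}, (letter_tape v, 0), ?t)
          (Emit [] None, s,
           (tape_contents (cs @ concat (map (\<lambda>M. out (mark_word m w M)) [N..<?L ^ m]) @ fin), i))"
        using nsteps_add[OF nsteps_add[OF nsteps_add[OF nsteps_add[OF 1 2] 3] 4] 5]
        unfolding ups by (simp del: nsteps.simps)
      have "length ?o \<le> K"
        using K[of "mark_word m w N"] by simp
      then show "?L + 1 + length ?o + Suc ?L + n \<le> (?L ^ m - N) * (2 * ?L + 2 + K)"
        using n unfolding pos by simp
    qed
  next
    case False
    have "N mod ?L ^ m = ?L ^ m - 1"
      using low False w by (intro mod_power_eq_digits) auto
    then have "Suc N = ?L ^ m"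
      using less.prems(1) w by simp
    then have "[N..<?L ^ m] = [N]"
      unfolding ups by simp
    then have 3: "nsteps ?S (length (?o @ fin)) (?nx, (letter_tape (mark_word m w N), int ?L - 1), ?t)
        (Emit [] None, (letter_tape (mark_word m w N), int ?L - 1),
          (tape_contents (cs @ concat (map (\<lambda>M. out (mark_word m w M)) [N..<?L ^ m]) @ fin),
           int (length (cs @ ?o @ fin))))"
      using False emit_run[of m out fin "?o @ fin" None _ cs] by simp
    show ?thesis
    proof (intro exI conjI)
      show "nsteps ?S (?L + 1 + length (?o @ fin)) (Sweep r True False out {}, (letter_tape v, 0), ?t)
        (Emit [] None, (letter_tape (mark_word m w N), int ?L - 1),
          (tape_contents (cs @ concat (map (\<lambda>M. out (mark_word m w M)) [N..<?L ^ m]) @ fin),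
           int (length (cs @ ?o @ fin))))"
        using nsteps_add[OF nsteps_add[OF 1 2] 3] .
      show "?L + 1 + length (?o @ fin) \<le> (?L ^ m - N) * (2 * ?L + 2 + K)"
        using K[of "mark_word m w N"] unfolding pos by (simp del: length_append)
    qed
  qed
qed

text \<open>Machine states are numbers with initial state \<open>0\<close>, so the numbering has to
  send the initial control state there.\<close>

lemma ex_bij_betw_index:
  assumes "finite Q" "q0 \<in> Q"
  shows "\<exists>h. bij_betw h Q {..<card Q} \<and> h q0 = (0::nat)"
proof -
  obtain g where "bij_betw g (Q - {q0}) {..<card (Q - {q0})}"
    using assms(1) ex_bij_betw_finite_nat[of "Q - {q0}"] by (auto simp: atLeast0LessThan)
  then have g: "bij_betw (\<lambda>x. Suc (g x)) (Q - {q0}) (Suc ` {..<card (Q - {q0})})"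
    by (metis (no_types, lifting) bij_betw_trans comp_apply bij_betw_cong inj_Suc inj_on_subset
        subset_UNIV bij_betw_imageI)
  have "bij_betw (\<lambda>x. if x \<in> {q0} then 0 else Suc (g x)) ({q0} \<union> (Q - {q0}))
      ({0} \<union> Suc ` {..<card (Q - {q0})})"
    by (rule bij_betw_disjoint_Un) (use g in auto)
  moreover have "{0} \<union> Suc ` {..<card (Q - {q0})} = {..<card Q}"
    using assms card_Suc_Diff1[OF assms] by (metis lessThan_Suc_eq_insert_0 insert_is_Un)
  moreover have "{q0} \<union> (Q - {q0}) = Q"
    using assms by auto
  ultimately show ?thesis
    by (intro exI[of _ "\<lambda>x. if x \<in> {q0} then 0 else Suc (g x)"]) simp
qed

text \<open>With \<open>m\<close> fixed there are polynomially many rounds of linear length, because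
  finiteness of the range of \<open>out\<close> bounds the word emitted per round by a
  constant.\<close>

theorem poly_time_computable_marks:
  assumes reg: "regular out" and ne: "\<And>w. w \<in> D \<Longrightarrow> w \<noteq> []"
    and f: "\<And>w. w \<in> D \<Longrightarrow>
      f w = concat (map (\<lambda>N. out (mark_word m w N)) [0..<length w ^ m]) @ fin"
  shows "poly_time_computable_on D f"
proof -
  define Q where "Q = sweep_states m out fin"
  define q0 where "q0 = Sweep m True False out {}"
  have "out = (\<lambda>u. out ([] @ u))"
    by simp
  then have q0: "q0 \<in> Q"
    unfolding Q_def q0_def Sweep_in_sweep_states by blast
  have finQ: "finite Q"
    using finite_sweep_states[OF reg] by (simp add: Q_def)
  obtain h where h: "bij_betw h Q {..<card Q}" and h0: "h q0 = 0"
    using ex_bij_betw_index[OF finQ q0] by blast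
  have inv: "inv_into Q h (h q) = q" if "q \<in> Q" for q
    using h that by (simp add: bij_betw_inv_into_left)
  have inv_in: "inv_into Q h i \<in> Q" if "i < card Q" for i
    using h that by (metis bij_betw_def inv_into_into lessThan_iff)
  have h_in: "h q < card Q" if "q \<in> Q" for q
    using h that by (meson bij_betwE lessThan_iff)
  define T where "T = \<lparr>num_tapes = 2, num_states = card Q, num_symbols = 2 ^ Suc m + 1,
    delta = \<lambda>i xs. case sweep_delta m out fin (inv_into Q h i) (xs ! 0) (xs ! 1) of
       None \<Rightarrow> None | Some (q', a, b) \<Rightarrow> Some (h q', [a, b])\<rparr>"
  have "turing_machine T"
    unfolding turing_machine_def
  proof (intro conjI allI impI)
    show "1 \<le> num_states T"
      using q0 finQ by (auto simp: T_def Suc_le_eq card_gt_0_iff)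
    show "3 \<le> num_symbols T"
      using one_le_power[of "2::nat" m] by (simp add: T_def del: one_le_power)
  next
    fix i xs j ys
    assume i: "i < num_states T" and xs: "length xs = num_tapes T" "set xs \<subseteq> {..<num_symbols T}"
      and "delta T i xs = Some (j, ys)"
    then obtain q' x d y e where d:
      "sweep_delta m out fin (inv_into Q h i) (xs ! 0) (xs ! 1) = Some (q', (x, d), (y, e))"
      "j = h q'" "ys = [(x, d), (y, e)]"
      by (auto simp: T_def split: option.splits)
    have "xs ! 0 \<in> set xs" "xs ! 1 \<in> set xs"
      using xs by (auto simp: T_def)
    then have x: "xs ! 0 < 2 ^ Suc m + 1" "xs ! 1 < 2 ^ Suc m + 1"
      using xs(2) by (auto simp: T_def)
    have "inv_into Q h i \<in> sweep_states m out fin"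
      using i inv_in[of i] by (simp add: T_def flip: Q_def)
    note c = sweep_delta_closed[OF d(1) this, folded Q_def]
    show "j < num_states T" "length ys = num_tapes T" "fst ` set ys \<subseteq> {..<num_symbols T}"
      using c x h_in d(2,3) by (auto simp: T_def)
  qed (simp add: T_def)
  have step: "tm_step T (h q, [s, t]) =
      map_option (\<lambda>(q', s', t'). (h q', [s', t'])) (sweep_step m out fin (q, s, t))" if "q \<in> Q" for q s t
    unfolding tm_step_def sweep_step_def T_def using inv[OF that] by (auto split: option.splits)
  have sim: "q' \<in> Q \<and> nsteps (tm_step T) n (h q, [s, t]) (h q', [s', t'])"
    if "nsteps (sweep_step m out fin) n (q, s, t) (q', s', t')" "q \<in> Q" for n q s t q' s' t'
    using that
  proof (induction n arbitrary: q s t)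
    case (Suc n)
    obtain q1 s1 t1 where 1: "sweep_step m out fin (q, s, t) = Some (q1, s1, t1)"
      "nsteps (sweep_step m out fin) n (q1, s1, t1) (q', s', t')"
      using Suc.prems(1) by auto
    have "q1 \<in> Q"
      using 1(1) Suc.prems(2) unfolding sweep_step_def Q_def
      by (auto split: option.splits dest: sweep_delta_closed(1))
    then show ?case
      using Suc.IH[OF 1(2)] step[OF Suc.prems(2), of s t] 1(1) by auto
  qed auto
  obtain K where K: "\<And>v. length (out v @ fin) \<le> K"
  proof
    show "length (out v @ fin) \<le> Max ((\<lambda>x. length (x @ fin)) ` range out)" for v
      using regular_finite_range[OF reg] by (intro Max_ge) auto
  qed
  \<comment> \<open>The bound of \<open>sweep_run\<close> at \<open>N = 0\<close>, as a polynomial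
    in the length of the input.\<close>
  define P where "P = monom 1 m * [:2 + K, 2:]"
  have "tm_computes_within T (poly P (length w)) w (f w)" if "w \<in> D" for w
  proof -
    have w: "w \<noteq> []" "0 < length w ^ m"
      using ne[OF that] by auto
    obtain n s i where n: "n \<le> (length w ^ m - 0) * (2 * length w + 2 + K)" and run:
      "nsteps (sweep_step m out fin) n
        (q0, (letter_tape (map (\<lambda>b. (b, {})) w), 0), (tape_contents [], int (length ([] :: bool list))))
        (Emit [] None, s, (tape_contents ([] @
           concat (map (\<lambda>M. out (mark_word m w M)) [0..<length w ^ m]) @ fin), i))"
      using sweep_run[where out = out and fin = fin and K = K and cs = "[]",
          OF w(1) K w(2) update_marks_blank]
      unfolding q0_def by fastforce
    let ?c = "(h (Emit [] None), [s, (tape_contents (f w), i)])"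
    have "Emit [] None \<in> Q" and tm: "nsteps (tm_step T) n (tm_init T w) ?c"
      using sim[OF run q0] f[OF that] h0
      by (auto simp: letter_tape_blank tm_init_def T_def)
    then have halt: "tm_step T ?c = None"
      by (simp add: step) (simp add: sweep_step_def)
    have "n \<le> poly P (length w)"
      using n by (simp add: P_def poly_monom algebra_simps)
    from tm_run_nsteps[OF tm halt this] halt show ?thesis
      unfolding tm_computes_within_def by simp
  qed
  then show ?thesis
    unfolding poly_time_computable_on_def using \<open>turing_machine T\<close> by blast
qed

section \<open>Hitting probabilities in Markov decision processes without terminal states\<close>

definition snoc_path :: "('s, 'a) fpath \<Rightarrow> 'a \<times> 's \<Rightarrow> ('s, 'a) fpath" where
  "snoc_path \<pi> x = (fst \<pi>, snd \<pi> @ [x])"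

definition valid_step :: "('s, 'a) mdp \<Rightarrow> 's \<Rightarrow> 'a \<times> 's \<Rightarrow> bool" where
  "valid_step M s x \<longleftrightarrow> fst x \<in> enabled M s \<and> snd x \<in> states M \<and> 0 < tprob M s (fst x) (snd x)"

lemma path_length_snoc [simp]: "path_length (snoc_path \<pi> x) = Suc (path_length \<pi>)"
  by (simp add: snoc_path_def path_length_def)

lemma nth_state_snoc: "i \<le> path_length \<pi> \<Longrightarrow> nth_state (snoc_path \<pi> x) i = nth_state \<pi> i"
  by (auto simp: snoc_path_def path_length_def nth_state_def nth_append)

lemma nth_action_snoc: "i < path_length \<pi> \<Longrightarrow> nth_action (snoc_path \<pi> x) i = nth_action \<pi> i"
  by (auto simp: snoc_path_def path_length_def nth_action_def nth_append)

lemma nth_action_snoc_last [simp]: "nth_action (snoc_path \<pi> x) (path_length \<pi>) = fst x"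
  by (simp add: snoc_path_def path_length_def nth_action_def)

lemma last_state_snoc [simp]: "last_state (snoc_path \<pi> x) = snd x"
  by (simp add: snoc_path_def path_length_def nth_state_def last_state_def)

lemma last_state_Nil [simp]: "last_state (s, []) = s"
  by (simp add: path_length_def nth_state_def last_state_def)

lemma nth_state_snoc_last [simp]: "nth_state (snoc_path \<pi> x) (Suc (path_length \<pi>)) = snd x"
  by (simp add: snoc_path_def path_length_def nth_state_def)

lemma take_path_snoc: "i \<le> path_length \<pi> \<Longrightarrow> take_path i (snoc_path \<pi> x) = take_path i \<pi>"
  by (simp add: snoc_path_def path_length_def take_path_def)

lemma take_path_all: "path_length \<pi> \<le> i \<Longrightarrow> take_path i \<pi> = \<pi>"
  by (simp add: path_length_def take_path_def)

lemma path_length_take_path: "path_length (take_path i \<pi>) = min i (path_length \<pi>)"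
  by (simp add: take_path_def path_length_def min.commute)

lemma take_path_Suc:
  "i < path_length \<pi> \<Longrightarrow> take_path (Suc i) \<pi> = snoc_path (take_path i \<pi>) (snd \<pi> ! i)"
  by (simp add: take_path_def snoc_path_def path_length_def take_Suc_conv_app_nth)

lemma snoc_path_inj: "snoc_path \<pi> x = snoc_path \<pi>' y \<longleftrightarrow> \<pi> = \<pi>' \<and> x = y"
  by (auto simp: snoc_path_def prod_eq_iff)

lemma acc_weight_snoc:
  "acc_weight M (snoc_path \<pi> x) = acc_weight M \<pi> + wgt M (last_state \<pi>) (fst x)"
  by (simp add: acc_weight_def nth_state_snoc nth_action_snoc last_state_def)

lemma acc_weight_Nil [simp]: "acc_weight M (s, []) = 0"
  by (simp add: acc_weight_def path_length_def)

lemma path_prob_snoc: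
  "path_prob M \<sigma> (snoc_path \<pi> x) =
     path_prob M \<sigma> \<pi> * (pmf (\<sigma> \<pi>) (fst x) * of_rat (tprob M (last_state \<pi>) (fst x) (snd x)))"
  by (simp add: path_prob_def nth_state_snoc nth_action_snoc last_state_def take_path_snoc take_path_all
      Suc_le_eq)

lemma path_prob_Nil [simp]: "path_prob M \<sigma> (s, []) = 1"
  by (simp add: path_prob_def path_length_def)

lemma finite_paths_Nil: "(s', []) \<in> finite_paths M s \<longleftrightarrow> s' = s \<and> s \<in> states M"
  by (auto simp: finite_paths_def path_length_def nth_state_def)

lemma finite_paths_snoc:
  "snoc_path \<pi> x \<in> finite_paths M s \<longleftrightarrow> \<pi> \<in> finite_paths M s \<and> valid_step M (last_state \<pi>) x"
  by (auto simp: finite_paths_def less_Suc_eq nth_state_snoc nth_action_snoc valid_step_def last_state_def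
      Suc_le_eq)

lemma path_cases:
  obtains s where "\<pi> = (s, [])" | \<pi>' x where "\<pi> = snoc_path \<pi>' x"
proof (cases "snd \<pi>" rule: rev_cases)
  case Nil
  then show ?thesis
    using that(1)[of "fst \<pi>"] by (metis prod.collapse)
next
  case (snoc xs x)
  then show ?thesis
    using that(2)[of "(fst \<pi>, xs)" x] by (metis snoc_path_def fst_conv snd_conv prod.collapse)
qed

lemma path_induct [case_names Nil snoc]:
  assumes "\<And>s. P (s, [])" "\<And>\<pi> x. P \<pi> \<Longrightarrow> P (snoc_path \<pi> x)"
  shows "P \<pi>"
proof -
  have "P (s, xs)" for s xs
    by (induction xs rule: rev_induct) (use assms(1) assms(2)[of "(s, _)"] in \<open>auto simp: snoc_path_def\<close>)
  then show ?thesis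
    by (metis prod.collapse)
qed

lemma take_path_finite_paths: "\<pi> \<in> finite_paths M s \<Longrightarrow> take_path i \<pi> \<in> finite_paths M s"
proof (induction \<pi> rule: path_induct)
  case (Nil s)
  then show ?case
    by (simp add: take_path_def)
next
  case (snoc \<pi> x)
  then show ?case
    by (cases "i \<le> path_length \<pi>") (simp_all add: take_path_snoc finite_paths_snoc take_path_all)
qed

lemma last_state_finite_paths: "\<pi> \<in> finite_paths M s \<Longrightarrow> last_state \<pi> \<in> states M"
  by (cases \<pi> rule: path_cases) (auto simp: finite_paths_snoc valid_step_def finite_paths_Nil)

lemma fst_finite_paths: "\<pi> \<in> finite_paths M s \<Longrightarrow> fst \<pi> = s"
  by (auto simp: finite_paths_def nth_state_def)

definition path_negative :: "('s, 'a) mdp \<Rightarrow> ('s, 'a) fpath \<Rightarrow> bool" where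
  "path_negative M \<pi> \<longleftrightarrow> (\<exists>i. acc_weight M (take_path i \<pi>) < 0)"

lemma path_negative_snoc:
  "path_negative M (snoc_path \<pi> x) \<longleftrightarrow>
     path_negative M \<pi> \<or> acc_weight M \<pi> + wgt M (last_state \<pi>) (fst x) < 0"
proof -
  have "take_path i (snoc_path \<pi> x) = (if i \<le> path_length \<pi> then take_path i \<pi> else snoc_path \<pi> x)" for i
    by (simp add: take_path_snoc take_path_all)
  moreover have "\<exists>j \<le> path_length \<pi>. take_path i \<pi> = take_path j \<pi>" for i
    by (rule exI[of _ "min i (path_length \<pi>)"]) (metis min.cobounded2 min_def nle_le take_path_all)
  moreover have "\<not> Suc (path_length \<pi>) \<le> path_length \<pi>"
    by simp
  ultimately show ?thesis
    unfolding path_negative_def acc_weight_snoc[symmetric] by metis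
qed

lemma path_negative_Nil [simp]: "\<not> path_negative M (s, [])"
  by (simp add: path_negative_def take_path_def)

text \<open>Only the last stage inspects the history, so the value is the probability that a path
  extending \<open>\<pi>\<close> by \<open>n\<close> steps has a negative prefix.\<close>

primrec hit_prob_within ::
  "('s, 'a) mdp \<Rightarrow> ('s, 'a) scheduler \<Rightarrow> nat \<Rightarrow> ('s, 'a) fpath \<Rightarrow> real" where
  "hit_prob_within M \<sigma> 0 \<pi> = (if path_negative M \<pi> then 1 else 0)"
| "hit_prob_within M \<sigma> (Suc n) \<pi> =
     (\<Sum>a \<in> enabled M (last_state \<pi>). \<Sum>t \<in> states M.
        pmf (\<sigma> \<pi>) a * of_rat (tprob M (last_state \<pi>) a t) * hit_prob_within M \<sigma> n (snoc_path \<pi> (a, t)))"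

locale nonterminating_mdp =
  fixes M :: "('s, 'a) mdp"
  assumes finite_mdp: "finite_mdp M"
    and nonterminating: "s \<in> states M \<Longrightarrow> enabled M s \<noteq> {}"
begin

lemma finite_states: "finite (states M)"
  using finite_mdp by (simp add: finite_mdp_def)

lemma finite_enabled: "finite (enabled M s)"
  using finite_mdp by (simp add: finite_mdp_def enabled_def)

lemma tprob_nonneg: "s \<in> states M \<Longrightarrow> a \<in> enabled M s \<Longrightarrow> t \<in> states M \<Longrightarrow> 0 \<le> tprob M s a t"
  using finite_mdp by (auto simp: finite_mdp_def enabled_def)

lemma sum_tprob: "a \<in> enabled M s \<Longrightarrow> (\<Sum>t \<in> states M. real_of_rat (tprob M s a t)) = 1"
  by (simp add: enabled_def flip: of_rat_sum)

lemma scheduler_support: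
  assumes "\<sigma> \<in> schedulers M" "\<pi> \<in> finite_paths M s"
  shows "set_pmf (\<sigma> \<pi>) \<subseteq> enabled M (last_state \<pi>)"
proof -
  have "s \<in> states M"
    using assms(2) by (simp add: finite_paths_def)
  then show ?thesis
    using assms nonterminating[OF last_state_finite_paths[OF assms(2)]] unfolding schedulers_def by blast
qed

lemma sum_scheduler:
  assumes "\<sigma> \<in> schedulers M" "\<pi> \<in> finite_paths M s"
  shows "(\<Sum>a \<in> enabled M (last_state \<pi>). pmf (\<sigma> \<pi>) a) = 1"
  using scheduler_support[OF assms] finite_enabled by (intro sum_pmf_eq_1) auto

definition step_prob :: "('s, 'a) scheduler \<Rightarrow> ('s, 'a) fpath \<Rightarrow> 'a \<times> 's \<Rightarrow> real" where
  "step_prob \<sigma> \<pi> x = (if valid_step M (last_state \<pi>) x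
     then pmf (\<sigma> \<pi>) (fst x) * of_rat (tprob M (last_state \<pi>) (fst x) (snd x)) else 0)"

lemma finite_valid_step: "finite {x. valid_step M s x}"
  by (rule finite_subset[of _ "enabled M s \<times> states M"])
    (auto simp: valid_step_def finite_enabled finite_states)

lemma sum_valid_step:
  assumes "\<pi> \<in> finite_paths M s"
  shows "(\<Sum>x | valid_step M (last_state \<pi>) x. step_prob \<sigma> \<pi> x * f x) =
    (\<Sum>a \<in> enabled M (last_state \<pi>). \<Sum>t \<in> states M.
        pmf (\<sigma> \<pi>) a * of_rat (tprob M (last_state \<pi>) a t) * f (a, t))"
proof -
  have "(\<Sum>x | valid_step M (last_state \<pi>) x. step_prob \<sigma> \<pi> x * f x) =
      (\<Sum>x \<in> enabled M (last_state \<pi>) \<times> states M.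
        pmf (\<sigma> \<pi>) (fst x) * of_rat (tprob M (last_state \<pi>) (fst x) (snd x)) * f x)"
    using tprob_nonneg[OF last_state_finite_paths[OF assms]]
    by (intro sum.mono_neutral_cong_left)
      (auto simp: valid_step_def finite_enabled finite_states step_prob_def less_le)
  then show ?thesis
    unfolding sum.cartesian_product by (simp add: split_def)
qed

lemma sum_step_prob:
  assumes "\<sigma> \<in> schedulers M" "\<pi> \<in> finite_paths M s"
  shows "(\<Sum>x | valid_step M (last_state \<pi>) x. step_prob \<sigma> \<pi> x) = 1"
proof -
  have "(\<Sum>x | valid_step M (last_state \<pi>) x. step_prob \<sigma> \<pi> x) =
      (\<Sum>a \<in> enabled M (last_state \<pi>). \<Sum>t \<in> states M.
        pmf (\<sigma> \<pi>) a * of_rat (tprob M (last_state \<pi>) a t))"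
    using sum_valid_step[OF assms(2), of \<sigma> "\<lambda>_. 1"] by simp
  also have "\<dots> = (\<Sum>a \<in> enabled M (last_state \<pi>). pmf (\<sigma> \<pi>) a)"
    by (intro sum.cong refl) (simp add: sum_tprob flip: sum_distrib_left)
  finally show ?thesis
    by (simp add: sum_scheduler[OF assms])
qed

lemma step_prob_nonneg: "\<pi> \<in> finite_paths M s \<Longrightarrow> 0 \<le> step_prob \<sigma> \<pi> x"
  by (auto simp: step_prob_def valid_step_def)

definition step_pmf :: "('s, 'a) scheduler \<Rightarrow> ('s, 'a) fpath \<Rightarrow> ('a \<times> 's) pmf" where
  "step_pmf \<sigma> \<pi> = embed_pmf (step_prob \<sigma> \<pi>)"

lemma pmf_step_pmf:
  assumes "\<sigma> \<in> schedulers M" "\<pi> \<in> finite_paths M s"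
  shows "pmf (step_pmf \<sigma> \<pi>) x = step_prob \<sigma> \<pi> x"
  unfolding step_pmf_def
proof (rule pmf_embed_pmf)
  have "(\<integral>\<^sup>+ x. ennreal (step_prob \<sigma> \<pi> x) \<partial>count_space UNIV) =
      (\<Sum>x | valid_step M (last_state \<pi>) x. ennreal (step_prob \<sigma> \<pi> x))"
    by (intro nn_integral_count_space') (auto simp: finite_valid_step step_prob_def)
  also have "\<dots> = 1"
    using sum_step_prob[OF assms] step_prob_nonneg[OF assms(2)] by (simp add: sum_ennreal)
  finally show "(\<integral>\<^sup>+ x. ennreal (step_prob \<sigma> \<pi> x) \<partial>count_space UNIV) = 1" .
qed (use step_prob_nonneg[OF assms(2)] in auto)

text \<open>
  A random path is obtained by choosing a step independently for every finite path and then following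
  these choices; invalid choices have probability zero and are replaced by arbitrary valid ones.
\<close>

definition repair :: "('s, 'a) fpath \<Rightarrow> 'a \<times> 's \<Rightarrow> 'a \<times> 's" where
  "repair \<pi> x = (if valid_step M (last_state \<pi>) x then x else (SOME x. valid_step M (last_state \<pi>) x))"

primrec follow :: "'s \<Rightarrow> (('s, 'a) fpath \<Rightarrow> 'a \<times> 's) \<Rightarrow> nat \<Rightarrow> ('s, 'a) fpath" where
  "follow s \<omega> 0 = (s, [])"
| "follow s \<omega> (Suc n) = snoc_path (follow s \<omega> n) (repair (follow s \<omega> n) (\<omega> (follow s \<omega> n)))"

definition followed_path :: "'s \<Rightarrow> (('s, 'a) fpath \<Rightarrow> 'a \<times> 's) \<Rightarrow> ('s, 'a) mpath" where
  "followed_path s \<omega> =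
     Infinite_Path s (smap (\<lambda>n. repair (follow s \<omega> n) (\<omega> (follow s \<omega> n))) nats)"

lemma ex_valid_step:
  assumes "s \<in> states M"
  shows "\<exists>x. valid_step M s x"
proof (rule ccontr)
  assume no: "\<nexists>x. valid_step M s x"
  obtain a where a: "a \<in> enabled M s"
    using nonterminating[OF assms] by auto
  then have "(\<Sum>t \<in> states M. tprob M s a t) \<le> (\<Sum>t \<in> states M. 0)"
    using no by (intro sum_mono) (auto simp: valid_step_def not_less)
  then show False
    using a by (simp add: enabled_def)
qed

lemma valid_repair: "\<pi> \<in> finite_paths M s \<Longrightarrow> valid_step M (last_state \<pi>) (repair \<pi> x)"
  unfolding repair_def using someI_ex[OF ex_valid_step[OF last_state_finite_paths]] by auto

lemma follow_finite_paths: "s \<in> states M \<Longrightarrow> follow s \<omega> n \<in> finite_paths M s"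
  by (induction n) (auto simp: finite_paths_Nil finite_paths_snoc valid_repair)

lemma path_length_follow [simp]: "path_length (follow s \<omega> n) = n"
  by (induction n) (auto simp: path_length_def[of "(s, [])"])

lemma follow_eq_stake:
  "follow s \<omega> n = (s, stake n (smap (\<lambda>n. repair (follow s \<omega> n) (\<omega> (follow s \<omega> n))) nats))"
proof (induction n)
  case (Suc n)
  let ?w = "smap (\<lambda>n. repair (follow s \<omega> n) (\<omega> (follow s \<omega> n))) nats"
  have "follow s \<omega> (Suc n) = snoc_path (s, stake n ?w) (?w !! n)"
    by (subst Suc[symmetric]) simp
  then show ?case
    by (simp add: snoc_path_def stake_Suc del: stake.simps follow.simps)
qed simp

lemma path_prefix_followed: "path_prefix \<pi> (followed_path s \<omega>) \<longleftrightarrow> \<pi> = follow s \<omega> (path_length \<pi>)"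
proof -
  obtain t xs where \<pi>: "\<pi> = (t, xs)"
    by fastforce
  show ?thesis
    unfolding \<pi> followed_path_def path_prefix.simps path_length_def snd_conv
    by (subst follow_eq_stake) (auto simp only: prod.inject)
qed

lemma followed_path_maximal:
  assumes "s \<in> states M"
  shows "followed_path s \<omega> \<in> maximal_paths M s"
proof -
  have "\<pi> \<in> finite_paths M s" if "path_prefix \<pi> (followed_path s \<omega>)" for \<pi>
    using that follow_finite_paths[OF assms] unfolding path_prefix_followed by metis
  moreover have "ends_terminal M (followed_path s \<omega>)"
    by (simp add: followed_path_def)
  ultimately show ?thesis
    by (simp add: maximal_paths_def)
qed

lemma followed_path_in_cylinder:
  assumes "s \<in> states M" "\<pi> \<in> finite_paths M s"
  shows "followed_path s \<omega> \<in> cylinder M s \<pi> \<longleftrightarrow>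
    (\<forall>i < path_length \<pi>. repair (take_path i \<pi>) (\<omega> (take_path i \<pi>)) = snd \<pi> ! i)"
proof -
  have "follow s \<omega> n = take_path n \<pi> \<longleftrightarrow>
      (\<forall>i < n. repair (take_path i \<pi>) (\<omega> (take_path i \<pi>)) = snd \<pi> ! i)" if "n \<le> path_length \<pi>" for n
    using that
  proof (induction n)
    case 0
    then show ?case
      using fst_finite_paths[OF assms(2)] by (simp add: take_path_def)
  next
    case (Suc n)
    then show ?case
      by (auto simp: take_path_Suc snoc_path_inj less_Suc_eq)
  qed
  from this[of "path_length \<pi>"] show ?thesis
    unfolding cylinder_def using followed_path_maximal[OF assms(1)]
    by (auto simp: path_prefix_followed take_path_all)
qed

text \<open>\<open>extend_measure\<close> attains the prescribed values only if some measure does.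
  The witness is the image under \<open>followed_path\<close> of the product of the step
  distributions over all finite paths.\<close>

lemma emeasure_cylinder:
  assumes \<sigma>: "\<sigma> \<in> schedulers M" and s: "s \<in> states M" and \<pi>: "\<pi> \<in> finite_paths M s"
  shows "emeasure (path_measure M \<sigma> s) (cylinder M s \<pi>) = ennreal (path_prob M \<sigma> \<pi>)"
proof -
  define P where "P = PiM UNIV (\<lambda>\<pi>. measure_pmf (step_pmf \<sigma> \<pi>))"
  interpret P: product_prob_space "\<lambda>\<pi>. measure_pmf (step_pmf \<sigma> \<pi>)" UNIV
    by unfold_locales
  define N where "N = sigma (maximal_paths M s) (cylinder M s ` finite_paths M s)"
  have cyl: "cylinder M s ` finite_paths M s \<subseteq> Pow (maximal_paths M s)"
    by (auto simp: cylinder_def)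
  have space_P: "space P = UNIV"
    by (simp add: P_def space_PiM)
  let ?X = "\<lambda>\<pi> i. {x. repair (take_path i \<pi>) x = snd \<pi> ! i}"
  have preimage: "followed_path s -` cylinder M s \<pi> \<inter> space P =
      {\<omega> \<in> space P. \<forall>i \<in> {..<path_length \<pi>}. \<omega> (take_path i \<pi>) \<in> ?X \<pi> i}"
    if "\<pi> \<in> finite_paths M s" for \<pi>
    using followed_path_in_cylinder[OF s that] by auto
  have comp: "{\<omega> \<in> space P. \<omega> \<rho> \<in> A} \<in> sets P" for \<rho> A
    unfolding P_def by (rule sets_Collect_single') auto
  have sets_P: "{\<omega> \<in> space P. \<forall>i \<in> {..<n}. \<omega> (f i) \<in> A i} \<in> sets P" for n :: nat and f A
    by (intro sets.sets_Collect_finite_All comp) auto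
  have meas: "followed_path s \<in> measurable P N"
    unfolding N_def
  proof (rule measurable_measure_of[OF cyl])
    fix Y
    assume "Y \<in> cylinder M s ` finite_paths M s"
    then obtain \<pi> where \<pi>: "\<pi> \<in> finite_paths M s" and Y: "Y = cylinder M s \<pi>"
      by (rule imageE)
    show "followed_path s -` Y \<inter> space P \<in> sets P"
      unfolding Y preimage[OF \<pi>] by (rule sets_P)
  qed (use followed_path_maximal[OF s] in auto)
  have emeasure: "emeasure (distr P N (followed_path s)) (cylinder M s \<pi>) = ennreal (path_prob M \<sigma> \<pi>)"
    if \<pi>: "\<pi> \<in> finite_paths M s" for \<pi>
  proof -
    let ?n = "path_length \<pi>" and ?t = "\<lambda>i. take_path i \<pi>"
    \<comment> \<open>The prefixes of \<open>\<pi>\<close> are different coordinates of the product,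
      so the choices along \<open>\<pi>\<close> are independent and their probabilities
      multiply.\<close>
    have inj: "inj_on ?t {..<?n}"
      by (rule inj_onI, drule arg_cong[where f = path_length]) (simp add: path_length_take_path)
    have "cylinder M s \<pi> \<in> sets N"
      unfolding N_def using \<pi> cyl by (auto simp: sets_measure_of)
    then have "emeasure (distr P N (followed_path s)) (cylinder M s \<pi>) =
        emeasure P {\<omega> \<in> space P. \<forall>i \<in> {..<?n}. \<omega> (?t i) \<in> ?X \<pi> i}"
      using meas by (simp add: emeasure_distr preimage[OF \<pi>])
    also have "{\<omega> \<in> space P. \<forall>i \<in> {..<?n}. \<omega> (?t i) \<in> ?X \<pi> i} =
        {\<omega> \<in> space P. \<forall>\<rho> \<in> ?t ` {..<?n}. \<omega> \<rho> \<in> ?X \<pi> (path_length \<rho>)}"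
      by (auto simp: path_length_take_path)
    also have "emeasure P \<dots> = (\<Prod>\<rho> \<in> ?t ` {..<?n}. emeasure (measure_pmf (step_pmf \<sigma> \<rho>)) (?X \<pi> (path_length \<rho>)))"
      unfolding P_def by (rule P.emeasure_PiM_Collect) auto
    also have "\<dots> = (\<Prod>i<?n. emeasure (measure_pmf (step_pmf \<sigma> (?t i))) (?X \<pi> i))"
      using inj by (simp add: prod.reindex path_length_take_path)
    also have "\<dots> = (\<Prod>i<?n. ennreal (pmf (\<sigma> (?t i)) (nth_action \<pi> i) *
        of_rat (tprob M (nth_state \<pi> i) (nth_action \<pi> i) (nth_state \<pi> (Suc i)))))"
    proof (intro prod.cong refl)
      fix i
      assume "i \<in> {..<?n}"
      then have i: "i < ?n"
        by simp
      have t: "?t i \<in> finite_paths M s"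
        using \<pi> by (rule take_path_finite_paths)
      have last: "last_state (?t i) = nth_state \<pi> i"
        using i by (auto simp: last_state_def nth_state_def path_length_take_path)
          (auto simp: take_path_def)
      have "take_path (Suc i) \<pi> \<in> finite_paths M s"
        using \<pi> by (rule take_path_finite_paths)
      then have valid: "valid_step M (last_state (?t i)) (snd \<pi> ! i)"
        by (simp add: take_path_Suc[OF i] finite_paths_snoc)
      have "measure (step_pmf \<sigma> (?t i)) (?X \<pi> i) = measure (step_pmf \<sigma> (?t i)) {snd \<pi> ! i}"
      proof (intro measure_pmf.finite_measure_eq_AE)
        \<comment> \<open>Repairing changes only invalid steps, and these have probability
          zero.\<close>
        show "AE x in measure_pmf (step_pmf \<sigma> (?t i)). (x \<in> ?X \<pi> i) = (x \<in> {snd \<pi> ! i})"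
        proof (rule AE_pmfI)
          fix x
          assume "x \<in> set_pmf (step_pmf \<sigma> (?t i))"
          then have "step_prob \<sigma> (?t i) x \<noteq> 0"
            by (simp add: set_pmf_iff pmf_step_pmf[OF \<sigma> t])
          then have "valid_step M (last_state (?t i)) x"
            by (auto simp: step_prob_def split: if_splits)
          then show "(x \<in> ?X \<pi> i) = (x \<in> {snd \<pi> ! i})"
            by (simp add: repair_def)
        qed
      qed auto
      also have "\<dots> = step_prob \<sigma> (?t i) (snd \<pi> ! i)"
        by (simp add: measure_pmf_single pmf_step_pmf[OF \<sigma> t])
      also have "\<dots> = pmf (\<sigma> (?t i)) (nth_action \<pi> i) *
          of_rat (tprob M (nth_state \<pi> i) (nth_action \<pi> i) (nth_state \<pi> (Suc i)))"
        using valid by (simp add: step_prob_def last nth_action_def nth_state_def)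
      finally show "emeasure (measure_pmf (step_pmf \<sigma> (?t i))) (?X \<pi> i) = ennreal (pmf (\<sigma> (?t i)) (nth_action \<pi> i) *
          of_rat (tprob M (nth_state \<pi> i) (nth_action \<pi> i) (nth_state \<pi> (Suc i))))"
        by (simp add: measure_pmf.emeasure_eq_measure)
    qed
    also have "\<dots> = ennreal (path_prob M \<sigma> \<pi>)"
      unfolding path_prob_def using \<pi>
      by (intro prod_ennreal) (auto simp: finite_paths_def)
    finally show ?thesis .
  qed
  have sets_eq: "sets (path_measure M \<sigma> s) = sets (distr P N (followed_path s))"
    unfolding path_measure_def using cyl by (simp add: sets_extend_measure N_def sets_measure_of)
  show ?thesis
  proof (rule emeasure_extend_measure[OF path_measure_def])
    show "emeasure (distr P N (followed_path s)) (cylinder M s \<rho>) = ennreal (path_prob M \<sigma> \<rho>)"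
      if "\<rho> \<in> finite_paths M s" for \<rho>
      using that by (rule emeasure)
    show "positive (sets (path_measure M \<sigma> s)) (emeasure (distr P N (followed_path s)))"
      unfolding sets_eq by (rule emeasure_positive)
    show "countably_additive (sets (path_measure M \<sigma> s)) (emeasure (distr P N (followed_path s)))"
      unfolding sets_eq by (rule emeasure_countably_additive)
  qed (fact cyl \<pi>)+
qed

section \<open>The event as a union of cylinders\<close>

definition paths_of_length :: "'s \<Rightarrow> nat \<Rightarrow> ('s, 'a) fpath set" where
  "paths_of_length s n = {\<pi> \<in> finite_paths M s. path_length \<pi> = n}"

lemma paths_of_length_0: "s \<in> states M \<Longrightarrow> paths_of_length s 0 = {(s, [])}"
proof -
  assume s: "s \<in> states M"
  have "\<pi> = (s, [])" if "\<pi> \<in> paths_of_length s 0" for \<pi>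
    using that by (cases \<pi> rule: path_cases) (auto simp: paths_of_length_def finite_paths_Nil)
  then show ?thesis
    using s by (auto simp: paths_of_length_def finite_paths_Nil path_length_def)
qed

lemma paths_of_length_Suc:
  "paths_of_length s (Suc n) = (\<lambda>(\<pi>, x). snoc_path \<pi> x) `
     (SIGMA \<pi> : paths_of_length s n. {x. valid_step M (last_state \<pi>) x})"
proof (intro set_eqI iffI)
  fix \<pi>
  assume "\<pi> \<in> paths_of_length s (Suc n)"
  then show "\<pi> \<in> (\<lambda>(\<pi>, x). snoc_path \<pi> x) `
      (SIGMA \<pi> : paths_of_length s n. {x. valid_step M (last_state \<pi>) x})"
    by (cases \<pi> rule: path_cases)
      (auto simp: paths_of_length_def finite_paths_snoc path_length_def[of "(_, [])"]
        intro!: image_eqI[of _ _ "(_, _)"])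
qed (auto simp: paths_of_length_def finite_paths_snoc)

lemma finite_paths_of_length: "s \<in> states M \<Longrightarrow> finite (paths_of_length s n)"
  by (induction n) (auto simp: paths_of_length_0 paths_of_length_Suc finite_valid_step)

lemma sum_paths_of_length_Suc:
  assumes "s \<in> states M"
  shows "(\<Sum>\<pi> \<in> paths_of_length s (Suc n). path_prob M \<sigma> \<pi> * hit_prob_within M \<sigma> m \<pi>) =
    (\<Sum>\<pi> \<in> paths_of_length s n. path_prob M \<sigma> \<pi> * hit_prob_within M \<sigma> (Suc m) \<pi>)"
proof -
  have inj: "inj_on (\<lambda>(\<pi>, x). snoc_path \<pi> x) A" for A :: "(('s, 'a) fpath \<times> ('a \<times> 's)) set"
    by (auto simp: inj_on_def snoc_path_inj)
  have "(\<Sum>\<pi> \<in> paths_of_length s (Suc n). path_prob M \<sigma> \<pi> * hit_prob_within M \<sigma> m \<pi>) =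
      (\<Sum>(\<pi>, x) \<in> (SIGMA \<pi> : paths_of_length s n. {x. valid_step M (last_state \<pi>) x}).
         path_prob M \<sigma> (snoc_path \<pi> x) * hit_prob_within M \<sigma> m (snoc_path \<pi> x))"
    unfolding paths_of_length_Suc sum.reindex[OF inj] by (simp add: split_def comp_def)
  also have "\<dots> = (\<Sum>\<pi> \<in> paths_of_length s n. \<Sum>x | valid_step M (last_state \<pi>) x.
         path_prob M \<sigma> (snoc_path \<pi> x) * hit_prob_within M \<sigma> m (snoc_path \<pi> x))"
    by (subst sum.Sigma) (auto simp: finite_paths_of_length assms finite_valid_step)
  also have "\<dots> = (\<Sum>\<pi> \<in> paths_of_length s n. path_prob M \<sigma> \<pi> *
         (\<Sum>x | valid_step M (last_state \<pi>) x. step_prob \<sigma> \<pi> x * hit_prob_within M \<sigma> m (snoc_path \<pi> x)))"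
    by (intro sum.cong refl) (simp add: path_prob_snoc step_prob_def sum_distrib_left mult.assoc)
  also have "\<dots> = (\<Sum>\<pi> \<in> paths_of_length s n. path_prob M \<sigma> \<pi> * hit_prob_within M \<sigma> (Suc m) \<pi>)"
  proof (intro sum.cong refl)
    fix \<pi>
    assume "\<pi> \<in> paths_of_length s n"
    then have "\<pi> \<in> finite_paths M s"
      by (simp add: paths_of_length_def)
    from sum_valid_step[OF this, of \<sigma> "\<lambda>x. hit_prob_within M \<sigma> m (snoc_path \<pi> x)"]
    show "path_prob M \<sigma> \<pi> *
         (\<Sum>x | valid_step M (last_state \<pi>) x. step_prob \<sigma> \<pi> x * hit_prob_within M \<sigma> m (snoc_path \<pi> x)) =
       path_prob M \<sigma> \<pi> * hit_prob_within M \<sigma> (Suc m) \<pi>"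
      by simp
  qed
  finally show ?thesis .
qed

text \<open>The sum over paths of length \<open>k\<close>, each weighted with its chance to succeed
  within the remaining \<open>n - k\<close> steps, does not depend on \<open>k\<close>; the cases
  \<open>k = 0\<close> and \<open>k = n\<close> are the two sides.\<close>

lemma hit_prob_within_eq_sum:
  assumes "s \<in> states M"
  shows "hit_prob_within M \<sigma> n (s, []) =
    (\<Sum>\<pi> | \<pi> \<in> paths_of_length s n \<and> path_negative M \<pi>. path_prob M \<sigma> \<pi>)"
proof -
  have "(\<Sum>\<pi> \<in> paths_of_length s k. path_prob M \<sigma> \<pi> * hit_prob_within M \<sigma> (n - k) \<pi>) =
      hit_prob_within M \<sigma> n (s, [])" if "k \<le> n" for k
    using that
  proof (induction k)
    case (Suc k)
    then show ?case
      using sum_paths_of_length_Suc[OF assms, where n = k and \<sigma> = \<sigma> and m = "n - Suc k"] by (simp add: Suc_diff_Suc)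
  qed (simp add: paths_of_length_0[OF assms])
  from this[of n] have "hit_prob_within M \<sigma> n (s, []) =
      (\<Sum>\<pi> \<in> paths_of_length s n. path_prob M \<sigma> \<pi> * (if path_negative M \<pi> then 1 else 0))"
    by simp
  also have "\<dots> = (\<Sum>\<pi> | \<pi> \<in> paths_of_length s n \<and> path_negative M \<pi>. path_prob M \<sigma> \<pi>)"
    by (rule sum.mono_neutral_cong_right) (auto simp: finite_paths_of_length[OF assms])
  finally show ?thesis .
qed

lemma maximal_path_infinite:
  assumes "\<zeta> \<in> maximal_paths M s"
  obtains x where "\<zeta> = Infinite_Path s x"
proof (cases \<zeta>)
  case (Finite_Path t xs)
  then have "(t, xs) \<in> finite_paths M s" "enabled M (last_state (t, xs)) = {}"
    using assms unfolding maximal_paths_def by auto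
  then show ?thesis
    using nonterminating[OF last_state_finite_paths] by blast
next
  case (Infinite_Path t x)
  then have "(t, []) \<in> finite_paths M s"
    using assms unfolding maximal_paths_def by auto
  then show ?thesis
    using that Infinite_Path by (auto simp: finite_paths_Nil)
qed

lemma path_prefix_Infinite: "path_prefix \<pi> (Infinite_Path s x) \<longleftrightarrow> \<pi> = (s, stake (path_length \<pi>) x)"
  by (cases \<pi>) (auto simp: path_length_def)

definition negative_within :: "'s \<Rightarrow> nat \<Rightarrow> ('s, 'a) mpath set" where
  "negative_within s n = (\<Union>\<pi> \<in> {\<pi> \<in> paths_of_length s n. path_negative M \<pi>}. cylinder M s \<pi>)"

lemma negative_within_iff:
  assumes "Infinite_Path s x \<in> maximal_paths M s"
  shows "Infinite_Path s x \<in> negative_within s n \<longleftrightarrow> (\<exists>i \<le> n. acc_weight M (s, stake i x) < 0)"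
proof -
  have "(s, stake n x) \<in> paths_of_length s n"
    using assms by (auto simp: maximal_paths_def paths_of_length_def path_length_def)
  then have "\<pi> \<in> paths_of_length s n \<and> path_prefix \<pi> (Infinite_Path s x) \<longleftrightarrow> \<pi> = (s, stake n x)" for \<pi>
    unfolding paths_of_length_def path_prefix_Infinite by (metis (mono_tags, lifting) mem_Collect_eq)
  note prefix = this
  have "Infinite_Path s x \<in> negative_within s n \<longleftrightarrow>
      (\<exists>\<pi>. (\<pi> \<in> paths_of_length s n \<and> path_prefix \<pi> (Infinite_Path s x)) \<and> path_negative M \<pi>)"
    using assms by (auto simp: negative_within_def cylinder_def simp del: path_prefix.simps)
  also have "\<dots> \<longleftrightarrow> path_negative M (s, stake n x)"
    unfolding prefix by simp
  also have "\<dots> \<longleftrightarrow> (\<exists>i. acc_weight M (s, stake (min i n) x) < 0)"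
    by (simp add: path_negative_def take_path_def take_stake min.commute)
  also have "\<dots> \<longleftrightarrow> (\<exists>i \<le> n. acc_weight M (s, stake i x) < 0)"
    by (metis min.absorb1 min.cobounded2)
  finally show ?thesis .
qed

lemma negative_within_subset: "negative_within s n \<subseteq> maximal_paths M s"
  by (auto simp: negative_within_def cylinder_def)

text \<open>In the absence of terminal states the event is the increasing union of the sets
  \<open>negative_within s n\<close>, each a finite disjoint union of cylinders, so continuity from
  below gives the limit.\<close>

lemma measure_eventually_negative:
  assumes \<sigma>: "\<sigma> \<in> schedulers M" and s: "s \<in> states M"
  shows "(\<lambda>n. hit_prob_within M \<sigma> n (s, [])) \<longlonglongrightarrow> measure (path_measure M \<sigma> s) (eventually_negative M s)"
proof -
  let ?P = "path_measure M \<sigma> s"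
  note cyl = emeasure_cylinder[OF \<sigma> s]
  have sub: "cylinder M s ` finite_paths M s \<subseteq> Pow (maximal_paths M s)"
    by (auto simp: cylinder_def)
  have sets: "cylinder M s \<pi> \<in> sets ?P" if "\<pi> \<in> finite_paths M s" for \<pi>
    using that sub by (auto simp: path_measure_def sets_extend_measure)
  have prefix_Nil: "path_prefix (s, []) \<zeta>" if "\<zeta> \<in> maximal_paths M s" for \<zeta>
    using that by (rule maximal_path_infinite) simp
  have "space ?P = maximal_paths M s"
    unfolding path_measure_def by (rule space_extend_measure[OF sub])
  also have "\<dots> = cylinder M s (s, [])"
    using prefix_Nil by (auto simp: cylinder_def)
  finally have "emeasure ?P (space ?P) = 1"
    using cyl[of "(s, [])"] s by (simp add: finite_paths_Nil)
  then interpret prob_space ?P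
    by (rule prob_spaceI)
  have disj: "disjoint_family_on (cylinder M s) (paths_of_length s n)" for n
  proof (unfold disjoint_family_on_def, intro ballI impI equals0I)
    fix \<pi> \<rho> \<zeta>
    assume "\<pi> \<in> paths_of_length s n" "\<rho> \<in> paths_of_length s n" "\<pi> \<noteq> \<rho>"
      "\<zeta> \<in> cylinder M s \<pi> \<inter> cylinder M s \<rho>"
    moreover from this have "\<zeta> \<in> maximal_paths M s"
      by (simp add: cylinder_def)
    then obtain x where "\<zeta> = Infinite_Path s x"
      by (rule maximal_path_infinite)
    ultimately show False
      by (simp add: cylinder_def paths_of_length_def path_prefix_Infinite)
  qed
  have within: "measure ?P (negative_within s n) = hit_prob_within M \<sigma> n (s, [])" for n
  proof -
    have "measure ?P (negative_within s n) =
        (\<Sum>\<pi> | \<pi> \<in> paths_of_length s n \<and> path_negative M \<pi>. measure ?P (cylinder M s \<pi>))"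
      unfolding negative_within_def
    proof (rule finite_measure_finite_Union)
      show "finite {\<pi> \<in> paths_of_length s n. path_negative M \<pi>}"
        using finite_paths_of_length[OF s] by simp
      show "cylinder M s ` {\<pi> \<in> paths_of_length s n. path_negative M \<pi>} \<subseteq> sets ?P"
        using sets by (auto simp: paths_of_length_def)
      show "disjoint_family_on (cylinder M s) {\<pi> \<in> paths_of_length s n. path_negative M \<pi>}"
        using disj by (rule disjoint_family_on_mono[rotated]) auto
    qed
    also have "\<dots> = (\<Sum>\<pi> | \<pi> \<in> paths_of_length s n \<and> path_negative M \<pi>. path_prob M \<sigma> \<pi>)"
    proof (intro sum.cong refl)
      fix \<pi>
      assume "\<pi> \<in> {\<pi>. \<pi> \<in> paths_of_length s n \<and> path_negative M \<pi>}"
      then have \<pi>: "\<pi> \<in> finite_paths M s"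
        by (simp add: paths_of_length_def)
      then have "0 \<le> path_prob M \<sigma> \<pi>"
        unfolding path_prob_def by (intro prod_nonneg) (auto simp: finite_paths_def)
      then show "measure ?P (cylinder M s \<pi>) = path_prob M \<sigma> \<pi>"
        using cyl[OF \<pi>] by (simp add: measure_def)
    qed
    finally show ?thesis
      by (simp add: hit_prob_within_eq_sum[OF s])
  qed
  have "(\<Union>n. negative_within s n) = eventually_negative M s"
  proof (intro set_eqI iffI)
    fix \<zeta>
    assume "\<zeta> \<in> (\<Union>n. negative_within s n)"
    then obtain n where n: "\<zeta> \<in> negative_within s n" and max: "\<zeta> \<in> maximal_paths M s"
      using negative_within_subset by blast
    obtain x where x: "\<zeta> = Infinite_Path s x"
      using max by (rule maximal_path_infinite)
    obtain i where "acc_weight M (s, stake i x) < 0"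
      using n max unfolding x by (auto simp: negative_within_iff)
    then show "\<zeta> \<in> eventually_negative M s"
      using max unfolding eventually_negative_def x
      by (auto intro!: exI[of _ s] exI[of _ "stake i x"])
  next
    fix \<zeta>
    assume "\<zeta> \<in> eventually_negative M s"
    then obtain \<pi> where \<pi>: "path_prefix \<pi> \<zeta>" "acc_weight M \<pi> < 0" and max: "\<zeta> \<in> maximal_paths M s"
      by (auto simp: eventually_negative_def)
    obtain x where x: "\<zeta> = Infinite_Path s x"
      using max by (rule maximal_path_infinite)
    have "\<zeta> \<in> negative_within s (path_length \<pi>)"
      using max \<pi> unfolding x by (auto simp: negative_within_iff path_prefix_Infinite)
    then show "\<zeta> \<in> (\<Union>n. negative_within s n)"
      by blast
  qed
  moreover have "incseq (negative_within s)"
  proof (rule incseq_SucI, rule subsetI)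
    fix n \<zeta>
    assume n: "\<zeta> \<in> negative_within s n"
    then have max: "\<zeta> \<in> maximal_paths M s"
      using negative_within_subset by blast
    obtain x where x: "\<zeta> = Infinite_Path s x"
      using max by (rule maximal_path_infinite)
    show "\<zeta> \<in> negative_within s (Suc n)"
      using n max unfolding x by (auto simp: negative_within_iff) (meson le_SucI)
  qed
  moreover have "range (negative_within s) \<subseteq> sets ?P"
  proof (rule image_subsetI)
    fix n
    show "negative_within s n \<in> sets ?P"
      unfolding negative_within_def
    proof (rule sets.finite_UN)
      show "finite {\<pi> \<in> paths_of_length s n. path_negative M \<pi>}"
        using finite_paths_of_length[OF s] by simp
    qed (simp add: sets paths_of_length_def)
  qed
  ultimately show ?thesis
    using finite_Lim_measure_incseq[of "negative_within s"] by (simp add: within)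
qed

end

section \<open>Chains with four equiprobable successors and a counter\<close>

text \<open>The list of four successors may contain repetitions and so encodes transition
  probabilities that are multiples of \<open>1/4\<close>. A negative counter counts as a hit for
  good.\<close>

primrec hits_within :: "('s \<Rightarrow> 's list) \<Rightarrow> ('s \<Rightarrow> int) \<Rightarrow> nat \<Rightarrow> 's \<Rightarrow> int \<Rightarrow> real" where
  "hits_within succ wg 0 s n = (if n < 0 then 1 else 0)"
| "hits_within succ wg (Suc N) s n =
     (if n < 0 then 1 else (\<Sum>t \<leftarrow> succ s. hits_within succ wg N t (n + wg s)) / 4)"

definition hits :: "('s \<Rightarrow> 's list) \<Rightarrow> ('s \<Rightarrow> int) \<Rightarrow> 's \<Rightarrow> int \<Rightarrow> real" where
  "hits succ wg s n = lim (\<lambda>N. hits_within succ wg N s n)"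

lemma sum_list_le_length:
  "(\<And>x. x \<in> set xs \<Longrightarrow> f x \<le> (1::real)) \<Longrightarrow> (\<Sum>x \<leftarrow> xs. f x) \<le> length xs"
  by (induction xs) force+

lemma tendsto_sum_list:
  fixes f :: "nat \<Rightarrow> 'a \<Rightarrow> real"
  shows "(\<And>x. x \<in> set xs \<Longrightarrow> (\<lambda>N. f N x) \<longlonglongrightarrow> g x) \<Longrightarrow>
    (\<lambda>N. \<Sum>x \<leftarrow> xs. f N x) \<longlonglongrightarrow> (\<Sum>x \<leftarrow> xs. g x)"
  by (induction xs) (auto intro!: tendsto_add)

locale quad_chain =
  fixes succ :: "'s \<Rightarrow> 's list" and wg :: "'s \<Rightarrow> int"
  assumes length_succ [simp]: "length (succ s) = 4"
begin

lemma hits_within_bounds: "0 \<le> hits_within succ wg N s n \<and> hits_within succ wg N s n \<le> 1"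
proof (induction N arbitrary: s n)
  case (Suc N)
  have "(\<Sum>t \<leftarrow> succ s. hits_within succ wg N t m) \<le> 4" for m
    using sum_list_le_length[of "succ s" "\<lambda>t. hits_within succ wg N t m"] Suc by simp
  moreover have "0 \<le> (\<Sum>t \<leftarrow> succ s. hits_within succ wg N t m)" for m
    using Suc by (auto intro!: sum_list_nonneg)
  ultimately show ?case
    by simp
qed simp

lemma hits_within_mono: "hits_within succ wg N s n \<le> hits_within succ wg (Suc N) s n"
proof (induction N arbitrary: s n)
  case 0
  then show ?case
    using hits_within_bounds[of "Suc 0" s n] by (cases "n < 0") (simp, simp del: hits_within.simps(2))
next
  case (Suc N)
  have "(\<Sum>t \<leftarrow> succ s. hits_within succ wg N t m) \<le> (\<Sum>t \<leftarrow> succ s. hits_within succ wg (Suc N) t m)" for m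
    using Suc by (auto intro!: sum_list_mono simp del: hits_within.simps)
  then show ?case
    by (simp del: hits_within.simps add: hits_within.simps(2)[of _ _ N] hits_within.simps(2)[of _ _ "Suc N"]
        divide_right_mono)
qed

lemma hits_tendsto: "(\<lambda>N. hits_within succ wg N s n) \<longlonglongrightarrow> hits succ wg s n"
proof -
  have "incseq (\<lambda>N. hits_within succ wg N s n)"
    by (rule incseq_SucI) (rule hits_within_mono)
  then have "convergent (\<lambda>N. hits_within succ wg N s n)"
    using hits_within_bounds by (metis Bseq_monoseq_convergent BseqI' abs_of_nonneg incseq_imp_monoseq real_norm_def)
  then show ?thesis
    unfolding hits_def by (simp add: convergent_LIMSEQ_iff)
qed

lemma hits_bounds: "0 \<le> hits succ wg s n" "hits succ wg s n \<le> 1"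
  using hits_tendsto[of s n] hits_within_bounds
  by (auto intro: LIMSEQ_le_const LIMSEQ_le_const2)

lemma hits_negative: "n < 0 \<Longrightarrow> hits succ wg s n = 1"
proof -
  assume "n < 0"
  then have "hits_within succ wg N s n = 1" for N
    by (cases N) auto
  then show ?thesis
    unfolding hits_def by simp
qed

lemma hits_step:
  assumes "0 \<le> n"
  shows "hits succ wg s n = (\<Sum>t \<leftarrow> succ s. hits succ wg t (n + wg s)) / 4"
proof -
  have "(\<lambda>N. hits_within succ wg (Suc N) s n) \<longlonglongrightarrow>
      (\<Sum>t \<leftarrow> succ s. hits succ wg t (n + wg s)) / 4"
    using assms by (auto intro!: tendsto_sum_list hits_tendsto tendsto_divide)
  then show ?thesis
    using LIMSEQ_unique LIMSEQ_Suc[OF hits_tendsto] by blast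
qed

lemma hits_absorbing:
  assumes "set (succ s) \<subseteq> {s}" "wg s = 0" "0 \<le> n"
  shows "hits succ wg s n = 0"
proof -
  have "hits_within succ wg N s n = 0" for N
  proof (induction N)
    case (Suc N)
    have "map (\<lambda>t. hits_within succ wg N t n) (succ s) = map (\<lambda>_. 0) (succ s)"
      using assms(1) Suc by (intro map_cong) auto
    then have "(\<Sum>t \<leftarrow> succ s. hits_within succ wg N t n) = 0"
      by (simp only: sum_list_0)
    then show ?case
      using assms by simp
  qed (use assms in simp)
  then show ?thesis
    unfolding hits_def by simp
qed

end

section \<open>The chain of an encoded recurrence\<close>

datatype pos_class =
  Alpha_Item | Alpha_End | Beta_Item | Beta_End | Sign bool
| Num_Digit bool | Num_End | Den_Digit bool | Den_End | Neutral

text \<open>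
  A state is a list \<open>[k, m, g, x, s, i, j, p]\<close> of numbers below the length of the input: \<open>k\<close> is the control
  state, \<open>m\<close> marks the shadow copy, \<open>g\<close> is the sign, \<open>x\<close> is the bit of a random comparison, \<open>s\<close> tells
  whether the item being read is selected, \<open>i\<close> and \<open>j\<close> are the positions of pebbles on the two lists of the
  input, and \<open>p\<close> is the position of a reading head. The control states are

  \<^item> \<open>0\<close>: choose between the game and the shadow; \<open>1\<close>, \<open>2\<close>: increase the counter; \<open>3\<close>: choose the sign;
    \<open>4\<close>: start;
  \<^item> \<open>5\<close>: move \<open>i\<close> to an \<open>\<alpha>\<close>-item; \<open>6\<close>: move \<open>j\<close> to a \<open>\<beta>\<close>-item; \<open>7\<close>, \<open>8\<close>: move \<open>j\<close> and then \<open>i\<close>;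
    \<open>9\<close>: sink;
  \<^item> \<open>10 + q\<close>: a pass over the input, which multiplies the signed probability by all denominators, where the
    one of the selected item is replaced with its numerator, and by a power of \<open>1/2\<close>;
  \<^item> \<open>16 + q\<close>: end of that pass, where the counter is decreased.

  Here \<open>q = 0\<close> skips an \<open>\<alpha>\<close>-item, \<open>q = 1\<close> selects it for a recursive call with smaller index, \<open>q = 2\<close> selects it
  as the last one, \<open>q = 3\<close> moves both pebbles, \<open>q = 4\<close> skips a \<open>\<beta>\<close>-item and \<open>q = 5\<close> selects it.
\<close>

datatype upd = Keep | Incr | Const nat

text \<open>All constants written are below 22, and inputs have length at least 22, so only
  \<open>Incr\<close> has to be capped to stay within the range of positions.\<close>

fun apply_upd :: "nat \<Rightarrow> upd \<Rightarrow> nat \<Rightarrow> nat" where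
  "apply_upd L Keep d = d"
| "apply_upd L Incr d = (if Suc d < L then Suc d else d)"
| "apply_upd L (Const c) d = c"

definition goto :: "nat \<Rightarrow> upd list" where
  "goto k = [Const k, Keep, Keep, Keep, Keep, Keep, Keep, Keep]"

definition goto_start :: "upd \<Rightarrow> bool \<Rightarrow> upd list" where
  "goto_start m g = [Const 4, m, Const (of_bool g), Keep, Keep, Keep, Keep, Keep]"

definition goto_pass :: "nat \<Rightarrow> upd list" where
  "goto_pass q = [Const (10 + q), Keep, Keep, Const 0, Const 0, Keep, Keep, Const 0]"

definition goto_move :: "nat \<Rightarrow> upd \<Rightarrow> upd \<Rightarrow> upd list" where
  "goto_move k i j = [Const k, Keep, Keep, Keep, Keep, i, j, Keep]"

definition proceed :: "upd \<Rightarrow> upd \<Rightarrow> upd \<Rightarrow> upd list" where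
  "proceed g x s = [Keep, Keep, g, x, s, Keep, Keep, Incr]"

text \<open>Each digit of the active number replaces \<open>x\<close> with probability
  \<open>1/2\<close>. Digits come least significant first, so digit \<open>i\<close> of
  \<open>l\<close> is the last one copied with probability \<open>2^i / 2^l\<close>, and a
  comparison starting with \<open>x = 0\<close> survives with probability equal to the number over
  \<open>2^l\<close>. Each digit of the inactive number ends the run with probability
  \<open>1/2\<close>, which keeps the power of \<open>1/2\<close> the same.\<close>

fun pass_slots :: "nat \<Rightarrow> bool \<Rightarrow> bool \<Rightarrow> bool \<Rightarrow> pos_class \<Rightarrow> bool \<Rightarrow> bool \<Rightarrow> upd list list" where
  "pass_slots k g x s Alpha_Item ei ej =
     replicate 4 (proceed Keep Keep (Const (of_bool ((k = 11 \<or> k = 12) \<and> ei \<or> k = 15 \<and> ej))))"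
| "pass_slots k g x s Beta_Item ei ej =
     replicate 4 (proceed Keep Keep (Const (of_bool ((k = 11 \<or> k = 12) \<and> ei \<or> k = 15 \<and> ej))))"
| "pass_slots k g x s (Sign b) ei ej =
     replicate 4 (proceed (if s \<and> b then Const (of_bool (\<not> g)) else Keep) Keep Keep)"
| "pass_slots k g x s (Num_Digit b) ei ej =
     (if s then [proceed Keep (Const (of_bool b)) Keep, proceed Keep (Const (of_bool b)) Keep,
        proceed Keep Keep Keep, proceed Keep Keep Keep]
      else [goto 9, goto 9, proceed Keep Keep Keep, proceed Keep Keep Keep])"
| "pass_slots k g x s (Den_Digit b) ei ej =
     (if \<not> s then [proceed Keep (Const (of_bool b)) Keep, proceed Keep (Const (of_bool b)) Keep,
        proceed Keep Keep Keep, proceed Keep Keep Keep]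
      else [goto 9, goto 9, proceed Keep Keep Keep, proceed Keep Keep Keep])"
| "pass_slots k g x s Num_End ei ej =
     replicate 4 (if s \<and> \<not> x then goto 9 else proceed Keep (Const 0) Keep)"
| "pass_slots k g x s Den_End ei ej =
     replicate 4 (if \<not> s \<and> \<not> x then goto 9 else proceed Keep (Const 0) Keep)"
| "pass_slots k g x s Alpha_End ei ej = replicate 4 (proceed Keep Keep Keep)"
| "pass_slots k g x s Neutral ei ej = replicate 4 (proceed Keep Keep Keep)"
| "pass_slots k g x s Beta_End ei ej =
     replicate 4 [Const (k + 6), Keep, Keep, Const 0, Const 0, Keep, Keep, Const 0]"

definition post_target :: "nat \<Rightarrow> upd list" where
  "post_target k =
     (if k = 16 then goto_move 5 Incr Keep
      else if k = 17 then goto_move 5 (Const 0) Keep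
      else if k = 18 then goto_move 7 Incr (Const 0)
      else if k = 19 then goto_move 7 Incr Incr
      else if k = 20 then goto_move 6 Keep Incr
      else goto 9)"

text \<open>Updates act on each coordinate separately, and the cases depend only on bounded data,
  classes and coincidences of positions, so the table can be tested coordinate by coordinate. The
  action \<open>a\<close> is consulted in control state \<open>3\<close> alone.\<close>

definition slots :: "bool \<Rightarrow> bool \<Rightarrow> nat \<Rightarrow> bool \<Rightarrow> bool \<Rightarrow> bool \<Rightarrow> bool \<Rightarrow>
    pos_class \<Rightarrow> pos_class \<Rightarrow> pos_class \<Rightarrow> bool \<Rightarrow> bool \<Rightarrow> upd list list" where
  "slots sg a k m g x s ci cj cp ei ej =
    (if 10 \<le> k \<and> k < 16 then pass_slots k g x s cp ei ej
     else if 16 \<le> k \<and> k < 22 then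
       (if k = 21 \<and> g then replicate 4 (goto 9)
        else if m then (let dead = [Const 9, Const 0, Keep, Keep, Keep, Keep, Keep, Keep]
          in [dead, dead, post_target k, post_target k])
        else replicate 4 (post_target k))
     else if k = 0 then [goto 1, goto 1, goto_start (Const 1) sg, goto_start (Const 1) sg]
     else if k = 1 then [goto 2, goto 2, goto 3, goto 3]
     else if k = 2 then replicate 4 (goto 1)
     else if k = 3 then replicate 4 (goto_start Keep (a \<noteq> sg))
     else if k = 4 then [goto 5, goto 5, goto 6, goto 6]
     else if k = 5 then
       (if ci = Alpha_Item then [goto_pass 0, goto_pass 1, goto_pass 2, goto 9]
        else replicate 4 (if ci \<in> {Alpha_End, Beta_End} then goto 9 else goto_move 5 Incr Keep))
     else if k = 6 then
       (if cj = Beta_Item then [goto_pass 4, goto_pass 5, goto 9, goto 9]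
        else replicate 4 (if cj = Beta_End then goto 9 else goto_move 6 Keep Incr))
     else if k = 7 then
       replicate 4 (if cj = Beta_Item then goto 8
         else if cj = Beta_End then goto 9 else goto_move 7 Keep Incr)
     else if k = 8 then
       (if ci = Alpha_Item then [goto_pass 3, goto 9, goto 9, goto 9]
        else replicate 4 (if ci = Alpha_End then goto 6
          else if ci = Beta_End then goto 9 else goto_move 8 Incr Keep))
     else replicate 4 (goto 9))"

text \<open>The final check \<open>21\<close> separates the signs: without \<open>g\<close>, a last
  decrement hits exactly if the counter is zero; with \<open>g\<close>, the run ends without a
  decrement. The shadow keeps its counter at zero, so the weight -1 at its sink makes reaching the
  sink a hit.\<close>

definition weight :: "nat \<Rightarrow> bool \<Rightarrow> bool \<Rightarrow> int" where
  "weight k m g =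
    (if 16 \<le> k \<and> k < 22 then (if m \<or> k = 21 \<and> g then 0 else -1)
     else if k = 2 then 1 else if k = 9 \<and> m then -1 else 0)"

definition state_weight :: "nat list \<Rightarrow> int" where
  "state_weight d = weight (d ! 0) (d ! 1 \<noteq> 0) (d ! 2 \<noteq> 0)"

definition succs :: "bool \<Rightarrow> pos_class list \<Rightarrow> bool \<Rightarrow> nat list \<Rightarrow> nat list list" where
  "succs sg cs a d = map (\<lambda>us. map2 (apply_upd (length cs)) us d)
     (slots sg a (d ! 0) (d ! 1 \<noteq> 0) (d ! 2 \<noteq> 0) (d ! 3 \<noteq> 0) (d ! 4 \<noteq> 0)
        (cs ! (d ! 5)) (cs ! (d ! 6)) (cs ! (d ! 7)) (d ! 7 = d ! 5) (d ! 7 = d ! 6))"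

lemma length_pass_slots: "length (pass_slots k g x s c ei ej) = 4"
  by (cases c) auto

lemma length_slots: "length (slots sg a k m g x s ci cj cp ei ej) = 4"
  by (simp add: slots_def length_pass_slots Let_def)

lemma length_succs [simp]: "length (succs sg cs a d) = 4"
  by (simp add: succs_def length_slots)

lemmas succs_simps = succs_def slots_def goto_def goto_start_def goto_pass_def goto_move_def proceed_def
  post_target_def state_weight_def weight_def

locale recurrence_chain =
  fixes sg :: bool and cs :: "pos_class list"
begin

sublocale quad_chain "succs sg cs False" state_weight
  by standard simp

abbreviation h :: "nat list \<Rightarrow> int \<Rightarrow> real" where
  "h \<equiv> hits (succs sg cs False) state_weight"

abbreviation "L \<equiv> length cs"

lemma replicate_4: "replicate 4 x = [x, x, x, x]"
  by (simp add: numeral_eq_Suc)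

lemma h_sink: "0 \<le> n \<Longrightarrow> h [9, 0, g, x, s, i, j, p] n = 0"
  by (rule hits_absorbing) (auto simp: succs_simps)

lemma h_shadow_sink: "h [9, Suc 0, g, x, s, i, j, p] 0 = 1"
  by (subst hits_step) (simp_all add: succs_simps replicate_4 hits_negative)

text \<open>The signed probability: exchanging the two values of \<open>g\<close> negates it, and
  premature hits cancel because a negative counter counts in both copies. This is the quantity that
  can follow a linear recurrence with coefficients of either sign.\<close>

definition D :: "nat \<Rightarrow> nat \<Rightarrow> nat \<Rightarrow> nat \<Rightarrow> nat \<Rightarrow> nat \<Rightarrow> int \<Rightarrow> real" where
  "D k x s i j p n = h [k, 0, 0, x, s, i, j, p] n - h [k, 0, 1, x, s, i, j, p] n"

lemma D_neg: "n < 0 \<Longrightarrow> D k x s i j p n = 0"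
  by (simp add: D_def hits_negative)

lemma D_start: "D 4 x s i j p n = (D 5 x s i j p n + D 6 x s i j p n) / 2"
proof (cases "n < 0")
  case False
  then show ?thesis
    unfolding D_def by (subst (1 2) hits_step) (simp_all add: succs_simps field_simps)
qed (simp add: D_neg)

text \<open>Three slots are used and the fourth leads to the sink; this gives every alternative the
  weight \<open>1/4\<close>, as in the rules for the \<beta>-pebble and for simultaneous
  moves.\<close>

lemma D_alpha_item:
  assumes "cs ! i = Alpha_Item"
  shows "D 5 x s i j p n = (D 10 0 0 i j 0 n + D 11 0 0 i j 0 n + D 12 0 0 i j 0 n) / 4"
proof (cases "n < 0")
  case False
  then show ?thesis
    unfolding D_def using assms by (subst (1 2) hits_step) (simp_all add: succs_simps h_sink field_simps)
qed (simp add: D_neg)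

lemma D_alpha_end:
  assumes "cs ! i = Alpha_End"
  shows "D 5 x s i j p n = 0"
proof (cases "n < 0")
  case False
  then show ?thesis
    unfolding D_def using assms by (subst (1 2) hits_step) (simp_all add: succs_simps replicate_4 h_sink)
qed (simp add: D_neg)

lemma D_alpha_walk:
  assumes "cs ! i \<notin> {Alpha_Item, Alpha_End, Beta_End}" "Suc i < L"
  shows "D 5 x s i j p n = D 5 x s (Suc i) j p n"
proof (cases "n < 0")
  case False
  then show ?thesis
    unfolding D_def using assms by (subst (1 2) hits_step) (simp_all add: succs_simps replicate_4)
qed (simp add: D_neg)

lemma D_beta_item:
  assumes "cs ! j = Beta_Item"
  shows "D 6 x s i j p n = (D 14 0 0 i j 0 n + D 15 0 0 i j 0 n) / 4"
proof (cases "n < 0")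
  case False
  then show ?thesis
    unfolding D_def using assms by (subst (1 2) hits_step) (simp_all add: succs_simps h_sink field_simps)
qed (simp add: D_neg)

lemma D_beta_end:
  assumes "cs ! j = Beta_End"
  shows "D 6 x s i j p n = 0"
proof (cases "n < 0")
  case False
  then show ?thesis
    unfolding D_def using assms by (subst (1 2) hits_step) (simp_all add: succs_simps replicate_4 h_sink)
qed (simp add: D_neg)

lemma D_beta_walk:
  assumes "cs ! j \<notin> {Beta_Item, Beta_End}" "Suc j < L"
  shows "D 6 x s i j p n = D 6 x s i (Suc j) p n"
proof (cases "n < 0")
  case False
  then show ?thesis
    unfolding D_def using assms by (subst (1 2) hits_step) (simp_all add: succs_simps replicate_4)
qed (simp add: D_neg)

lemma D_lock_beta_item:
  assumes "cs ! j = Beta_Item"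
  shows "D 7 x s i j p n = D 8 x s i j p n"
proof (cases "n < 0")
  case False
  then show ?thesis
    unfolding D_def using assms by (subst (1 2) hits_step[of n "7 # d" for d]) (simp_all add: succs_simps replicate_4)
qed (simp add: D_neg)

lemma D_lock_beta_walk:
  assumes "cs ! j \<notin> {Beta_Item, Beta_End}" "Suc j < L"
  shows "D 7 x s i j p n = D 7 x s i (Suc j) p n"
proof (cases "n < 0")
  case False
  then show ?thesis
    unfolding D_def using assms by (subst (1 2) hits_step) (simp_all add: succs_simps replicate_4)
qed (simp add: D_neg)

lemma D_lock_alpha_item:
  assumes "cs ! i = Alpha_Item"
  shows "D 8 x s i j p n = D 13 0 0 i j 0 n / 4"
proof (cases "n < 0")
  case False
  then show ?thesis
    unfolding D_def using assms by (subst (1 2) hits_step) (simp_all add: succs_simps h_sink field_simps)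
qed (simp add: D_neg)

lemma D_lock_alpha_end:
  assumes "cs ! i = Alpha_End"
  shows "D 8 x s i j p n = D 6 x s i j p n"
proof (cases "n < 0")
  case False
  then show ?thesis
    unfolding D_def using assms by (subst (1 2) hits_step[of n "8 # d" for d]) (simp_all add: succs_simps replicate_4)
qed (simp add: D_neg)

lemma D_lock_alpha_walk:
  assumes "cs ! i \<notin> {Alpha_Item, Alpha_End, Beta_End}" "Suc i < L"
  shows "D 8 x s i j p n = D 8 x s (Suc i) j p n"
proof (cases "n < 0")
  case False
  then show ?thesis
    unfolding D_def using assms by (subst (1 2) hits_step) (simp_all add: succs_simps replicate_4)
qed (simp add: D_neg)

lemma D_post:
  assumes "Suc i < L" "Suc j < L" "0 \<le> n"
  shows "D 16 x s i j p n = D 5 x s (Suc i) j p (n - 1)"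
    and "D 17 x s i j p n = D 5 x s 0 j p (n - 1)"
    and "D 18 x s i j p n = D 7 x s (Suc i) 0 p (n - 1)"
    and "D 19 x s i j p n = D 7 x s (Suc i) (Suc j) p (n - 1)"
    and "D 20 x s i j p n = D 6 x s i (Suc j) p (n - 1)"
proof -
  show "D 16 x s i j p n = D 5 x s (Suc i) j p (n - 1)"
    unfolding D_def using assms
    by (subst (1 2) hits_step[of n "16 # d" for d]) (simp_all add: succs_simps replicate_4)
  show "D 17 x s i j p n = D 5 x s 0 j p (n - 1)"
    unfolding D_def using assms
    by (subst (1 2) hits_step[of n "17 # d" for d]) (simp_all add: succs_simps replicate_4)
  show "D 18 x s i j p n = D 7 x s (Suc i) 0 p (n - 1)"
    unfolding D_def using assms
    by (subst (1 2) hits_step[of n "18 # d" for d]) (simp_all add: succs_simps replicate_4)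
  show "D 19 x s i j p n = D 7 x s (Suc i) (Suc j) p (n - 1)"
    unfolding D_def using assms
    by (subst (1 2) hits_step[of n "19 # d" for d]) (simp_all add: succs_simps replicate_4)
  show "D 20 x s i j p n = D 6 x s i (Suc j) p (n - 1)"
    unfolding D_def using assms
    by (subst (1 2) hits_step[of n "20 # d" for d]) (simp_all add: succs_simps replicate_4)
qed

lemma D_check: "0 \<le> n \<Longrightarrow> D 21 x s i j p n = (if n = 0 then 1 else 0)"
  unfolding D_def
  by (subst (1 2) hits_step) (simp_all add: succs_simps replicate_4 h_sink hits_negative)

context
  fixes k :: nat
  assumes k: "10 \<le> k" "k < 16"
begin

lemma D_pass_item:
  assumes "cs ! p \<in> {Alpha_Item, Beta_Item}" "Suc p < L"
  shows "D k x s i j p n =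
    D k x (of_bool ((k = 11 \<or> k = 12) \<and> p = i \<or> k = 15 \<and> p = j)) i j (Suc p) n"
proof (cases "n < 0")
  case False
  then show ?thesis
    unfolding D_def using assms k by (subst (1 2) hits_step) (auto simp: succs_simps replicate_4)
qed (simp add: D_neg)

lemma D_pass_neutral:
  assumes "cs ! p \<in> {Alpha_End, Neutral}" "Suc p < L"
  shows "D k x s i j p n = D k x s i j (Suc p) n"
proof (cases "n < 0")
  case False
  then show ?thesis
    unfolding D_def using assms k by (subst (1 2) hits_step) (auto simp: succs_simps replicate_4)
qed (simp add: D_neg)

lemma D_pass_sign:
  assumes "cs ! p = Sign b" "Suc p < L"
  shows "D k x s i j p n = (if s \<noteq> 0 \<and> b then -1 else 1) * D k x s i j (Suc p) n"
proof (cases "n < 0")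
  case False
  then show ?thesis
    unfolding D_def using assms k by (subst (1 2) hits_step) (auto simp: succs_simps replicate_4)
qed (simp add: D_neg)

lemma D_pass_digit:
  assumes "cs ! p = Num_Digit b \<and> s \<noteq> 0 \<or> cs ! p = Den_Digit b \<and> s = 0" "Suc p < L"
  shows "D k x s i j p n = (D k (of_bool b) s i j (Suc p) n + D k x s i j (Suc p) n) / 2"
proof (cases "n < 0")
  case False
  then show ?thesis
    unfolding D_def using assms k
    by (subst (1 2) hits_step) (auto simp: succs_simps replicate_4 field_simps)
qed (simp add: D_neg)

lemma D_pass_other_digit:
  assumes "cs ! p = Num_Digit b \<and> s = 0 \<or> cs ! p = Den_Digit b \<and> s \<noteq> 0" "Suc p < L"
  shows "D k x s i j p n = D k x s i j (Suc p) n / 2"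
proof (cases "n < 0")
  case False
  then show ?thesis
    unfolding D_def using assms k
    by (subst (1 2) hits_step) (auto simp: succs_simps replicate_4 h_sink field_simps)
qed (simp add: D_neg)

text \<open>\<open>r\<close> says whether the number just read was the active one; only then does
  the bit \<open>x\<close> decide about survival.\<close>

lemma D_pass_number_end:
  assumes "cs ! p = Num_End \<and> (r \<longleftrightarrow> s \<noteq> 0) \<or> cs ! p = Den_End \<and> (r \<longleftrightarrow> s = 0)" "Suc p < L"
  shows "D k x s i j p n = (if r \<and> x = 0 then 0 else 1) * D k 0 s i j (Suc p) n"
proof (cases "n < 0")
  case False
  then show ?thesis
    unfolding D_def using assms k
    by (subst (1 2) hits_step) (auto simp: succs_simps replicate_4 h_sink field_simps)
qed (simp add: D_neg)

lemma D_pass_end: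
  assumes "cs ! p = Beta_End"
  shows "D k x s i j p n = D (k + 6) 0 0 i j 0 n"
proof (cases "n < 0")
  case False
  then show ?thesis
    unfolding D_def using assms k
    by (subst (1 2) hits_step[of n "k # d" for d]) (auto simp: succs_simps replicate_4)
qed (simp add: D_neg)

end

end

context recurrence_chain
begin

section \<open>The shadow chain\<close>

text \<open>
  The counter never increases after the start. Hence, for a geometrically distributed initial value, a run
  avoids negative values with probability \<open>1/2\<close> to the number of decrements, and the shadow chain reproduces
  this probability without a counter by stopping with probability \<open>1/2\<close> at every decrement.
\<close>

definition W :: "nat list \<Rightarrow> real" where
  "W d = (\<Sum>n. (1 / 2) ^ Suc n * h d (int n))"

lemma summable_W: "summable (\<lambda>n. (1 / 2) ^ Suc n * h d (int n))"
proof (rule summable_comparison_test')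
  show "summable (\<lambda>n. (1 / 2 :: real) ^ Suc n)"
    by (intro summable_Suc_iff[THEN iffD2] summable_geometric) simp
  show "norm ((1 / 2) ^ Suc n * h d (int n)) \<le> (1 / 2) ^ Suc n" for n
    using hits_bounds[of d "int n"] by (simp add: abs_mult mult_left_le)
qed

lemma W_bounds: "0 \<le> W d" "W d \<le> 1"
proof -
  show "0 \<le> W d"
    unfolding W_def by (intro suminf_nonneg summable_W) (simp add: hits_bounds)
  have "W d \<le> (\<Sum>n. (1 / 2 :: real) ^ Suc n)"
    unfolding W_def
  proof (rule suminf_le[OF _ summable_W])
    show "(1 / 2) ^ Suc n * h d (int n) \<le> (1 / 2) ^ Suc n" for n
      by (rule mult_left_le) (simp_all add: hits_bounds)
    show "summable (\<lambda>n. (1 / 2 :: real) ^ Suc n)"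
      using power_half_series by (rule sums_summable)
  qed
  also have "\<dots> = 1"
    using power_half_series by (rule sums_unique[symmetric])
  finally show "W d \<le> 1" .
qed

lemma sum_list_W: "(\<Sum>t \<leftarrow> ts. W t) = (\<Sum>n. (1 / 2) ^ Suc n * (\<Sum>t \<leftarrow> ts. h t (int n)))"
proof (induction ts)
  case (Cons t ts)
  have "summable (\<lambda>n. (1 / 2) ^ Suc n * (\<Sum>t \<leftarrow> ts. h t (int n)))"
    by (induction ts) (simp_all add: distrib_left del: power_Suc, intro summable_add summable_W)
  then show ?case
    using Cons by (simp add: W_def distrib_left suminf_add[OF summable_W] del: power_Suc)
qed simp

lemma W_avg:
  assumes "state_weight d = 0"
  shows "W d = (\<Sum>t \<leftarrow> succs sg cs False d. W t) / 4"
proof -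
  have "(\<Sum>t \<leftarrow> succs sg cs False d. W t) = (\<Sum>n. 4 * ((1 / 2) ^ Suc n * h d (int n)))"
    unfolding sum_list_W by (subst hits_step[of _ d]) (simp_all add: assms)
  also have "\<dots> = 4 * W d"
    unfolding W_def by (rule suminf_mult[OF summable_W])
  finally show ?thesis
    by simp
qed

text \<open>With probability \<open>1/2\<close> the initial counter is zero and the decrement hits
  at once. Otherwise the geometric distribution is memoryless, so the decremented counter has the
  same law again; together with the average over four successors this gives the factor
  \<open>1/8\<close>.\<close>

lemma W_decrease:
  assumes "state_weight d = -1"
  shows "W d = 1 / 2 + (\<Sum>t \<leftarrow> succs sg cs False d. W t) / 8"
proof -
  let ?f = "\<lambda>n. (\<Sum>t \<leftarrow> succs sg cs False d. h t (int n))"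
  have "h d 0 = 1"
  proof -
    have "(\<Sum>t \<leftarrow> succs sg cs False d. h t (- 1)) = 4"
      by (simp add: hits_negative sum_list_triv)
    then show ?thesis
      by (subst hits_step) (simp_all add: assms)
  qed
  then have "W d = 1 / 2 + (\<Sum>n. (1 / 2) ^ Suc (Suc n) * h d (int (Suc n)))"
    unfolding W_def using suminf_split_initial_segment[OF summable_W, of d 1] by simp
  also have "(\<lambda>n. (1 / 2) ^ Suc (Suc n) * h d (int (Suc n))) = (\<lambda>n. (1 / 8) * ((1 / 2) ^ Suc n * ?f n))"
    by (rule ext, subst hits_step) (simp_all add: assms)
  also have "(\<Sum>n. (1 / 8) * ((1 / 2) ^ Suc n * ?f n)) = (1 / 8) * (\<Sum>n. (1 / 2) ^ Suc n * ?f n)"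
  proof (rule suminf_mult)
    have "(1 / 2) ^ Suc n * ?f n = 8 * ((1 / 2) ^ Suc (Suc n) * h d (int (Suc n)))" for n
      by (subst hits_step[of "int (Suc n)"]) (simp_all add: assms)
    moreover have "summable (\<lambda>n. 8 * ((1 / 2) ^ Suc (Suc n) * h d (int (Suc n))))"
      using summable_W[of d] by (intro summable_mult) (subst summable_Suc_iff)
    ultimately show "summable (\<lambda>n. (1 / 2) ^ Suc n * ?f n)"
      by simp
  qed
  finally show ?thesis
    by (simp add: sum_list_W)
qed

text \<open>The defect of complementarity: \<open>Z d = 0\<close> says that the hitting
  probabilities from \<open>d\<close> with a geometric counter and from the shadow of
  \<open>d\<close> with counter zero add up to one.\<close>

definition Z :: "nat list \<Rightarrow> real" where
  "Z d = W d + h (d[1 := 1]) 0 - 1"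

definition main_state :: "nat list \<Rightarrow> bool" where
  "main_state d \<longleftrightarrow> (\<exists>k g x s i j p. d = [k, 0, g, x, s, i, j, p] \<and> 4 \<le> k \<and> k < 22 \<and>
     i < L \<and> j < L \<and> p < L)"

text \<open>Decreases until the next decrement. The multiples of \<open>L\<close> order the control
  states as \<open>4\<close>, \<open>7\<close>, \<open>8\<close>, then \<open>5\<close> and
  \<open>6\<close>, then the passes; within one of them the moving pebble or head approaches the end
  of the input.\<close>

definition rank :: "nat list \<Rightarrow> nat" where
  "rank d = (if 10 \<le> d ! 0 then (if d ! 0 < 16 then Suc (L - d ! 7) else 0)
     else if d ! 0 = 4 then 10 * L + 20
     else if d ! 0 = 5 then L + 2 + (L - d ! 5)
     else if d ! 0 = 6 then L + 2 + (L - d ! 6)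
     else if d ! 0 = 7 then 5 * L + 10 + (L - d ! 6)
     else if d ! 0 = 8 then 3 * L + 5 + (L - d ! 5)
     else 0)"

lemma range_cases:
  fixes k :: nat
  assumes "4 \<le> k" "k < 22"
  obtains "k = 4" | "k = 5" | "k = 6" | "k = 7" | "k = 8" | "k = 9" | "10 \<le> k" "k < 16" | "16 \<le> k" "k < 22"
  using assms by linarith

lemma succs_main_state:
  assumes "main_state d" "d ! 0 \<noteq> 9" "d ! 0 < 16" "cs ! (L - 1) = Beta_End" "t \<in> set (succs sg cs False d)"
  shows "main_state t \<and> (rank t < rank d \<or> t ! 0 = 9)"
proof -
  obtain k g x s i j p where d: "d = [k, 0, g, x, s, i, j, p]" and k: "4 \<le> k" "k < 22"
    and b: "i < L" "j < L" "p < L"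
    using assms(1) by (auto simp: main_state_def)
  have L: "0 < L"
    using b by linarith
  have Suc: "Suc q < L" if "q < L" "cs ! q \<noteq> Beta_End" for q
    using that assms(4) by (metis Suc_lessI diff_Suc_1)
  show ?thesis
    using k
  proof (cases rule: range_cases)
    case 7
    then show ?thesis
      using assms(5) b Suc[of p] L unfolding d
      by (cases "cs ! p") (auto simp: succs_simps replicate_4 main_state_def rank_def split: if_splits)
  qed (use assms(2,3,5) b Suc[of i] Suc[of j] L in \<open>auto simp: d succs_simps replicate_4 main_state_def rank_def
      split: if_splits\<close>)
qed

lemma succs_shadow:
  assumes "main_state d" "d ! 0 \<noteq> 9" "d ! 0 < 16"
  shows "succs sg cs False (d[1 := 1]) = map (\<lambda>t. t[1 := 1]) (succs sg cs False d)"
    and "state_weight d = 0" "state_weight (d[1 := 1]) = 0"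
proof -
  obtain k g x s i j p where d: "d = [k, 0, g, x, s, i, j, p]" and k: "4 \<le> k" "k < 22"
    using assms(1) by (auto simp: main_state_def)
  show "state_weight d = 0" "state_weight (d[1 := 1]) = 0"
    using k assms(2,3) by (auto simp: d state_weight_def weight_def)
  show "succs sg cs False (d[1 := 1]) = map (\<lambda>t. t[1 := 1]) (succs sg cs False d)"
    using k
  proof (cases rule: range_cases)
    case 7
    then show ?thesis
      unfolding d by (cases "cs ! p") (simp_all add: succs_simps replicate_4)
  qed (use assms(2,3) in \<open>simp_all add: d succs_simps replicate_4\<close>)
qed

lemma Z_avg:
  assumes "main_state d" "d ! 0 \<noteq> 9" "d ! 0 < 16"
  shows "Z d = (\<Sum>t \<leftarrow> succs sg cs False d. Z t) / 4"
proof -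
  note s = succs_shadow[OF assms]
  have "(\<Sum>t \<leftarrow> ts. Z t) = (\<Sum>t \<leftarrow> ts. W t) + (\<Sum>t \<leftarrow> ts. h (t[1 := 1]) 0) - length ts" for ts
    by (induction ts) (auto simp: Z_def)
  moreover have "h (d[1 := 1]) 0 = (\<Sum>t \<leftarrow> succs sg cs False d. h (t[1 := 1]) 0) / 4"
    by (subst hits_step) (simp_all only: s map_map comp_def add_0 order_refl)
  ultimately show ?thesis
    unfolding Z_def by (simp add: W_avg[OF s(2)] add_divide_distrib diff_divide_distrib)
qed

lemma W_sink: "W [9, 0, g, x, s, i, j, p] = 0"
  unfolding W_def by (simp add: h_sink)

lemma Z_sink: "Z [9, 0, g, x, s, i, j, p] = 0"
  by (simp add: Z_def W_sink h_shadow_sink)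

text \<open>The decrement gives \<open>1/2\<close> plus half the value of \<open>W\<close> at the
  target, while the shadow stops without a hit with probability \<open>1/2\<close>; together they
  leave half the defect of the target.\<close>

lemma Z_post:
  assumes "16 \<le> k" "k < 22" "\<not> (k = 21 \<and> g \<noteq> 0)"
  shows "Z [k, 0, g, x, s, i, j, p] = Z (map2 (apply_upd L) (post_target k) [k, 0, g, x, s, i, j, p]) / 2"
proof -
  let ?d = "[k, 0, g, x, s, i, j, p]" and ?t = "\<lambda>m. map2 (apply_upd L) (post_target k) [k, m, g, x, s, i, j, p]"
  have t: "succs sg cs False ?d = [?t 0, ?t 0, ?t 0, ?t 0]"
    using assms by (auto simp: succs_def slots_def replicate_4)
  have "state_weight ?d = -1"
    using assms by (auto simp: state_weight_def weight_def)
  from W_decrease[OF this] have W: "W ?d = 1 / 2 + W (?t 0) / 2"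
    by (simp add: t)
  have shadow: "succs sg cs False (?d[1 := 1]) =
      [[9, 0, g, x, s, i, j, p], [9, 0, g, x, s, i, j, p], ?t 1, ?t 1]"
    using assms by (auto simp: succs_def slots_def Let_def)
  have "(?t 0)[1 := 1] = ?t 1"
    by (simp add: post_target_def goto_move_def goto_def)
  moreover have "h (?d[1 := 1]) 0 = h (?t 1) 0 / 2"
    using assms by (subst hits_step) (simp, simp only: shadow, simp add: h_sink state_weight_def weight_def)
  ultimately show ?thesis
    unfolding Z_def by (simp add: W field_simps)
qed

lemma Z_post_negative:
  assumes "g \<noteq> 0"
  shows "Z [21, 0, g, x, s, i, j, p] = 0"
proof -
  have "W [21, 0, g, x, s, i, j, p] = 0"
    using assms by (subst W_avg) (auto simp: succs_simps replicate_4 W_sink)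
  moreover have "h [21, Suc 0, g, x, s, i, j, p] 0 = 1"
    using assms by (subst hits_step) (auto simp: succs_simps replicate_4 h_shadow_sink)
  ultimately show ?thesis
    by (simp add: Z_def)
qed

text \<open>\<open>Z\<close> is harmonic between decrements, halved by each of them and zero where a
  run ends, while \<open>rank\<close> excludes long runs without a decrement. The outer induction
  counts halvings, the inner one is on \<open>rank\<close>.\<close>

lemma Z_le_power:
  assumes "cs ! (L - 1) = Beta_End"
  shows "main_state d \<Longrightarrow> \<bar>Z d\<bar> \<le> (1 / 2) ^ M"
proof (induction M arbitrary: d)
  case 0
  then show ?case
    using W_bounds[of d] hits_bounds[of "d[1 := 1]" 0] by (simp add: Z_def)
next
  case (Suc M)
  show ?case
    using Suc.prems
  proof (induction d rule: measure_induct_rule[of rank])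
    case (less d)
    obtain k g x s i j p where d: "d = [k, 0, g, x, s, i, j, p]" and k: "4 \<le> k" "k < 22"
      and b: "i < L" "j < L" "p < L"
      using less.prems by (auto simp: main_state_def)
    consider "k = 9" | "16 \<le> k" "k = 21 \<and> g \<noteq> 0" | "16 \<le> k" "\<not> (k = 21 \<and> g \<noteq> 0)" | "k \<noteq> 9" "k < 16"
      by linarith
    then show ?case
    proof cases
      case 1
      then show ?thesis
        by (simp add: d Z_sink)
    next
      case 2
      then show ?thesis
        by (simp add: d Z_post_negative)
    next
      case 3
      have "main_state (map2 (apply_upd L) (post_target k) d)"
        using k b by (auto simp: d main_state_def post_target_def goto_move_def goto_def)
      from Suc.IH[OF this] show ?thesis
        using Z_post[OF 3(1) k(2) 3(2), of x s i j p] by (simp add: d)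
    next
      case 4
      have "\<bar>Z t\<bar> \<le> (1 / 2) ^ Suc M" if t: "t \<in> set (succs sg cs False d)" for t
      proof -
        have "main_state t" "rank t < rank d \<or> t ! 0 = 9"
          using succs_main_state[OF less.prems _ _ assms t] 4 by (auto simp: d)
        then show ?thesis
          using less.IH[of t] by (auto simp: main_state_def Z_sink)
      qed
      then have "\<bar>\<Sum>t \<leftarrow> succs sg cs False d. Z t\<bar> \<le> (\<Sum>t \<leftarrow> succs sg cs False d. (1 / 2) ^ Suc M)"
        by (intro order_trans[OF sum_list_abs]) (simp add: sum_list_mono comp_def del: power_Suc)
      then show ?thesis
        using Z_avg[OF less.prems] 4 by (simp add: d sum_list_triv)
    qed
  qed
qed

lemma W_plus_shadow:
  assumes "cs ! (L - 1) = Beta_End" "i < L" "j < L" "p < L"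
  shows "W [4, 0, g, x, s, i, j, p] + h [4, 1, g, x, s, i, j, p] 0 = 1"
proof -
  have "main_state [4, 0, g, x, s, i, j, p]"
    using assms by (simp add: main_state_def)
  then have "\<bar>Z [4, 0, g, x, s, i, j, p]\<bar> \<le> (1 / 2) ^ M" for M
    using Z_le_power[OF assms(1)] by blast
  moreover have "(\<lambda>M. (1 / 2 :: real) ^ M) \<longlonglongrightarrow> 0"
    by (rule LIMSEQ_power_zero) simp
  ultimately have "\<bar>Z [4, 0, g, x, s, i, j, p]\<bar> \<le> 0"
    by (intro LIMSEQ_le_const) auto
  then show ?thesis
    by (simp add: Z_def)
qed

lemma h_game_step:
  assumes "0 \<le> n"
  shows "h [1, 0, 0, 0, 0, 0, 0, 0] n =
    (h [1, 0, 0, 0, 0, 0, 0, 0] (n + 1) + h [4, 0, of_bool sg, 0, 0, 0, 0, 0] n) / 2"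
proof -
  have "h [1, 0, 0, 0, 0, 0, 0, 0] n = (h [2, 0, 0, 0, 0, 0, 0, 0] n + h [3, 0, 0, 0, 0, 0, 0, 0] n) / 2"
    using assms by (subst hits_step[of n "1 # d" for d]) (simp_all add: succs_simps)
  moreover have "h [2, 0, 0, 0, 0, 0, 0, 0] n = h [1, 0, 0, 0, 0, 0, 0, 0] (n + 1)"
    using assms by (subst hits_step[of n "2 # d" for d]) (simp_all add: succs_simps replicate_4)
  moreover have "h [3, 0, 0, 0, 0, 0, 0, 0] n = h [4, 0, of_bool sg, 0, 0, 0, 0, 0] n"
    using assms by (subst hits_step[of n "3 # d" for d]) (simp_all add: succs_simps replicate_4)
  ultimately show ?thesis
    by simp
qed

text \<open>Unrolling the game \<open>N\<close> times leaves a remainder of weight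
  \<open>(1 / 2) ^ N\<close>; the start with the fixed sign at counter \<open>n\<close> enters with
  weight \<open>(1 / 2) ^ Suc n\<close>, which is the weight in \<open>W\<close>.\<close>

lemma h_game: "h [1, 0, 0, 0, 0, 0, 0, 0] 0 = W [4, 0, of_bool sg, 0, 0, 0, 0, 0]"
proof -
  let ?S = "\<lambda>n. h [4, 0, of_bool sg, 0, 0, 0, 0, 0] (int n)" and ?G = "\<lambda>n. h [1, 0, 0, 0, 0, 0, 0, 0] (int n)"
  have "?G 0 = (\<Sum>n<N. (1 / 2) ^ Suc n * ?S n) + (1 / 2) ^ N * ?G N" for N
  proof (induction N)
    case (Suc N)
    have "?G N = (?G (Suc N) + ?S N) / 2"
      using h_game_step[of "int N"] by (simp add: add.commute)
    then show ?case
      using Suc by (simp add: field_simps)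
  qed simp
  then have "(\<Sum>n<N. (1 / 2) ^ Suc n * ?S n) = ?G 0 - (1 / 2) ^ N * ?G N" for N
    by (simp add: algebra_simps)
  moreover have "(\<lambda>N. (1 / 2) ^ N * ?G N) \<longlonglongrightarrow> 0"
  proof (rule Lim_null_comparison)
    show "(\<lambda>N. (1 / 2 :: real) ^ N) \<longlonglongrightarrow> 0"
      by (rule LIMSEQ_power_zero) simp
    show "\<forall>\<^sub>F N in sequentially. norm ((1 / 2) ^ N * ?G N) \<le> (1 / 2) ^ N"
      using hits_bounds by (auto simp: abs_mult intro!: mult_left_le)
  qed
  ultimately have "(\<lambda>N. \<Sum>n<N. (1 / 2) ^ Suc n * ?S n) \<longlonglongrightarrow> ?G 0 - 0"
    by (simp only:) (intro tendsto_intros)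
  then have "(\<lambda>n. (1 / 2) ^ Suc n * ?S n) sums ?G 0"
    by (simp add: sums_def)
  then show ?thesis
    by (simp add: W_def sums_iff)
qed

end

section \<open>Position classes of an encoded recurrence\<close>

fun bit_value :: "bool list \<Rightarrow> nat" where
  "bit_value [] = 0"
| "bit_value (b # bs) = of_bool b + 2 * bit_value bs"

lemma bit_value_bits: "bit_value (bits n) = n"
  by (induction n rule: bits.induct) (subst bits.simps, auto simp: mod_2_eq_odd[symmetric])

definition num_bits :: "rat \<Rightarrow> bool list" where
  "num_bits r = bits (nat \<bar>fst (quotient_of r)\<bar>)"

definition den_bits :: "rat \<Rightarrow> bool list" where
  "den_bits r = bits (nat \<bar>snd (quotient_of r)\<bar>)"

definition digit_classes :: "(bool \<Rightarrow> pos_class) \<Rightarrow> bool list \<Rightarrow> pos_class list" where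
  "digit_classes f bs = concat (map (\<lambda>b. [Neutral, f b]) bs)"

definition item_classes :: "pos_class \<Rightarrow> rat \<Rightarrow> pos_class list" where
  "item_classes c r = c # Sign (fst (quotient_of r) < 0) # digit_classes Num_Digit (num_bits r) @
     Num_End # Neutral # digit_classes Den_Digit (den_bits r) @ [Den_End]"

definition list_classes :: "pos_class \<Rightarrow> rat list \<Rightarrow> pos_class list" where
  "list_classes c rs = concat (map (item_classes c) rs)"

definition input_classes :: "rat list \<Rightarrow> rat list \<Rightarrow> pos_class list" where
  "input_classes as bs =
     list_classes Alpha_Item as @ Alpha_End # list_classes Beta_Item bs @ [Beta_End]"

lemma length_digit_classes [simp]: "length (digit_classes f bs) = 2 * length bs"
  by (induction bs) (auto simp: digit_classes_def)

lemma set_digit_classes: "set (digit_classes f bs) \<subseteq> insert Neutral (range f)"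
  by (auto simp: digit_classes_def split: if_splits)

lemma set_item_classes:
  assumes "x \<in> set (item_classes c r)"
  shows "x = c \<or> x \<notin> {Alpha_Item, Alpha_End, Beta_Item, Beta_End}"
proof -
  have "x = c \<or> x = Sign (fst (quotient_of r) < 0) \<or> x = Num_End \<or> x = Neutral \<or> x = Den_End \<or>
      x \<in> set (digit_classes Num_Digit (num_bits r)) \<or> x \<in> set (digit_classes Den_Digit (den_bits r))"
    using assms unfolding item_classes_def by auto
  then show ?thesis
    by (elim disjE) (auto dest: subsetD[OF set_digit_classes])
qed

lemma set_tl_item_classes:
  assumes "x \<in> set (tl (item_classes c r))"
  shows "x \<notin> {Alpha_Item, Alpha_End, Beta_Item, Beta_End}"
  using assms set_item_classes[of x Neutral r] by (auto simp: item_classes_def)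

lemma list_classes_Cons: "list_classes c (r # rs) = item_classes c r @ list_classes c rs"
  by (simp add: list_classes_def)

lemma list_classes_append: "list_classes c (rs @ ss) = list_classes c rs @ list_classes c ss"
  by (simp add: list_classes_def)

definition sgn_factor :: "bool \<Rightarrow> real" where
  "sgn_factor b = (if b then -1 else 1)"

text \<open>The contribution of one item to a pass: its signed numerator if it is selected, its
  denominator otherwise. The power of two counts the digits of both numbers and is therefore
  independent of the selection.\<close>

definition factor :: "bool \<Rightarrow> rat \<Rightarrow> real" where
  "factor sel r = (if sel then of_int (fst (quotient_of r)) else of_int (snd (quotient_of r))) /
     2 ^ (length (num_bits r) + length (den_bits r))"

lemma factor_pos: "0 < factor False r"
  using quotient_of_denom_pos'[of r] by (simp add: factor_def)

lemma factor_True: "factor True r = factor False r * of_rat r"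
proof -
  have "of_rat r = (of_int (fst (quotient_of r)) / of_int (snd (quotient_of r)) :: real)"
    using quotient_of_div[of r "fst (quotient_of r)" "snd (quotient_of r)"]
    by (metis of_rat_divide of_rat_of_int_eq prod.collapse)
  then show ?thesis
    using quotient_of_denom_pos'[of r] by (simp add: factor_def)
qed

lemma drop_eq_ConsD:
  assumes "drop p xs = y # ys"
  shows "xs ! p = y" "p < length xs" "drop (Suc p) xs = ys" "ys \<noteq> [] \<Longrightarrow> Suc p < length xs"
proof -
  show p: "p < length xs"
    using assms by (metis drop_all list.distinct(1) not_less)
  then show "xs ! p = y" "drop (Suc p) xs = ys"
    using assms by (auto simp flip: Cons_nth_drop_Suc)
  then show "ys \<noteq> [] \<Longrightarrow> Suc p < length xs"
    by (metis drop_all not_less)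
qed

section \<open>Effect of one pass over the input\<close>

context recurrence_chain
begin

context
  fixes k :: nat
  assumes k: "10 \<le> k" "k < 16"
begin

text \<open>For the induction the comparison starts with an arbitrary bit \<open>x\<close>, which
  escapes all replacements with probability \<open>1 / 2 ^ length bs\<close> and hence adds
  \<open>x\<close> to the numerator.\<close>

lemma D_selected_number:
  assumes "f = Num_Digit \<and> e = Num_End \<and> s \<noteq> 0 \<or> f = Den_Digit \<and> e = Den_End \<and> s = 0"
    and "drop p cs = digit_classes f bs @ e # ys" "ys \<noteq> []" "x \<le> 1"
  shows "D k x s i j p n =
    (bit_value bs + x) / 2 ^ length bs * D k 0 s i j (Suc (p + 2 * length bs)) n"
  using assms(2,4)
proof (induction bs arbitrary: p x)
  case Nil
  note d = drop_eq_ConsD[of p cs e ys]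
  show ?case
    using D_pass_number_end[OF k, of p True s x i j n] Nil assms(1,3) d by (auto simp: digit_classes_def)
next
  case (Cons b bs)
  have e: "drop p cs = Neutral # f b # digit_classes f bs @ e # ys"
    using Cons.prems(1) by (simp add: digit_classes_def)
  note d = drop_eq_ConsD[OF e]
  note d' = drop_eq_ConsD[OF d(3)]
  have "D k x s i j p n = D k x s i j (Suc p) n"
    using d by (intro D_pass_neutral[OF k]) auto
  also have "\<dots> = (D k (of_bool b) s i j (Suc (Suc p)) n + D k x s i j (Suc (Suc p)) n) / 2"
    using d d' assms(1) by (intro D_pass_digit[OF k]) auto
  also have "\<dots> = ((bit_value bs + of_bool b) / 2 ^ length bs * D k 0 s i j (Suc (Suc (Suc p) + 2 * length bs)) n +
      (bit_value bs + x) / 2 ^ length bs * D k 0 s i j (Suc (Suc (Suc p) + 2 * length bs)) n) / 2"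
    using Cons.IH[OF d'(3), of "of_bool b"] Cons.IH[OF d'(3) Cons.prems(2)] by simp
  also have "\<dots> = (bit_value (b # bs) + x) / 2 ^ length (b # bs) *
      D k 0 s i j (Suc (p + 2 * length (b # bs))) n"
    by (simp add: field_simps)
  finally show ?case .
qed

lemma D_skipped_number:
  assumes "f = Num_Digit \<and> e = Num_End \<and> s = 0 \<or> f = Den_Digit \<and> e = Den_End \<and> s \<noteq> 0"
    and "drop p cs = digit_classes f bs @ e # ys" "ys \<noteq> []"
  shows "D k x s i j p n = 1 / 2 ^ length bs * D k 0 s i j (Suc (p + 2 * length bs)) n"
  using assms(2)
proof (induction bs arbitrary: p)
  case Nil
  note d = drop_eq_ConsD[of p cs e ys]
  show ?case
    using D_pass_number_end[OF k, of p False s x i j n] Nil assms(1,3) d by (auto simp: digit_classes_def)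
next
  case (Cons b bs)
  have e: "drop p cs = Neutral # f b # digit_classes f bs @ e # ys"
    using Cons.prems(1) by (simp add: digit_classes_def)
  note d = drop_eq_ConsD[OF e]
  note d' = drop_eq_ConsD[OF d(3)]
  have "D k x s i j p n = D k x s i j (Suc p) n"
    using d by (intro D_pass_neutral[OF k]) auto
  also have "\<dots> = D k x s i j (Suc (Suc p)) n / 2"
    using d d' assms(1) by (intro D_pass_other_digit[OF k, where b = b]) auto
  also have "\<dots> = 1 / 2 ^ length (b # bs) * D k 0 s i j (Suc (p + 2 * length (b # bs))) n"
    using Cons.IH[OF d'(3)] by simp
  finally show ?case .
qed

definition selected :: "nat \<Rightarrow> nat \<Rightarrow> nat \<Rightarrow> bool" where
  "selected i j p \<longleftrightarrow> (k = 11 \<or> k = 12) \<and> p = i \<or> k = 15 \<and> p = j"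

lemma D_item:
  assumes "drop p cs = item_classes c r @ ys" "ys \<noteq> []" "c \<in> {Alpha_Item, Beta_Item}"
  shows "D k 0 s i j p n = factor (selected i j p) r *
    D k 0 (of_bool (selected i j p)) i j (p + length (item_classes c r)) n"
proof -
  let ?s = "of_bool (selected i j p) :: nat" and ?N = "num_bits r" and ?M = "den_bits r"
  let ?a = "fst (quotient_of r)" and ?b = "snd (quotient_of r)"
  define p1 where "p1 = Suc (Suc p)"
  define p2 where "p2 = Suc (p1 + 2 * length ?N)"
  have e: "drop p cs = c # Sign (?a < 0) # digit_classes Num_Digit ?N @ Num_End # Neutral #
      digit_classes Den_Digit ?M @ Den_End # ys"
    using assms(1) by (simp add: item_classes_def)
  note d = drop_eq_ConsD[OF e]
  note d' = drop_eq_ConsD[OF d(3)]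
  have p1: "drop p1 cs = digit_classes Num_Digit ?N @ Num_End # Neutral #
      digit_classes Den_Digit ?M @ Den_End # ys"
    using d'(3) by (simp add: p1_def)
  have "drop (2 * length ?N) (drop p1 cs) = Num_End # Neutral # digit_classes Den_Digit ?M @ Den_End # ys"
    unfolding p1 by simp
  then have "drop (p1 + 2 * length ?N) cs = Num_End # Neutral # digit_classes Den_Digit ?M @ Den_End # ys"
    by (simp add: add.commute)
  from drop_eq_ConsD(3)[OF this]
  have p2: "drop p2 cs = Neutral # digit_classes Den_Digit ?M @ Den_End # ys"
    by (simp add: p2_def)
  note d2 = drop_eq_ConsD[OF p2]
  have len: "p + length (item_classes c r) = Suc (Suc p2 + 2 * length ?M)"
    by (simp add: item_classes_def p1_def p2_def)
  have "D k 0 s i j p n = D k 0 ?s i j (Suc p) n"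
    using d assms(3) unfolding selected_def by (intro D_pass_item[OF k]) auto
  also have "\<dots> = sgn_factor (selected i j p \<and> ?a < 0) * D k 0 ?s i j p1 n"
    using D_pass_sign[OF k, of "Suc p" "?a < 0" 0 ?s i j n] d d' by (simp add: sgn_factor_def p1_def)
  also have "D k 0 ?s i j p1 n =
      (if selected i j p then nat \<bar>?a\<bar> else 1) / 2 ^ length ?N * D k 0 ?s i j p2 n"
    using D_selected_number[OF _ p1, of ?s 0 i j n] D_skipped_number[OF _ p1, of ?s 0 i j n]
    by (simp add: p2_def bit_value_bits num_bits_def)
  also have "D k 0 ?s i j p2 n = D k 0 ?s i j (Suc p2) n"
    using d2 by (intro D_pass_neutral[OF k]) auto
  also have "\<dots> = (if selected i j p then 1 else nat \<bar>?b\<bar>) / 2 ^ length ?M *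
      D k 0 ?s i j (p + length (item_classes c r)) n"
    unfolding len
    using D_selected_number[OF _ d2(3) assms(2), of ?s 0 i j n]
      D_skipped_number[OF _ d2(3) assms(2), of ?s 0 i j n]
    by (simp add: bit_value_bits den_bits_def)
  finally show ?thesis
    using quotient_of_denom_pos'[of r]
    by (cases "selected i j p") (auto simp: factor_def sgn_factor_def power_add abs_if)
qed

text \<open>The flag \<open>s'\<close> left by the last item is existentially quantified: a later
  item overwrites it, and \<open>Beta_End\<close> resets it.\<close>

lemma D_items:
  assumes "drop p cs = list_classes c rs @ ys" "ys \<noteq> []" "c \<in> {Alpha_Item, Beta_Item}"
  shows "\<exists>s'. D k 0 s i j p n =
    (\<Prod>t<length rs. factor (selected i j (p + length (list_classes c (take t rs)))) (rs ! t)) *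
      D k 0 s' i j (p + length (list_classes c rs)) n"
  using assms(1)
proof (induction rs arbitrary: p s)
  case Nil
  show ?case
    by (intro exI[of _ s]) (simp add: list_classes_def)
next
  case (Cons r rs)
  let ?p = "p + length (item_classes c r)"
  have e: "drop p cs = item_classes c r @ list_classes c rs @ ys"
    using Cons.prems by (simp add: list_classes_Cons)
  then have "drop (length (item_classes c r)) (drop p cs) = list_classes c rs @ ys"
    by simp
  then have e': "drop ?p cs = list_classes c rs @ ys"
    by (simp add: add.commute)
  obtain s' where s': "D k 0 (of_bool (selected i j p)) i j ?p n =
      (\<Prod>t<length rs. factor (selected i j (?p + length (list_classes c (take t rs)))) (rs ! t)) *
        D k 0 s' i j (?p + length (list_classes c rs)) n"
    using Cons.IH[OF e'] by blast
  have "D k 0 s i j p n = factor (selected i j p) r * D k 0 (of_bool (selected i j p)) i j ?p n"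
    using assms(2,3) by (intro D_item[OF e]) auto
  then show ?case
    unfolding s' by (intro exI[of _ s'])
      (simp add: list_classes_Cons prod.lessThan_Suc_shift add.assoc list_classes_def[of _ "[]"]
        del: prod.lessThan_Suc)
qed

end

text \<open>Markers occur only at heads of items and ends of lists, so a pebble that leaves one
  marker walks on without branching until the next.\<close>

lemma inner_classes:
  assumes "drop q cs = item_classes c r @ ys" "q < p" "p < q + length (item_classes c r)"
  shows "cs ! p \<notin> {Alpha_Item, Alpha_End, Beta_Item, Beta_End}"
proof -
  have "q \<le> length cs"
    using drop_eq_ConsD(2)[of q cs c] assms(1) by (simp add: item_classes_def)
  then have "cs ! p = drop q cs ! (p - q)"
    using assms(2) by simp
  also have "\<dots> = item_classes c r ! (p - q)"
    unfolding assms(1) using assms(2,3) by (intro nth_append_left) linarith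
  also have "\<dots> = tl (item_classes c r) ! (p - q - 1)"
    using assms(2) by (simp add: item_classes_def nth_Cons')
  also have "\<dots> \<in> set (tl (item_classes c r))"
    using assms(2,3) by (intro nth_mem) simp
  finally show ?thesis
    by (rule set_tl_item_classes)
qed

lemma walk_eq:
  fixes f :: "nat \<Rightarrow> real"
  assumes "\<And>p. q \<le> p \<Longrightarrow> p < q' \<Longrightarrow> f p = f (Suc p)" "q \<le> q'"
  shows "f q = f q'"
  using assms(2,1) by (induction rule: dec_induct) auto

end

section \<open>Signed probabilities of the pebble walks\<close>

locale lrs_chain = recurrence_chain +
  fixes as bs :: "rat list" and N :: nat
  assumes cs: "cs = input_classes as bs" and length_as: "length as = N" and length_bs: "length bs = N"
    and N_pos: "0 < N"
begin

definition alpha_pos :: "nat \<Rightarrow> nat" where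
  "alpha_pos t = length (list_classes Alpha_Item (take t as))"

definition beta_pos :: "nat \<Rightarrow> nat" where
  "beta_pos t = Suc (alpha_pos N) + length (list_classes Beta_Item (take t bs))"

lemma drop_list_classes:
  assumes "t < length rs"
  shows "drop (length (list_classes c (take t rs))) (list_classes c rs @ ys) =
    item_classes c (rs ! t) @ list_classes c (drop (Suc t) rs) @ ys"
proof -
  have "list_classes c rs = list_classes c (take t rs @ rs ! t # drop (Suc t) rs)"
    using assms by (simp flip: id_take_nth_drop)
  then show ?thesis
    by (simp add: list_classes_append list_classes_Cons)
qed

lemma drop_alpha:
  "t < N \<Longrightarrow> drop (alpha_pos t) cs = item_classes Alpha_Item (as ! t) @
     list_classes Alpha_Item (drop (Suc t) as) @ Alpha_End # list_classes Beta_Item bs @ [Beta_End]"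
  unfolding alpha_pos_def cs input_classes_def by (rule drop_list_classes) (simp add: length_as)

lemma drop_alpha_end: "drop (alpha_pos N) cs = Alpha_End # list_classes Beta_Item bs @ [Beta_End]"
  unfolding alpha_pos_def cs input_classes_def by (simp flip: length_as)

lemma drop_beta_start: "drop (beta_pos 0) cs = list_classes Beta_Item bs @ [Beta_End]"
  using drop_eq_ConsD(3)[OF drop_alpha_end] by (simp add: beta_pos_def list_classes_def[of _ "[]"])

lemma drop_beta: "t < N \<Longrightarrow> drop (beta_pos t) cs = item_classes Beta_Item (bs ! t) @
     list_classes Beta_Item (drop (Suc t) bs) @ [Beta_End]"
  using drop_list_classes[of t bs Beta_Item "[Beta_End]"]
  by (simp add: length_bs flip: drop_beta_start)
    (simp add: beta_pos_def list_classes_def[of _ "[]"] add.commute)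

lemma drop_beta_end: "drop (beta_pos N) cs = [Beta_End]"
proof -
  have "drop (length (list_classes Beta_Item bs)) (drop (beta_pos 0) cs) = [Beta_End]"
    unfolding drop_beta_start by simp
  then show ?thesis
    by (simp add: beta_pos_def list_classes_def[of _ "[]"] add.commute length_bs)
qed

lemma alpha_pos_Suc:
  "t < N \<Longrightarrow> alpha_pos (Suc t) = alpha_pos t + length (item_classes Alpha_Item (as ! t))"
  by (simp add: alpha_pos_def take_Suc_conv_app_nth length_as list_classes_append)
    (simp add: list_classes_def)

lemma beta_pos_Suc:
  "t < N \<Longrightarrow> beta_pos (Suc t) = beta_pos t + length (item_classes Beta_Item (bs ! t))"
  by (simp add: beta_pos_def take_Suc_conv_app_nth length_bs list_classes_append)
    (simp add: list_classes_def)

lemma item_classes_not_Nil: "0 < length (item_classes c r)"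
  by (simp add: item_classes_def)

lemma alpha_pos_less: "t < u \<Longrightarrow> u \<le> N \<Longrightarrow> alpha_pos t < alpha_pos u"
proof (induction u)
  case (Suc u)
  then show ?case
    using item_classes_not_Nil[of Alpha_Item "as ! u"] by (cases "t = u") (auto simp: alpha_pos_Suc)
qed simp

lemma beta_pos_less: "t < u \<Longrightarrow> u \<le> N \<Longrightarrow> beta_pos t < beta_pos u"
proof (induction u)
  case (Suc u)
  then show ?case
    using item_classes_not_Nil[of Beta_Item "bs ! u"] by (cases "t = u") (auto simp: beta_pos_Suc)
qed simp

lemma alpha_pos_eq_iff: "t \<le> N \<Longrightarrow> u \<le> N \<Longrightarrow> alpha_pos t = alpha_pos u \<longleftrightarrow> t = u"
  by (cases t u rule: linorder_cases) (auto dest: alpha_pos_less)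

lemma beta_pos_eq_iff: "t \<le> N \<Longrightarrow> u \<le> N \<Longrightarrow> beta_pos t = beta_pos u \<longleftrightarrow> t = u"
  by (cases t u rule: linorder_cases) (auto dest: beta_pos_less)

lemma alpha_pos_less_beta_pos: "t \<le> N \<Longrightarrow> alpha_pos t < beta_pos u"
  using alpha_pos_less[of t N] by (cases "t = N") (auto simp: beta_pos_def)

lemma alpha_pos_0 [simp]: "alpha_pos 0 = 0"
  by (simp add: alpha_pos_def list_classes_def)

lemma class_alpha:
  "t < N \<Longrightarrow> cs ! alpha_pos t = Alpha_Item" "t < N \<Longrightarrow> Suc (alpha_pos t) < L"
  using drop_eq_ConsD[of "alpha_pos t" cs Alpha_Item] drop_alpha[of t] by (simp_all add: item_classes_def)

lemma class_alpha_end: "cs ! alpha_pos N = Alpha_End" "Suc (alpha_pos N) < L"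
  using drop_eq_ConsD[OF drop_alpha_end] by simp_all

lemma class_beta:
  "t < N \<Longrightarrow> cs ! beta_pos t = Beta_Item" "t < N \<Longrightarrow> Suc (beta_pos t) < L"
  using drop_eq_ConsD[of "beta_pos t" cs Beta_Item] drop_beta[of t] by (simp_all add: item_classes_def)

lemma class_beta_end: "cs ! beta_pos N = Beta_End" "Suc (beta_pos N) = L"
  using drop_eq_ConsD[OF drop_beta_end] by (simp_all add: le_antisym)

lemma class_last: "cs ! (L - 1) = Beta_End"
  using class_beta_end by (metis diff_Suc_1)

lemma walk_alpha:
  assumes "t < N" and step: "\<And>p. cs ! p \<notin> {Alpha_Item, Alpha_End, Beta_End} \<Longrightarrow> Suc p < L \<Longrightarrow> f p = f (Suc p)"
  shows "f (Suc (alpha_pos t)) = (f (alpha_pos (Suc t)) :: real)"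
proof (rule walk_eq)
  show "Suc (alpha_pos t) \<le> alpha_pos (Suc t)"
    using alpha_pos_less[of t "Suc t"] assms(1) by simp
  fix p
  assume p: "Suc (alpha_pos t) \<le> p" "p < alpha_pos (Suc t)"
  have "alpha_pos (Suc t) \<le> alpha_pos N"
    using alpha_pos_less[of "Suc t" N] assms(1) by (cases "Suc t = N") auto
  then have "Suc p < L"
    using p(2) class_alpha_end(2) by simp
  moreover have "cs ! p \<notin> {Alpha_Item, Alpha_End, Beta_Item, Beta_End}"
    using p assms(1) by (intro inner_classes[OF drop_alpha]) (auto simp: alpha_pos_Suc)
  ultimately show "f p = f (Suc p)"
    by (intro step) auto
qed

lemma walk_beta:
  assumes "t < N" and step: "\<And>p. cs ! p \<notin> {Beta_Item, Beta_End} \<Longrightarrow> Suc p < L \<Longrightarrow> f p = f (Suc p)"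
  shows "f (Suc (beta_pos t)) = (f (beta_pos (Suc t)) :: real)"
proof (rule walk_eq)
  show "Suc (beta_pos t) \<le> beta_pos (Suc t)"
    using beta_pos_less[of t "Suc t"] assms(1) by simp
  fix p
  assume p: "Suc (beta_pos t) \<le> p" "p < beta_pos (Suc t)"
  have "beta_pos (Suc t) \<le> beta_pos N"
    using beta_pos_less[of "Suc t" N] assms(1) by (cases "Suc t = N") auto
  then have "Suc p < L"
    using p(2) class_beta_end(2) by simp
  moreover have "cs ! p \<notin> {Alpha_Item, Alpha_End, Beta_Item, Beta_End}"
    using p assms(1) by (intro inner_classes[OF drop_beta]) (auto simp: beta_pos_Suc)
  ultimately show "f p = f (Suc p)"
    by (intro step) auto
qed

text \<open>The \<beta>-pebble starts at position 0 and has to cross the whole \<alpha>-list, whose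
  classes are neither \<open>Beta_Item\<close> nor \<open>Beta_End\<close>.\<close>

lemma walk_to_beta:
  assumes step: "\<And>p. cs ! p \<notin> {Beta_Item, Beta_End} \<Longrightarrow> Suc p < L \<Longrightarrow> f p = f (Suc p)"
  shows "f 0 = (f (beta_pos 0) :: real)"
proof (rule walk_eq)
  fix p
  assume "p < beta_pos 0"
  then have p: "p < Suc (alpha_pos N)"
    by (simp add: beta_pos_def list_classes_def)
  have "cs ! p \<in> set (list_classes Alpha_Item as @ [Alpha_End])"
  proof -
    have "p < length (list_classes Alpha_Item as @ [Alpha_End])"
      using p by (simp add: alpha_pos_def flip: length_as)
    then have "(list_classes Alpha_Item as @ [Alpha_End]) ! p \<in> set (list_classes Alpha_Item as @ [Alpha_End])"
      "((list_classes Alpha_Item as @ [Alpha_End]) @ list_classes Beta_Item bs @ [Beta_End]) ! p =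
        (list_classes Alpha_Item as @ [Alpha_End]) ! p"
      by (rule nth_mem) (rule nth_append_left, fact)
    then show ?thesis
      by (simp add: cs input_classes_def)
  qed
  then have "cs ! p \<notin> {Beta_Item, Beta_End}"
    using set_item_classes[of "cs ! p" Alpha_Item] by (auto simp: list_classes_def)
  then show "f p = f (Suc p)"
    using p class_alpha_end(2) by (intro step) auto
qed simp

lemma D_pass:
  assumes "10 \<le> k" "k < 16"
  shows "D k 0 0 i j 0 n = (\<Prod>t<N. factor (selected k i j (alpha_pos t)) (as ! t)) *
    (\<Prod>t<N. factor (selected k i j (beta_pos t)) (bs ! t)) * D (k + 6) 0 0 i j 0 n"
proof -
  have "drop 0 cs = list_classes Alpha_Item as @ Alpha_End # list_classes Beta_Item bs @ [Beta_End]"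
    by (simp add: cs input_classes_def)
  from D_items[OF assms this, of 0 i j n] obtain s1 where 1: "D k 0 0 i j 0 n =
      (\<Prod>t<N. factor (selected k i j (alpha_pos t)) (as ! t)) * D k 0 s1 i j (alpha_pos N) n"
    by (auto simp: length_as alpha_pos_def)
  have 2: "D k 0 s1 i j (alpha_pos N) n = D k 0 s1 i j (beta_pos 0) n"
    using D_pass_neutral[OF assms, of "alpha_pos N"] class_alpha_end
    by (simp add: beta_pos_def list_classes_def)
  from D_items[OF assms drop_beta_start, of s1 i j n] obtain s2 where 3: "D k 0 s1 i j (beta_pos 0) n =
      (\<Prod>t<N. factor (selected k i j (beta_pos t)) (bs ! t)) * D k 0 s2 i j (beta_pos N) n"
    by (auto simp: length_bs beta_pos_def list_classes_def[of _ "[]"])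
  show ?thesis
    by (simp only: 1 2 3 D_pass_end[OF assms class_beta_end(1)] mult.assoc)
qed

definition scale :: real where
  "scale = (\<Prod>t<N. factor False (as ! t)) * (\<Prod>t<N. factor False (bs ! t))"

text \<open>The factor of a unit step: a quarter for the branching and \<open>scale\<close> for a
  pass without selection. Selecting an item multiplies it by the rational value of that
  item.\<close>

definition lam :: real where
  "lam = scale / 4"

lemma lam_pos: "0 < lam"
  unfolding lam_def scale_def by (auto intro!: mult_pos_pos prod_pos factor_pos)

lemma prod_factor_selected:
  "t < N \<Longrightarrow> (\<Prod>u<N. factor (u = t) (f u)) = (\<Prod>u<N. factor False (f u)) * of_rat (f t)"
proof -
  assume t: "t < N"
  have remove: "(\<Prod>u<N. g u) = g t * (\<Prod>u \<in> {..<N} - {t}. g u)" for g :: "nat \<Rightarrow> real"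
    using t by (intro prod.remove) auto
  have "(\<Prod>u \<in> {..<N} - {t}. factor (u = t) (f u)) = (\<Prod>u \<in> {..<N} - {t}. factor False (f u))"
    by (intro prod.cong) auto
  then show ?thesis
    unfolding remove by (simp add: factor_True)
qed

lemma D_pass_plain:
  assumes "k = 10 \<or> k = 13 \<or> k = 14"
  shows "D k 0 0 i j 0 n = scale * D (k + 6) 0 0 i j 0 n"
proof -
  have "\<not> selected k i j p" for p
    using assms by (auto simp: selected_def)
  then show ?thesis
    using D_pass[of k i j n] assms by (auto simp: scale_def)
qed

lemma D_pass_alpha:
  assumes "k = 11 \<or> k = 12" "t < N"
  shows "D k 0 0 (alpha_pos t) j 0 n = scale * of_rat (as ! t) * D (k + 6) 0 0 (alpha_pos t) j 0 n"
proof -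
  have "selected k (alpha_pos t) j (alpha_pos u) \<longleftrightarrow> u = t" if "u < N" for u
    using assms that by (auto simp: selected_def alpha_pos_eq_iff)
  moreover have "\<not> selected k (alpha_pos t) j (beta_pos u)" for u
    using assms alpha_pos_less_beta_pos[of t u] by (auto simp: selected_def)
  ultimately show ?thesis
    using D_pass[of k "alpha_pos t" j n] assms
    by (auto simp: scale_def prod_factor_selected[OF assms(2)])
qed

lemma D_pass_beta:
  assumes "t < N"
  shows "D 15 0 0 i (beta_pos t) 0 n = scale * of_rat (bs ! t) * D 21 0 0 i (beta_pos t) 0 n"
proof -
  have "selected 15 i (beta_pos t) (beta_pos u) \<longleftrightarrow> u = t" if "u < N" for u
    using assms that by (auto simp: selected_def beta_pos_eq_iff)
  moreover have "\<not> selected 15 i (beta_pos t) (alpha_pos u)" if "u < N" for u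
    using alpha_pos_less_beta_pos[of u t] that by (auto simp: selected_def)
  ultimately show ?thesis
    using D_pass[of 15 i "beta_pos t" n]
    by (simp add: scale_def prod_factor_selected[OF assms])
qed

text \<open>The walk has to skip exactly \<open>n\<close> items, since the check contributes only at
  counter zero and a negative counter contributes nothing; \<open>n\<close> skipping passes and one
  selecting pass give the power \<open>Suc n\<close>.\<close>

lemma D_beta:
  assumes "Suc i < L" "t \<le> N"
  shows "D 6 0 0 i (beta_pos t) 0 (int n) =
    (if t + n < N then lam ^ Suc n * of_rat (bs ! (t + n)) else 0)"
  using assms(2)
proof (induction n arbitrary: t)
  case 0
  show ?case
  proof (cases "t = N")
    case False
    then have t: "t < N"
      using 0 by simp
    then show ?thesis
      using assms(1) class_beta[of t]
      by (simp add: D_beta_item D_pass_plain D_pass_beta D_post D_neg D_check lam_def)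
  qed (simp add: D_beta_end class_beta_end)
next
  case (Suc n)
  show ?case
  proof (cases "t = N")
    case False
    then have t: "t < N"
      using Suc.prems by simp
    have "D 6 0 0 i (beta_pos t) 0 (int (Suc n)) = lam * D 6 0 0 i (Suc (beta_pos t)) 0 (int n)"
      using t assms(1) class_beta[of t]
      by (simp add: D_beta_item D_pass_plain D_pass_beta D_post D_check lam_def)
    also have "D 6 0 0 i (Suc (beta_pos t)) 0 (int n) = D 6 0 0 i (beta_pos (Suc t)) 0 (int n)"
      using t by (rule walk_beta) (rule D_beta_walk)
    finally show ?thesis
      using Suc.IH[of "Suc t"] t by simp
  qed (simp add: D_beta_end class_beta_end)
qed

text \<open>After the \<open>N - t\<close> remaining moves of the \<alpha>-pebble, the
  \<beta>-pebble stands at item \<open>u + (N - t)\<close> and the counter at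
  \<open>n - (N - t)\<close>, so \<open>D_beta\<close> selects item \<open>u + n\<close>. A smaller
  counter becomes negative on the way.\<close>

lemma D_lockstep:
  assumes "t \<le> N" "u + (N - t) < N"
  shows "D 8 0 0 (alpha_pos t) (beta_pos u) 0 (int n) =
    (if N - t \<le> n \<and> u + n < N then lam ^ Suc n * of_rat (bs ! (u + n)) else 0)"
  using assms
proof (induction "N - t" arbitrary: t u n)
  case 0
  then have "t = N"
    by simp
  then show ?case
    using 0 D_lock_alpha_end[OF class_alpha_end(1)] D_beta[OF class_alpha_end(2), of u n] by simp
next
  case (Suc m)
  then have t: "t < N"
    by simp
  have u: "u < N" "Suc u < N"
    using Suc t by linarith+
  have "D 8 0 0 (alpha_pos t) (beta_pos u) 0 (int n) =
      lam * D 7 0 0 (Suc (alpha_pos t)) (Suc (beta_pos u)) 0 (int n - 1)"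
    using t u class_alpha[of t] class_beta[of u]
    by (simp add: D_lock_alpha_item D_pass_plain D_post lam_def)
  also have "D 7 0 0 (Suc (alpha_pos t)) (Suc (beta_pos u)) 0 (int n - 1) =
      D 7 0 0 (Suc (alpha_pos t)) (beta_pos (Suc u)) 0 (int n - 1)"
    using u(1) by (rule walk_beta) (rule D_lock_beta_walk)
  also have "\<dots> = D 8 0 0 (Suc (alpha_pos t)) (beta_pos (Suc u)) 0 (int n - 1)"
    using u by (intro D_lock_beta_item class_beta)
  also have "\<dots> = D 8 0 0 (alpha_pos (Suc t)) (beta_pos (Suc u)) 0 (int n - 1)"
    using t by (rule walk_alpha) (rule D_lock_alpha_walk)
  finally have eq: "D 8 0 0 (alpha_pos t) (beta_pos u) 0 (int n) =
      lam * D 8 0 0 (alpha_pos (Suc t)) (beta_pos (Suc u)) 0 (int n - 1)" .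
  show ?case
  proof (cases n)
    case 0
    then show ?thesis
      using eq t by (simp add: D_neg)
  next
    case (Suc n')
    have "D 8 0 0 (alpha_pos (Suc t)) (beta_pos (Suc u)) 0 (int n') =
      (if N - Suc t \<le> n' \<and> Suc u + n' < N then lam ^ Suc n' * of_rat (bs ! (Suc u + n')) else 0)"
      using Suc.hyps t Suc.prems by (intro Suc.hyps(1)) auto
    then show ?thesis
      using eq t by (auto simp: \<open>n = Suc n'\<close>)
  qed
qed

text \<open>Coefficient \<open>t\<close> is skipped, selected with a recursive call, or selected as
  the last one. In the last case the pebbles go to items \<open>Suc t\<close> and 0 and then move
  together, so the guard \<open>N - Suc t \<le> n\<close> says that the expanded index
  \<open>Suc n + t\<close> is at least the order \<open>N\<close>.\<close>

lemma D_alpha_step: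
  assumes "t < N"
  shows "D 5 0 0 (alpha_pos t) 0 0 (int (Suc n)) =
    lam * D 5 0 0 (alpha_pos (Suc t)) 0 0 (int n) +
    lam * of_rat (as ! t) * (D 5 0 0 0 0 0 (int n) +
      (if N - Suc t \<le> n \<and> n < N then lam ^ Suc n * of_rat (bs ! n) else 0))"
proof -
  let ?i = "alpha_pos t"
  have L: "Suc 0 < L"
    using class_alpha[of 0] N_pos by simp
  have "D 16 0 0 ?i 0 0 (int (Suc n)) = D 5 0 0 (Suc ?i) 0 0 (int n)"
    using class_alpha[of t] assms L by (simp add: D_post)
  also have "\<dots> = D 5 0 0 (alpha_pos (Suc t)) 0 0 (int n)"
    using assms by (rule walk_alpha) (rule D_alpha_walk)
  finally have 1: "D 16 0 0 ?i 0 0 (int (Suc n)) = D 5 0 0 (alpha_pos (Suc t)) 0 0 (int n)" .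
  have 2: "D 17 0 0 ?i 0 0 (int (Suc n)) = D 5 0 0 0 0 0 (int n)"
    using class_alpha[of t] assms L by (simp add: D_post)
  have "D 18 0 0 ?i 0 0 (int (Suc n)) = D 7 0 0 (Suc ?i) 0 0 (int n)"
    using class_alpha[of t] assms L by (simp add: D_post)
  also have "\<dots> = D 7 0 0 (Suc ?i) (beta_pos 0) 0 (int n)"
    by (rule walk_to_beta) (rule D_lock_beta_walk)
  also have "\<dots> = D 8 0 0 (Suc ?i) (beta_pos 0) 0 (int n)"
    using N_pos by (intro D_lock_beta_item class_beta)
  also have "\<dots> = D 8 0 0 (alpha_pos (Suc t)) (beta_pos 0) 0 (int n)"
    using assms by (rule walk_alpha) (rule D_lock_alpha_walk)
  also have "\<dots> = (if N - Suc t \<le> n \<and> n < N then lam ^ Suc n * of_rat (bs ! n) else 0)"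
    using D_lockstep[of "Suc t" 0 n] assms by simp
  finally have 3: "D 18 0 0 ?i 0 0 (int (Suc n)) =
      (if N - Suc t \<le> n \<and> n < N then lam ^ Suc n * of_rat (bs ! n) else 0)" .
  have "D 5 0 0 ?i 0 0 (int (Suc n)) = (scale * D 16 0 0 ?i 0 0 (int (Suc n)) +
      scale * of_rat (as ! t) * D 17 0 0 ?i 0 0 (int (Suc n)) +
      scale * of_rat (as ! t) * D 18 0 0 ?i 0 0 (int (Suc n))) / 4"
    using class_alpha[of t] assms
    by (simp add: D_alpha_item D_pass_plain D_pass_alpha del: of_nat_Suc)
  then show ?thesis
    unfolding 1 2 3 by (simp add: lam_def field_simps)
qed

lemma D_alpha_0:
  assumes "t < N"
  shows "D 5 0 0 (alpha_pos t) 0 0 0 = 0"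
proof -
  have "Suc 0 < L"
    using class_alpha[of 0] N_pos by simp
  then show ?thesis
    using class_alpha[of t] assms
    by (simp add: D_alpha_item D_pass_plain D_pass_alpha D_post D_neg)
qed

lemma lrs_recurrence:
  "N \<le> n \<Longrightarrow> lrs as bs n = (\<Sum>l<N. as ! l * lrs as bs (n - 1 - l))"
  by (subst lrs.simps) (simp add: length_as)

lemma lrs_initial: "n < N \<Longrightarrow> lrs as bs n = bs ! n"
  by (subst lrs.simps) (simp add: length_as)

text \<open>With the pebble at item \<open>t\<close> and counter \<open>n\<close>, the index being
  expanded is \<open>n + t\<close>. The sum is the tail of its recurrence from coefficient
  \<open>t\<close> on, and the condition says that the recurrence applies to this index.\<close>

lemma D_alpha:
  assumes "t \<le> N"
  shows "D 5 0 0 (alpha_pos t) 0 0 (int n) = (if N - t \<le> n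
    then lam ^ Suc n * (\<Sum>l<N - t. of_rat (as ! (t + l)) * of_rat (lrs as bs (n - 1 - l))) else 0)"
  using assms
proof (induction n arbitrary: t)
  case 0
  then show ?case
    by (cases "t = N") (auto simp: D_alpha_0 D_alpha_end class_alpha_end)
next
  case (Suc n)
  show ?case
  proof (cases "t = N")
    case False
    then have t: "t < N"
      using Suc.prems by simp
    have 0: "D 5 0 0 0 0 0 (int n) = (if N \<le> n then lam ^ Suc n * of_rat (lrs as bs n) else 0)"
      using Suc.IH[of 0] lrs_recurrence[of n] by (simp add: of_rat_sum of_rat_mult)
    \<comment> \<open>The recursive call supplies the term with index \<open>n\<close> for
      \<open>N \<le> n\<close>, the initial values supply it for \<open>n < N\<close>, so that the
      two ranges fit together without overlap.\<close>
    have "D 5 0 0 0 0 0 (int n) +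
        (if N - Suc t \<le> n \<and> n < N then lam ^ Suc n * of_rat (bs ! n) else 0) =
        (if N - Suc t \<le> n then lam ^ Suc n * of_rat (lrs as bs n) else 0)"
      unfolding 0 using lrs_initial[of n] by auto
    moreover have "N - t = Suc (N - Suc t)"
      using t by simp
    ultimately show ?thesis
      unfolding D_alpha_step[OF t] using Suc.IH[of "Suc t"] t
      by (simp add: sum.lessThan_Suc_shift algebra_simps del: sum.lessThan_Suc of_nat_Suc)
  qed (simp add: D_alpha_end class_alpha_end)
qed

theorem D_start_lrs: "D 4 0 0 0 0 0 (int n) = lam ^ Suc n * of_rat (lrs as bs n) / 2"
proof -
  have "Suc 0 < L"
    using class_alpha[of 0] N_pos by simp
  have "D 6 0 0 0 0 0 (int n) = D 6 0 0 0 (beta_pos 0) 0 (int n)"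
    by (rule walk_to_beta) (rule D_beta_walk)
  also have "\<dots> = (if n < N then lam ^ Suc n * of_rat (lrs as bs n) else 0)"
    using D_beta[OF \<open>Suc 0 < L\<close>, of 0 n] lrs_initial[of n] by simp
  finally have "D 6 0 0 0 0 0 (int n) = (if n < N then lam ^ Suc n * of_rat (lrs as bs n) else 0)" .
  moreover have "D 5 0 0 0 0 0 (int n) = (if N \<le> n then lam ^ Suc n * of_rat (lrs as bs n) else 0)"
    using D_alpha[of 0 n] lrs_recurrence[of n] by (simp add: of_rat_sum of_rat_mult)
  ultimately show ?thesis
    by (simp add: D_start)
qed

end

section \<open>The Markov decision process\<close>

lemma digits_eq_imp_mod_eq:
  "(\<And>r. r < m \<Longrightarrow> digit L r a = digit L r b) \<Longrightarrow> a mod L ^ m = b mod L ^ m"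
proof (induction m)
  case (Suc m)
  have "a mod (L ^ m * L) = b mod (L ^ m * L)"
    unfolding mod_mult2_eq using Suc by (auto simp: digit_def)
  then show ?case
    by (simp add: mult.commute)
qed simp

definition digits :: "nat \<Rightarrow> nat \<Rightarrow> nat \<Rightarrow> nat list" where
  "digits L m n = map (\<lambda>r. digit L r n) [0..<m]"

lemma length_digits [simp]: "length (digits L m n) = m"
  by (simp add: digits_def)

lemma nth_digits [simp]: "r < m \<Longrightarrow> digits L m n ! r = digit L r n"
  by (simp add: digits_def)

text \<open>Injectivity suffices, since both sides have \<open>L ^ m\<close> elements.\<close>

lemma bij_betw_digits:
  assumes "0 < L"
  shows "bij_betw (digits L m) {0..<L ^ m} {d. set d \<subseteq> {..<L} \<and> length d = m}"
proof -
  have inj: "inj_on (digits L m) {0..<L ^ m}"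
  proof (rule inj_onI)
    fix a b
    assume ab: "a \<in> {0..<L ^ m}" "b \<in> {0..<L ^ m}" and eq: "digits L m a = digits L m b"
    have "digit L r a = digit L r b" if "r < m" for r
      using arg_cong[OF eq, of "\<lambda>d. d ! r"] that by simp
    from digits_eq_imp_mod_eq[of m, OF this] show "a = b"
      using ab by simp
  qed
  have "digits L m ` {0..<L ^ m} \<subseteq> {d. set d \<subseteq> {..<L} \<and> length d = m}"
    using assms by (auto simp: digits_def digit_def)
  moreover have "card (digits L m ` {0..<L ^ m}) = card {d. set d \<subseteq> {..<L} \<and> length d = m}"
    using card_image[OF inj] by (simp add: card_lists_length_eq)
  ultimately have "digits L m ` {0..<L ^ m} = {d. set d \<subseteq> {..<L} \<and> length d = m}"
    by (intro card_subset_eq) (auto simp: finite_lists_length_eq)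
  with inj show ?thesis
    by (simp add: bij_betw_def)
qed

text \<open>Actions are numbered like positions, so an entry of the table is indexed by 8 + 1 + 8 =
  17 positions of the input; an action is read as the binary choice
  \<open>a \<noteq> 0\<close>.\<close>

definition recurrence_mdp :: "bool \<Rightarrow> pos_class list \<Rightarrow> (nat, nat) mdp" where
  "recurrence_mdp sg cs = \<lparr>
     states = {0..<length cs ^ 8},
     actions = {0..<length cs},
     tprob = (\<lambda>s a t. of_nat (count_list (succs sg cs (a \<noteq> 0) (digits (length cs) 8 s))
       (digits (length cs) 8 t)) / 4),
     init = 0,
     wgt = (\<lambda>s a. state_weight (digits (length cs) 8 s))\<rparr>"

locale mdp_chain = recurrence_chain +
  assumes L_ge: "22 \<le> L"
begin

abbreviation "M \<equiv> recurrence_mdp sg cs"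

lemma L_pos: "0 < L"
  using L_ge by linarith

definition valid :: "nat list \<Rightarrow> bool" where
  "valid d \<longleftrightarrow> set d \<subseteq> {..<L} \<and> length d = 8"

definition dig :: "nat \<Rightarrow> nat list" where
  "dig = digits L 8"

definition num :: "nat list \<Rightarrow> nat" where
  "num = inv_into {0..<L ^ 8} dig"

lemma bij_dig: "bij_betw dig {0..<L ^ 8} {d. valid d}"
  using bij_betw_digits[OF L_pos, of 8] by (simp add: dig_def valid_def)

lemma valid_dig: "t < L ^ 8 \<Longrightarrow> valid (dig t)"
  using bij_dig by (auto dest: bij_betwE)

lemma dig_num: "valid d \<Longrightarrow> dig (num d) = d"
  unfolding num_def using bij_betw_inv_into_right[OF bij_dig, of d] by simp

lemma num_less: "valid d \<Longrightarrow> num d < L ^ 8"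
  unfolding num_def using bij_betw_inv_into[OF bij_dig] by (auto dest: bij_betwE)

lemma num_dig: "t < L ^ 8 \<Longrightarrow> num (dig t) = t"
  unfolding num_def using bij_betw_inv_into_left[OF bij_dig, of t] by simp

lemma valid_explicit:
  "valid d \<longleftrightarrow> (\<exists>k m g x s i j p. d = [k, m, g, x, s, i, j, p] \<and>
     k < L \<and> m < L \<and> g < L \<and> x < L \<and> s < L \<and> i < L \<and> j < L \<and> p < L)"
  by (auto simp: valid_def numeral_eq_Suc length_Suc_conv)

lemma set_slots:
  assumes "us \<in> set (slots sg a k m g x s ci cj cp ei ej)"
  shows "length us = 8" "Const c \<in> set us \<Longrightarrow> c < 22"
proof -
  have "length us = 8 \<and> (\<forall>c. Const c \<in> set us \<longrightarrow> c < 22)"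
  proof (cases "10 \<le> k \<and> k < 16")
    case True
    then show ?thesis
      using assms by (cases cp) (auto simp: slots_def goto_def proceed_def split: if_splits)
  next
    case False
    then show ?thesis
      using assms
      by (auto simp: slots_def goto_def goto_start_def goto_pass_def goto_move_def post_target_def Let_def
          split: if_splits)
  qed
  then show "length us = 8" "Const c \<in> set us \<Longrightarrow> c < 22"
    by auto
qed

lemma valid_succs:
  assumes "valid d" "t \<in> set (succs sg cs a d)"
  shows "valid t"
proof -
  obtain us where us: "us \<in> set (slots sg a (d ! 0) (d ! 1 \<noteq> 0) (d ! 2 \<noteq> 0) (d ! 3 \<noteq> 0) (d ! 4 \<noteq> 0)
      (cs ! (d ! 5)) (cs ! (d ! 6)) (cs ! (d ! 7)) (d ! 7 = d ! 5) (d ! 7 = d ! 6))"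
    and t: "t = map2 (apply_upd L) us d"
    using assms(2) by (auto simp: succs_def)
  have "apply_upd L u e < L" if "u \<in> set us" "e \<in> set d" for u e
  proof -
    have "e < L"
      using that(2) assms(1) by (auto simp: valid_def)
    moreover have "c < L" if "u = Const c" for c
      using set_slots(2)[OF us, of c] that \<open>u \<in> set us\<close> L_ge by simp
    ultimately show ?thesis
      by (cases u) auto
  qed
  then show ?thesis
    using assms(1) set_slots(1)[OF us] unfolding t valid_def
    by (auto dest: set_zip_leftD set_zip_rightD)
qed

lemma states_M [simp]: "states M = {0..<L ^ 8}"
  and actions_M [simp]: "actions M = {0..<L}"
  and init_M [simp]: "init M = 0"
  and tprob_M: "tprob M s a t = of_nat (count_list (succs sg cs (a \<noteq> 0) (dig s)) (dig t)) / 4"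
  and wgt_M: "wgt M s a = state_weight (dig s)"
  by (simp_all add: recurrence_mdp_def dig_def)

lemma sum_count_list:
  fixes f :: "nat list \<Rightarrow> 'b::comm_semiring_1"
  assumes "\<And>d. d \<in> set ds \<Longrightarrow> valid d"
  shows "(\<Sum>t \<in> {0..<L ^ 8}. of_nat (count_list ds (dig t)) * f (dig t)) = (\<Sum>d \<leftarrow> ds. f d)"
proof -
  have "(\<Sum>t \<in> {0..<L ^ 8}. of_nat (count_list ds (dig t)) * f (dig t)) =
      (\<Sum>d \<in> {d. valid d}. of_nat (count_list ds d) * f d)"
    by (rule sum.reindex_bij_betw[OF bij_dig])
  also have "\<dots> = (\<Sum>d \<leftarrow> ds. f d)"
    using assms
  proof (induction ds)
    case (Cons d ds)
    have fin: "finite {d. valid d}"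
      using bij_betw_finite[OF bij_dig] by simp
    have "(\<Sum>e \<in> {d. valid d}. of_nat (count_list (d # ds) e) * f e) =
        (\<Sum>e \<in> {d. valid d}. of_nat (count_list ds e) * f e + (if e = d then f e else 0))"
      by (intro sum.cong) (auto simp: algebra_simps)
    also have "\<dots> = (\<Sum>e \<in> {d. valid d}. of_nat (count_list ds e) * f e) + f d"
      using Cons.prems fin by (simp add: sum.distrib)
    finally show ?case
      using Cons by (simp add: add.commute)
  qed simp
  finally show ?thesis .
qed

lemma sum_tprob_M:
  assumes "s < L ^ 8"
  shows "(\<Sum>t \<in> states M. tprob M s a t) = 1"
proof -
  have "(\<Sum>t \<in> states M. tprob M s a t) =
      (\<Sum>t \<in> {0..<L ^ 8}. of_nat (count_list (succs sg cs (a \<noteq> 0) (dig s)) (dig t)) * 1) / 4"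
    by (simp add: tprob_M sum_divide_distrib)
  also have "\<dots> = 1"
    using valid_succs[OF valid_dig[OF assms]]
    by (subst sum_count_list) (auto simp: sum_list_triv)
  finally show ?thesis .
qed

lemma enabled_M: "s < L ^ 8 \<Longrightarrow> enabled M s = {0..<L}"
  using sum_tprob_M by (auto simp: enabled_def)

lemma finite_mdp_M: "finite_mdp M"
proof -
  have "0 \<le> tprob M s a t \<and> tprob M s a t \<le> 1" if "s < L ^ 8" "t < L ^ 8" for s a t
  proof -
    have "0 \<le> tprob M s a t'" for t'
      by (simp add: tprob_M)
    moreover from this have "tprob M s a t \<le> (\<Sum>t \<in> states M. tprob M s a t)"
      using that by (intro member_le_sum) auto
    ultimately show ?thesis
      using sum_tprob_M[OF that(1)] by simp
  qed
  then show ?thesis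
    using sum_tprob_M L_pos by (simp add: finite_mdp_def)
qed

sublocale mdp: nonterminating_mdp M
  by standard (use finite_mdp_M enabled_M L_pos in auto)

lemma sum_step:
  assumes "s < L ^ 8"
  shows "(\<Sum>t \<in> states M. c * of_rat (tprob M s a t) * f t) =
    c * ((\<Sum>d \<leftarrow> succs sg cs (a \<noteq> 0) (dig s). f (num d)) / (4 :: real))"
proof -
  have "(\<Sum>t \<in> states M. c * of_rat (tprob M s a t) * f t) =
      c / 4 * (\<Sum>t \<in> {0..<L ^ 8}. of_nat (count_list (succs sg cs (a \<noteq> 0) (dig s)) (dig t)) * f (num (dig t)))"
    unfolding sum_distrib_left states_M
    by (intro sum.cong refl) (simp add: tprob_M num_dig of_rat_divide)
  also have "\<dots> = c / 4 * (\<Sum>d \<leftarrow> succs sg cs (a \<noteq> 0) (dig s). f (num d))"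
    using valid_succs[OF valid_dig[OF assms]] by (subst sum_count_list) auto
  finally show ?thesis
    by simp
qed

end

text \<open>
  The limit of the hitting probabilities satisfies the same one-step equations, so that schedulers can be
  compared without referring to finite horizons.
\<close>

locale scheduled_chain = mdp_chain +
  fixes \<sigma> :: "(nat, nat) scheduler"
  assumes \<sigma>: "\<sigma> \<in> schedulers M"
begin

abbreviation "paths \<equiv> finite_paths M 0"

definition st :: "(nat, nat) fpath \<Rightarrow> nat list" where
  "st \<pi> = dig (last_state \<pi>)"

definition ext :: "(nat, nat) fpath \<Rightarrow> nat \<Rightarrow> nat list \<Rightarrow> (nat, nat) fpath" where
  "ext \<pi> a d = snoc_path \<pi> (a, num d)"

abbreviation "nexts \<pi> a \<equiv> succs sg cs (a \<noteq> 0) (st \<pi>)"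

definition average :: "(nat, nat) fpath \<Rightarrow> (nat \<Rightarrow> real) \<Rightarrow> real" where
  "average \<pi> f = (\<Sum>a \<in> {0..<L}. pmf (\<sigma> \<pi>) a * f a)"

lemma last_less: "\<pi> \<in> paths \<Longrightarrow> last_state \<pi> < L ^ 8"
  using last_state_finite_paths[of \<pi> M 0] by simp

lemma valid_st: "\<pi> \<in> paths \<Longrightarrow> valid (st \<pi>)"
  unfolding st_def by (intro valid_dig last_less)

lemma ext_paths:
  assumes "\<pi> \<in> paths" "a < L" "d \<in> set (nexts \<pi> a)"
  shows "ext \<pi> a d \<in> paths" "st (ext \<pi> a d) = d"
    "acc_weight M (ext \<pi> a d) = acc_weight M \<pi> + state_weight (st \<pi>)"
    "path_negative M (ext \<pi> a d) \<longleftrightarrow> path_negative M \<pi> \<or> acc_weight M \<pi> + state_weight (st \<pi>) < 0"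
proof -
  have d: "valid d"
    using valid_succs[OF valid_st[OF assms(1)] assms(3)] .
  have "count_list (nexts \<pi> a) d \<noteq> 0"
    using assms(3) by (simp add: count_list_0_iff)
  then show "ext \<pi> a d \<in> paths"
    using assms(1,2) d unfolding ext_def finite_paths_snoc
    by (simp add: valid_step_def enabled_M[OF last_less[OF assms(1)]] num_less tprob_M dig_num flip: st_def)
  show "st (ext \<pi> a d) = d"
    using d by (simp add: st_def ext_def dig_num)
  show "acc_weight M (ext \<pi> a d) = acc_weight M \<pi> + state_weight (st \<pi>)"
    "path_negative M (ext \<pi> a d) \<longleftrightarrow> path_negative M \<pi> \<or> acc_weight M \<pi> + state_weight (st \<pi>) < 0"
    by (simp_all add: ext_def acc_weight_snoc path_negative_snoc wgt_M st_def)
qed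

lemma average_const: "\<pi> \<in> paths \<Longrightarrow> average \<pi> (\<lambda>_. c) = c"
  using mdp.sum_scheduler[OF \<sigma>, of \<pi> 0] enabled_M[OF last_less, of \<pi>]
  by (simp add: average_def flip: sum_distrib_right)

lemma average_mono: "(\<And>a. a < L \<Longrightarrow> f a \<le> g a) \<Longrightarrow> average \<pi> f \<le> average \<pi> g"
  unfolding average_def by (intro sum_mono mult_left_mono) auto

lemma average_cong: "(\<And>a. a < L \<Longrightarrow> f a = g a) \<Longrightarrow> average \<pi> f = average \<pi> g"
  unfolding average_def by (intro sum.cong) auto

lemma average_add: "average \<pi> (\<lambda>a. f a + g a) = average \<pi> f + average \<pi> g"
  by (simp add: average_def distrib_left sum.distrib)

lemma average_cmult: "average \<pi> (\<lambda>a. c * f a) = c * average \<pi> f"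
  by (simp add: average_def sum_distrib_left mult.left_commute)

abbreviation hw :: "nat \<Rightarrow> (nat, nat) fpath \<Rightarrow> real" where
  "hw \<equiv> hit_prob_within M \<sigma>"

lemma hw_Suc:
  assumes "\<pi> \<in> paths"
  shows "hw (Suc n) \<pi> = average \<pi> (\<lambda>a. (\<Sum>d \<leftarrow> nexts \<pi> a. hw n (ext \<pi> a d)) / 4)"
proof -
  have "hw (Suc n) \<pi> = (\<Sum>a \<in> {0..<L}. \<Sum>t \<in> states M.
      pmf (\<sigma> \<pi>) a * of_rat (tprob M (last_state \<pi>) a t) * hw n (snoc_path \<pi> (a, t)))"
    using enabled_M[OF last_less[OF assms]] by simp
  also have "\<dots> = average \<pi> (\<lambda>a. (\<Sum>d \<leftarrow> nexts \<pi> a. hw n (ext \<pi> a d)) / 4)"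
    unfolding average_def ext_def st_def by (intro sum.cong refl sum_step last_less assms)
  finally show ?thesis .
qed

lemma hw_bounds: "\<pi> \<in> paths \<Longrightarrow> 0 \<le> hw n \<pi> \<and> hw n \<pi> \<le> 1"
proof (induction n arbitrary: \<pi>)
  case (Suc n)
  let ?f = "\<lambda>a. (\<Sum>d \<leftarrow> nexts \<pi> a. hw n (ext \<pi> a d)) / 4"
  have "0 \<le> ?f a \<and> ?f a \<le> 1" if "a < L" for a
  proof -
    have b: "0 \<le> hw n (ext \<pi> a d) \<and> hw n (ext \<pi> a d) \<le> 1" if "d \<in> set (nexts \<pi> a)" for d
      using Suc.IH[OF ext_paths(1)[OF Suc.prems \<open>a < L\<close> that]] .
    have "(\<Sum>d \<leftarrow> nexts \<pi> a. hw n (ext \<pi> a d)) \<le> 4"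
      using sum_list_le_length[of "nexts \<pi> a" "\<lambda>d. hw n (ext \<pi> a d)"] b by simp
    moreover have "0 \<le> (\<Sum>d \<leftarrow> nexts \<pi> a. hw n (ext \<pi> a d))"
      using b by (intro sum_list_nonneg) auto
    ultimately show ?thesis
      by simp
  qed
  then have "average \<pi> (\<lambda>_. 0) \<le> average \<pi> ?f" "average \<pi> ?f \<le> average \<pi> (\<lambda>_. 1)"
    by (auto intro!: average_mono)
  then show ?case
    unfolding hw_Suc[OF Suc.prems] average_const[OF Suc.prems] by simp
qed simp

lemma hw_negative: "\<pi> \<in> paths \<Longrightarrow> path_negative M \<pi> \<Longrightarrow> hw n \<pi> = 1"
proof (induction n arbitrary: \<pi>)
  case (Suc n)
  have "(\<Sum>d \<leftarrow> nexts \<pi> a. hw n (ext \<pi> a d)) / 4 = 1" if "a < L" for a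
  proof -
    have "map (\<lambda>d. hw n (ext \<pi> a d)) (nexts \<pi> a) = map (\<lambda>_. 1) (nexts \<pi> a)"
      using Suc ext_paths[OF Suc.prems(1) that] by (intro map_cong) auto
    then show ?thesis
      by (simp only:) (simp add: sum_list_triv)
  qed
  then show ?case
    unfolding hw_Suc[OF Suc.prems(1)] using average_cong[of _ "\<lambda>_. 1"] average_const[OF Suc.prems(1)] by simp
qed simp

lemma hw_mono: "\<pi> \<in> paths \<Longrightarrow> hw n \<pi> \<le> hw (Suc n) \<pi>"
proof (induction n arbitrary: \<pi>)
  case 0
  then show ?case
    using hw_negative[OF 0, of "Suc 0"] hw_bounds[OF 0, of "Suc 0"]
    by (simp del: hit_prob_within.simps(2))
next
  case (Suc n)
  show ?case
    unfolding hw_Suc[OF Suc.prems] using Suc.IH ext_paths(1)[OF Suc.prems]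
    by (intro average_mono divide_right_mono sum_list_mono)
      (auto simp del: hit_prob_within.simps)
qed

definition hp :: "(nat, nat) fpath \<Rightarrow> real" where
  "hp \<pi> = lim (\<lambda>n. hw n \<pi>)"

lemma hw_tendsto:
  assumes "\<pi> \<in> paths"
  shows "(\<lambda>n. hw n \<pi>) \<longlonglongrightarrow> hp \<pi>"
proof -
  have "incseq (\<lambda>n. hw n \<pi>)"
    by (rule incseq_SucI) (rule hw_mono[OF assms])
  then have "convergent (\<lambda>n. hw n \<pi>)"
    using hw_bounds[OF assms]
    by (metis Bseq_monoseq_convergent BseqI' abs_of_nonneg incseq_imp_monoseq real_norm_def)
  then show ?thesis
    unfolding hp_def by (simp add: convergent_LIMSEQ_iff)
qed

lemma hp_bounds: "\<pi> \<in> paths \<Longrightarrow> 0 \<le> hp \<pi>" "\<pi> \<in> paths \<Longrightarrow> hp \<pi> \<le> 1"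
  using hw_tendsto[of \<pi>] hw_bounds[of \<pi>] by (auto intro: LIMSEQ_le_const LIMSEQ_le_const2)

lemma hp_step:
  assumes "\<pi> \<in> paths"
  shows "hp \<pi> = average \<pi> (\<lambda>a. (\<Sum>d \<leftarrow> nexts \<pi> a. hp (ext \<pi> a d)) / 4)"
proof -
  have "(\<lambda>n. hw (Suc n) \<pi>) \<longlonglongrightarrow>
      average \<pi> (\<lambda>a. (\<Sum>d \<leftarrow> nexts \<pi> a. hp (ext \<pi> a d)) / 4)"
    unfolding hw_Suc[OF assms] average_def
    using ext_paths(1)[OF assms]
    by (intro tendsto_sum tendsto_mult tendsto_const tendsto_divide tendsto_sum_list hw_tendsto) auto
  then show ?thesis
    using LIMSEQ_unique LIMSEQ_Suc[OF hw_tendsto[OF assms]] by blast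
qed

lemma measure_eq_hp: "measure (path_measure M \<sigma> 0) (eventually_negative M 0) = hp (0, [])"
proof (rule LIMSEQ_unique)
  show "(\<lambda>n. hw n (0, [])) \<longlonglongrightarrow> measure (path_measure M \<sigma> 0) (eventually_negative M 0)"
    using \<sigma> L_pos by (intro mdp.measure_eventually_negative) auto
  show "(\<lambda>n. hw n (0, [])) \<longlonglongrightarrow> hp (0, [])"
    using L_pos by (intro hw_tendsto) (simp add: finite_paths_Nil)
qed

lemma succs_ge_4:
  assumes "4 \<le> d ! 0" "valid d"
  shows "succs sg cs a d = succs sg cs False d" "t \<in> set (succs sg cs a d) \<Longrightarrow> 4 \<le> t ! 0"
proof -
  obtain k m g x s i j p where d: "d = [k, m, g, x, s, i, j, p]"
    using assms(2) by (auto simp: valid_explicit)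
  show "succs sg cs a d = succs sg cs False d"
    using assms(1) by (simp add: d succs_def slots_def)
  show "4 \<le> t ! 0" if "t \<in> set (succs sg cs a d)"
  proof (cases "10 \<le> k \<and> k < 16")
    case True
    then show ?thesis
      using that unfolding d by (cases "cs ! p") (auto simp: succs_simps replicate_4 split: if_splits)
  next
    case False
    then show ?thesis
      using that assms(1) unfolding d by (auto simp: succs_simps replicate_4 Let_def split: if_splits)
  qed
qed

text \<open>From control state \<open>4\<close> on, all actions have the same successors, so every
  scheduler induces the same chain. The third assumption ties the history to the current weight,
  because \<open>hits_within\<close> sees only the counter.\<close>

lemma hw_eq_hits_within:
  assumes "\<pi> \<in> paths" "4 \<le> st \<pi> ! 0" "path_negative M \<pi> \<longleftrightarrow> acc_weight M \<pi> < 0"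
  shows "hw n \<pi> = hits_within (succs sg cs False) state_weight n (st \<pi>) (acc_weight M \<pi>)"
  using assms
proof (induction n arbitrary: \<pi>)
  case (Suc n)
  show ?case
  proof (cases "acc_weight M \<pi> < 0")
    case True
    then show ?thesis
      using hw_negative[OF Suc.prems(1), of "Suc n"] Suc.prems(3) by simp
  next
    case False
    note succ = succs_ge_4[OF Suc.prems(2) valid_st[OF Suc.prems(1)]]
    have IH: "hw n (ext \<pi> a d) =
        hits_within (succs sg cs False) state_weight n d (acc_weight M \<pi> + state_weight (st \<pi>))"
      if "a < L" "d \<in> set (nexts \<pi> a)" for a d
      using Suc.IH[of "ext \<pi> a d"] ext_paths[OF Suc.prems(1) that] succ(2)[OF that(2)] False Suc.prems(3)
      by simp
    have "average \<pi> (\<lambda>a. (\<Sum>d \<leftarrow> nexts \<pi> a. hw n (ext \<pi> a d)) / 4) =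
        average \<pi> (\<lambda>a. (\<Sum>d \<leftarrow> succs sg cs False (st \<pi>).
          hits_within (succs sg cs False) state_weight n d (acc_weight M \<pi> + state_weight (st \<pi>))) / 4)"
    proof (intro average_cong)
      fix a
      assume a: "a < L"
      have "map (hw n \<circ> ext \<pi> a) (nexts \<pi> a) =
          map (\<lambda>d. hits_within (succs sg cs False) state_weight n d (acc_weight M \<pi> + state_weight (st \<pi>)))
            (nexts \<pi> a)"
        using IH[OF a] by (intro map_cong) auto
      then show "(\<Sum>d \<leftarrow> nexts \<pi> a. hw n (ext \<pi> a d)) / 4 =
          (\<Sum>d \<leftarrow> succs sg cs False (st \<pi>).
            hits_within (succs sg cs False) state_weight n d (acc_weight M \<pi> + state_weight (st \<pi>))) / 4"
        by (simp only: succ(1)[of "a \<noteq> 0"] comp_def)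
    qed
    then show ?thesis
      unfolding hw_Suc[OF Suc.prems(1)] using False average_const[OF Suc.prems(1)] by simp
  qed
qed simp

lemma hp_eq_h:
  assumes "\<pi> \<in> paths" "4 \<le> st \<pi> ! 0" "path_negative M \<pi> \<longleftrightarrow> acc_weight M \<pi> < 0"
  shows "hp \<pi> = h (st \<pi>) (acc_weight M \<pi>)"
  unfolding hp_def hits_def hw_eq_hits_within[OF assms] ..

section \<open>Comparison with the fixed choice of sign\<close>

definition "game = [1, 0, 0, 0, 0, 0, 0, 0 :: nat]"
definition "incr = [2, 0, 0, 0, 0, 0, 0, 0 :: nat]"
definition "choice = [3, 0, 0, 0, 0, 0, 0, 0 :: nat]"
definition start :: "bool \<Rightarrow> nat list" where
  "start g = [4, 0, of_bool g, 0, 0, 0, 0, 0]"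
definition "shadow_start = [4, 1, of_bool sg, 0, 0, 0, 0, 0 :: nat]"

definition at_state :: "nat list \<Rightarrow> int \<Rightarrow> (nat, nat) fpath \<Rightarrow> bool" where
  "at_state d n \<pi> \<longleftrightarrow> \<pi> \<in> paths \<and> st \<pi> = d \<and> acc_weight M \<pi> = n \<and> \<not> path_negative M \<pi> \<and> 0 \<le> n"

lemma succs_game: "succs sg cs a game = [incr, incr, choice, choice]"
  and succs_incr: "succs sg cs a incr = [game, game, game, game]"
  and succs_choice: "succs sg cs a choice =
    [start (a \<noteq> sg), start (a \<noteq> sg), start (a \<noteq> sg), start (a \<noteq> sg)]"
  by (simp_all add: succs_simps replicate_4 game_def incr_def choice_def start_def)

lemma weights: "state_weight game = 0" "state_weight incr = 1" "state_weight choice = 0"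
  "4 \<le> start g ! 0" "4 \<le> shadow_start ! 0"
  by (simp_all add: state_weight_def weight_def game_def incr_def choice_def start_def shadow_start_def)

lemma at_state_ext:
  assumes "at_state d n \<pi>" "a < L" "t \<in> set (succs sg cs (a \<noteq> 0) d)" "0 \<le> n + state_weight d"
  shows "at_state t (n + state_weight d) (ext \<pi> a t)"
  using assms ext_paths[of \<pi> a t] by (auto simp: at_state_def)

lemma hp_choice:
  assumes "at_state choice n \<pi>"
  shows "hp \<pi> = average \<pi> (\<lambda>a. h (start ((a \<noteq> 0) \<noteq> sg)) n)"
proof -
  have \<pi>: "\<pi> \<in> paths" "st \<pi> = choice"
    using assms by (auto simp: at_state_def)
  have "hp (ext \<pi> a (start ((a \<noteq> 0) \<noteq> sg))) = h (start ((a \<noteq> 0) \<noteq> sg)) n" if "a < L" for a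
  proof -
    have "at_state (start ((a \<noteq> 0) \<noteq> sg)) n (ext \<pi> a (start ((a \<noteq> 0) \<noteq> sg)))"
      using at_state_ext[OF assms that, of "start ((a \<noteq> 0) \<noteq> sg)"] assms
      by (simp add: succs_choice weights at_state_def)
    then show ?thesis
      by (auto simp: at_state_def hp_eq_h weights)
  qed
  then show ?thesis
    unfolding hp_step[OF \<pi>(1)] \<pi>(2) succs_choice by (intro average_cong) simp
qed

text \<open>The difference between the scheduler and the chain \<open>h\<close>, which always takes
  the action \<open>0\<close> and hence the sign \<open>sg\<close>.\<close>

definition gap :: "(nat, nat) fpath \<Rightarrow> real" where
  "gap \<pi> = hp \<pi> - h game (acc_weight M \<pi>)"

lemma gap_step:
  assumes "at_state game n \<pi>"
  shows "gap \<pi> = average \<pi> (\<lambda>a. (average (ext \<pi> a incr) (\<lambda>a'. gap (ext (ext \<pi> a incr) a' game)) +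
    (hp (ext \<pi> a choice) - h (start sg) n)) / 2)"
    and "a < L \<Longrightarrow> a' < L \<Longrightarrow> at_state game (n + 1) (ext (ext \<pi> a incr) a' game)"
    and "a < L \<Longrightarrow> at_state choice n (ext \<pi> a choice)"
proof -
  have \<pi>: "\<pi> \<in> paths" "st \<pi> = game" "acc_weight M \<pi> = n" "0 \<le> n"
    using assms by (auto simp: at_state_def)
  have incr: "at_state incr n (ext \<pi> a incr)" if "a < L" for a
    using at_state_ext[OF assms that, of incr] \<pi>(4) by (simp add: succs_game weights)
  show choice: "at_state choice n (ext \<pi> a choice)" if "a < L" for a
    using at_state_ext[OF assms that, of choice] \<pi>(4) by (simp add: succs_game weights)
  show game: "at_state game (n + 1) (ext (ext \<pi> a incr) a' game)" if "a < L" "a' < L" for a a'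
    using at_state_ext[OF incr[OF that(1)] that(2), of game] \<pi>(4)
    by (simp add: succs_incr weights)
  have "hp \<pi> - h game n =
      average \<pi> (\<lambda>a. (hp (ext \<pi> a incr) + hp (ext \<pi> a choice)) / 2 + - h game n)"
    unfolding average_add average_const[OF \<pi>(1)]
    by (subst hp_step[OF \<pi>(1)])
      (simp add: \<pi>(2) succs_game, intro average_cong, simp add: field_simps)
  also have "\<dots> = average \<pi> (\<lambda>a. (average (ext \<pi> a incr) (\<lambda>a'. gap (ext (ext \<pi> a incr) a' game)) +
    (hp (ext \<pi> a choice) - h (start sg) n)) / 2)"
  proof (rule average_cong)
    fix a
    assume a: "a < L"
    have i: "ext \<pi> a incr \<in> paths" "st (ext \<pi> a incr) = incr"
      using incr[OF a] by (auto simp: at_state_def)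
    have "hp (ext \<pi> a incr) = average (ext \<pi> a incr) (\<lambda>a'. hp (ext (ext \<pi> a incr) a' game))"
      by (subst hp_step[OF i(1)]) (simp add: i(2) succs_incr)
    also have "\<dots> = average (ext \<pi> a incr) (\<lambda>a'. gap (ext (ext \<pi> a incr) a' game) + h game (n + 1))"
      using game[OF a] by (intro average_cong) (auto simp: gap_def at_state_def)
    also have "\<dots> = average (ext \<pi> a incr) (\<lambda>a'. gap (ext (ext \<pi> a incr) a' game)) + h game (n + 1)"
      unfolding average_add average_const[OF i(1)] ..
    finally show "(hp (ext \<pi> a incr) + hp (ext \<pi> a choice)) / 2 + - h game n =
        (average (ext \<pi> a incr) (\<lambda>a'. gap (ext (ext \<pi> a incr) a' game)) +
         (hp (ext \<pi> a choice) - h (start sg) n)) / 2"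
      using h_game_step[OF \<pi>(4), folded game_def start_def] by (simp add: field_simps)
  qed
  finally show "gap \<pi> = average \<pi> (\<lambda>a. (average (ext \<pi> a incr) (\<lambda>a'. gap (ext (ext \<pi> a incr) a' game)) +
      (hp (ext \<pi> a choice) - h (start sg) n)) / 2)"
    by (simp add: gap_def \<pi>(3))
qed

text \<open>The factor \<open>c\<close> covers maximum and minimum as well as both directions of the
  comparison. If no choice improves on the fixed sign, an advantage could only come from ever later
  rounds, and each further round is entered with probability \<open>1/2\<close>.\<close>

lemma gap_nonpos:
  assumes c: "\<bar>c\<bar> = (1 :: real)"
    and choice: "\<And>n \<pi>. at_state choice n \<pi> \<Longrightarrow> c * (hp \<pi> - h (start sg) n) \<le> 0"
    and "at_state game n \<pi>"
  shows "c * gap \<pi> \<le> 0"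
proof -
  have le: "c * gap \<pi> \<le> (1 / 2) ^ m" if "at_state game n \<pi>" for m n \<pi>
    using that
  proof (induction m arbitrary: n \<pi>)
    case 0
    then have "\<pi> \<in> paths"
      by (simp add: at_state_def)
    then show ?case
      using hp_bounds[of \<pi>] hits_bounds[of game "acc_weight M \<pi>"] c
      by (cases "c = 1") (auto simp: gap_def abs_if split: if_splits)
  next
    case (Suc m)
    have "c * gap \<pi> = average \<pi> (\<lambda>a. (average (ext \<pi> a incr) (\<lambda>a'. c * gap (ext (ext \<pi> a incr) a' game)) +
        c * (hp (ext \<pi> a choice) - h (start sg) n)) / 2)"
      by (subst gap_step(1)[OF Suc.prems]) (simp add: algebra_simps average_cmult flip: average_cmult[of \<pi> c])
    also have "\<dots> \<le> average \<pi> (\<lambda>a. (1 / 2) ^ Suc m)"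
    proof (rule average_mono)
      fix a
      assume a: "a < L"
      have "ext \<pi> a incr \<in> paths"
        using ext_paths(1)[of \<pi> a incr] a Suc.prems by (auto simp: at_state_def succs_game)
      note const = average_const[OF this]
      have "average (ext \<pi> a incr) (\<lambda>a'. c * gap (ext (ext \<pi> a incr) a' game)) \<le>
          average (ext \<pi> a incr) (\<lambda>a'. (1 / 2) ^ m)"
        using Suc.IH gap_step(2)[OF Suc.prems a] by (intro average_mono) blast
      then show "(average (ext \<pi> a incr) (\<lambda>a'. c * gap (ext (ext \<pi> a incr) a' game)) +
        c * (hp (ext \<pi> a choice) - h (start sg) n)) / 2 \<le> (1 / 2) ^ Suc m"
        unfolding const using choice[OF gap_step(3)[OF Suc.prems a]] by simp
    qed
    finally show ?case
      using average_const Suc.prems by (simp add: at_state_def)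
  qed
  have "(\<lambda>m. (1 / 2 :: real) ^ m) \<longlonglongrightarrow> 0"
    by (rule LIMSEQ_power_zero) simp
  then show ?thesis
    using le[OF assms(3)] by (intro LIMSEQ_le_const) auto
qed

text \<open>Game and shadow are entered with probability \<open>1/2\<close> each and are
  complementary under the fixed sign, which yields the constant; what remains is half the gap of the
  game.\<close>

lemma hp_init:
  assumes "cs ! (L - 1) = Beta_End"
  shows "hp (0, []) = 1 / 2 + average (0, []) (\<lambda>a. gap (ext (0, []) a game)) / 2"
    and "a < L \<Longrightarrow> at_state game 0 (ext (0, []) a game)"
proof -
  define z where "z = [0, 0, 0, 0, 0, 0, 0, 0 :: nat]"
  have st0: "st (0, []) = z"
    by (simp add: st_def dig_def digits_def digit_def upt_rec z_def)
  have p0: "(0, []) \<in> paths"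
    using L_pos by (simp add: finite_paths_Nil)
  have at0: "at_state z 0 (0, [])"
    using st0 p0 by (simp add: at_state_def)
  have succs0: "succs sg cs a z = [game, game, shadow_start, shadow_start]" for a
    by (simp add: succs_simps z_def game_def shadow_start_def)
  have w0: "state_weight z = 0"
    by (simp add: z_def state_weight_def weight_def)
  show game: "at_state game 0 (ext (0, []) a game)" if "a < L" for a
    using at_state_ext[OF at0 that, of game] by (simp add: succs0 w0)
  have shadow: "at_state shadow_start 0 (ext (0, []) a shadow_start)" if "a < L" for a
    using at_state_ext[OF at0 that, of shadow_start] by (simp add: succs0 w0)
  have one: "h game 0 + h shadow_start 0 = 1"
    using W_plus_shadow[OF assms, of 0 0 0 "of_bool sg" 0 0] h_game L_pos
    by (simp only: game_def shadow_start_def)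
  have "hp (0, []) = average (0, []) (\<lambda>a. (hp (ext (0, []) a game) + hp (ext (0, []) a shadow_start)) / 2)"
    by (subst hp_step[OF p0]) (simp add: st0 succs0, intro average_cong, simp add: field_simps)
  also have "\<dots> = average (0, []) (\<lambda>a. 1 / 2 + (1 / 2) * gap (ext (0, []) a game))"
  proof (rule average_cong)
    fix a
    assume a: "a < L"
    have "hp (ext (0, []) a shadow_start) = h shadow_start 0"
      using shadow[OF a] by (auto simp: at_state_def hp_eq_h weights)
    moreover have "hp (ext (0, []) a game) = gap (ext (0, []) a game) + h game 0"
      using game[OF a] by (simp add: gap_def at_state_def)
    ultimately show "(hp (ext (0, []) a game) + hp (ext (0, []) a shadow_start)) / 2 =
        1 / 2 + (1 / 2) * gap (ext (0, []) a game)"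
      using one by simp
  qed
  also have "\<dots> = 1 / 2 + average (0, []) (\<lambda>a. gap (ext (0, []) a game)) / 2"
    by (simp only: average_add average_const[OF p0] average_cmult)
  finally show "hp (0, []) = 1 / 2 + average (0, []) (\<lambda>a. gap (ext (0, []) a game)) / 2" .
qed

end

section \<open>Schedulers and negative terms\<close>

locale lrs_mdp = lrs_chain + mdp_chain
begin

abbreviation prob_negative :: "(nat, nat) scheduler \<Rightarrow> real" where
  "prob_negative \<sigma> \<equiv> measure (path_measure M \<sigma> 0) (eventually_negative M 0)"

text \<open>Orientation: with \<open>c = 1\<close> larger probabilities are better, with
  \<open>c = -1\<close> smaller ones. As the fixed sign is \<open>sg\<close> itself, deviating pays
  in both cases exactly at the indices with a negative term.\<close>

definition c :: real where
  "c = (if sg then -1 else 1)"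

lemma start_difference:
  assumes "0 \<le> n"
  shows "c * (h [4, 0, of_bool (\<not> sg), 0, 0, 0, 0, 0] n - h [4, 0, of_bool sg, 0, 0, 0, 0, 0] n) =
    - (lam ^ Suc (nat n) * of_rat (lrs as bs (nat n)) / 2)"
  using D_start_lrs[of "nat n"] assms unfolding D_def c_def by (cases sg) simp_all

lemma prob_negative_le:
  assumes \<sigma>: "\<sigma> \<in> schedulers M" and nonneg: "\<And>n. 0 \<le> lrs as bs n"
  shows "c * (prob_negative \<sigma> - 1 / 2) \<le> 0"
proof -
  interpret scheduled_chain sg cs \<sigma>
    by unfold_locales (rule \<sigma>)
  have abs_c: "\<bar>c\<bar> = 1"
    by (simp add: c_def)
  have "c * (hp \<pi> - h (start sg) n) \<le> 0" if "at_state choice n \<pi>" for n \<pi>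
  proof -
    have \<pi>: "\<pi> \<in> paths" "0 \<le> n"
      using that by (auto simp: at_state_def)
    have "c * (hp \<pi> - h (start sg) n) = average \<pi> (\<lambda>a. c * (h (start ((a \<noteq> 0) \<noteq> sg)) n + - h (start sg) n))"
      unfolding average_cmult average_add average_const[OF \<pi>(1)] hp_choice[OF that] by simp
    also have "\<dots> \<le> average \<pi> (\<lambda>_. 0)"
    proof (rule average_mono)
      fix a
      have "0 \<le> lam ^ Suc (nat n) * real_of_rat (lrs as bs (nat n)) / 2"
        using nonneg lam_pos by (simp add: zero_le_of_rat_iff)
      then show "c * (h (start ((a \<noteq> 0) \<noteq> sg)) n + - h (start sg) n) \<le> 0"
        using start_difference[OF \<pi>(2)] by (cases "a = 0") (simp_all add: start_def)
    qed
    finally show ?thesis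
      by (simp add: average_const[OF \<pi>(1)])
  qed
  note gap = gap_nonpos[OF abs_c this]
  have p0: "(0, []) \<in> paths"
    using L_pos by (simp add: finite_paths_Nil)
  have "c * (hp (0, []) - 1 / 2) = average (0, []) (\<lambda>a. c * gap (ext (0, []) a game)) / 2"
    by (simp add: hp_init(1)[OF class_last] average_cmult)
  moreover have "average (0, []) (\<lambda>a. c * gap (ext (0, []) a game)) \<le> average (0, []) (\<lambda>_. 0)"
    using gap hp_init(2)[OF class_last] by (intro average_mono) blast
  ultimately show ?thesis
    by (simp add: measure_eq_hp average_const[OF p0])
qed

text \<open>The scheduler flips the sign exactly when the counter equals \<open>n0\<close>. It never
  loses against the fixed choice, and this counter value is reached with positive
  probability.\<close>

lemma prob_negative_greater:
  assumes "lrs as bs n0 < 0"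
  shows "\<exists>\<sigma> \<in> schedulers M. 0 < c * (prob_negative \<sigma> - 1 / 2)"
proof -
  define act where "act n = (if n = int n0 then 1 else 0 :: nat)" for n
  define \<sigma> :: "(nat, nat) scheduler" where "\<sigma> = (\<lambda>\<pi>. return_pmf (act (acc_weight M \<pi>)))"
  have act_less: "act n < L" for n
  proof -
    have "act n \<le> 1"
      by (simp add: act_def)
    then show ?thesis
      using L_ge by linarith
  qed
  have \<sigma>: "\<sigma> \<in> schedulers M"
    unfolding schedulers_def using enabled_M last_state_finite_paths[of _ M] act_less
    by (force simp: \<sigma>_def)
  interpret scheduled_chain sg cs \<sigma>
    by unfold_locales (rule \<sigma>)
  have average: "average \<pi> f = f (act (acc_weight M \<pi>))" for \<pi> f
  proof -
    have "average \<pi> f = (\<Sum>a \<in> {0..<L}. if a = act (acc_weight M \<pi>) then f a else 0)"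
    proof (unfold average_def, intro sum.cong refl)
      fix a
      show "pmf (\<sigma> \<pi>) a * f a = (if a = act (acc_weight M \<pi>) then f a else 0)"
        by (simp add: \<sigma>_def)
    qed
    then show ?thesis
      using act_less by simp
  qed
  let ?e = "- (lam ^ Suc n0 * of_rat (lrs as bs n0) / 2)"
  have e: "0 < ?e"
    using assms lam_pos by (simp add: mult_less_0_iff)
  have choice: "c * (hp \<pi> - h (start sg) n) = (if n = int n0 then ?e else 0)" if "at_state choice n \<pi>" for n \<pi>
  proof -
    have "acc_weight M \<pi> = n" "0 \<le> n"
      using that by (auto simp: at_state_def)
    then show ?thesis
      using hp_choice[OF that] start_difference[of n] by (auto simp: average act_def start_def)
  qed
  \<comment> \<open>This is \<open>gap_nonpos\<close> with the orientation reversed.\<close>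
  have nonneg: "0 \<le> c * gap \<pi>" if "at_state game n \<pi>" for n \<pi>
  proof -
    have "\<bar>- c\<bar> = 1"
      by (simp add: c_def)
    moreover have "- c * (hp \<rho> - h (start sg) l) \<le> 0" if "at_state choice l \<rho>" for l \<rho>
      using choice[OF that] e by (simp split: if_splits)
    ultimately have "- c * gap \<pi> \<le> 0"
      using that by (rule gap_nonpos)
    then show ?thesis
      by simp
  qed
  \<comment> \<open>Backward induction from counter \<open>n0\<close>: each earlier round halves the
    strict gain, and the choices in between do not lose.\<close>
  have pos: "0 < c * gap \<pi>" if "at_state game (int n0 - int j) \<pi>" for j \<pi>
    using that
  proof (induction j arbitrary: \<pi>)
    case 0
    define a where "a = act (acc_weight M \<pi>)"
    define a' where "a' = act (acc_weight M (ext \<pi> a incr))"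
    have "0 \<le> c * gap (ext (ext \<pi> a incr) a' game)"
      using gap_step(2)[OF 0, of a a'] act_less by (intro nonneg) (auto simp: a_def a'_def)
    moreover have "c * (hp (ext \<pi> a choice) - h (start sg) (int n0 - int 0)) = ?e"
      using choice[OF gap_step(3)[OF 0, of a]] act_less by (simp add: a_def)
    moreover have "c * gap \<pi> = (c * gap (ext (ext \<pi> a incr) a' game) +
        c * (hp (ext \<pi> a choice) - h (start sg) (int n0 - int 0))) / 2"
      by (subst gap_step(1)[OF 0]) (simp add: average a_def a'_def algebra_simps)
    ultimately show ?case
      using e by simp
  next
    case (Suc j)
    define a where "a = act (acc_weight M \<pi>)"
    define a' where "a' = act (acc_weight M (ext \<pi> a incr))"
    have "at_state game (int n0 - int j) (ext (ext \<pi> a incr) a' game)"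
      using gap_step(2)[OF Suc.prems, of a a'] act_less by (auto simp: a_def a'_def)
    then have "0 < c * gap (ext (ext \<pi> a incr) a' game)"
      by (rule Suc.IH)
    moreover have "0 \<le> c * (hp (ext \<pi> a choice) - h (start sg) (int n0 - int (Suc j)))"
    proof -
      have "a < L"
        using act_less by (simp add: a_def)
      from choice[OF gap_step(3)[OF Suc.prems this]] e show ?thesis
        by (simp only: simp_thms if_True if_False order_refl less_imp_le split: if_splits)
    qed
    moreover have "c * gap \<pi> = (c * gap (ext (ext \<pi> a incr) a' game) +
        c * (hp (ext \<pi> a choice) - h (start sg) (int n0 - int (Suc j)))) / 2"
      by (subst gap_step(1)[OF Suc.prems]) (simp add: average a_def a'_def algebra_simps)
    ultimately show ?case
      by simp
  qed
  define a where "a = act (acc_weight M (0, []))"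
  have "at_state game 0 (ext (0, []) a game)"
    using hp_init(2)[OF class_last, of a] act_less by (simp add: a_def)
  then have "0 < c * gap (ext (0, []) a game)"
    by (intro pos[of n0]) simp
  moreover have "hp (0, []) = 1 / 2 + gap (ext (0, []) a game) / 2"
    using hp_init(1)[OF class_last] by (simp only: average a_def)
  ultimately have "0 < c * (hp (0, []) - 1 / 2)"
    by simp
  then show ?thesis
    using \<sigma> by (intro bexI[of _ \<sigma>]) (simp_all only: measure_eq_hp)
qed

lemma ex_scheduler: "schedulers M \<noteq> {}"
proof -
  have "(\<lambda>_. return_pmf 0) \<in> schedulers M"
    unfolding schedulers_def using enabled_M last_state_finite_paths[of _ M] L_pos by force
  then show ?thesis
    by blast
qed

lemma prob_negative_bounds: "\<sigma> \<in> schedulers M \<Longrightarrow> 0 \<le> prob_negative \<sigma> \<and> prob_negative \<sigma> \<le> 1"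
proof -
  assume \<sigma>: "\<sigma> \<in> schedulers M"
  interpret scheduled_chain sg cs \<sigma>
    by unfold_locales (rule \<sigma>)
  have "(0, []) \<in> paths"
    using L_pos by (simp add: finite_paths_Nil)
  then show ?thesis
    using hp_bounds by (simp add: measure_eq_hp)
qed

theorem Pr_max_iff:
  assumes "\<not> sg"
  shows "1 / 2 < Pr_max M 0 (eventually_negative M 0) \<longleftrightarrow> (\<exists>n. lrs as bs n < 0)"
proof
  have c: "c = 1"
    using assms unfolding c_def by simp
  assume gt: "1 / 2 < Pr_max M 0 (eventually_negative M 0)"
  show "\<exists>n. lrs as bs n < 0"
  proof (rule ccontr)
    assume "\<nexists>n. lrs as bs n < 0"
    then have "prob_negative \<sigma> \<le> 1 / 2" if "\<sigma> \<in> schedulers M" for \<sigma>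
      using prob_negative_le[OF that] c by (simp add: not_less)
    then have "Pr_max M 0 (eventually_negative M 0) \<le> 1 / 2"
      unfolding Pr_max_def using ex_scheduler by (intro cSUP_least) auto
    with gt show False
      by simp
  qed
next
  have c: "c = 1"
    using assms unfolding c_def by simp
  assume "\<exists>n. lrs as bs n < 0"
  then obtain \<sigma> where \<sigma>: "\<sigma> \<in> schedulers M" "1 / 2 < prob_negative \<sigma>"
    using prob_negative_greater c by auto
  have "prob_negative \<sigma> \<le> Pr_max M 0 (eventually_negative M 0)"
    unfolding Pr_max_def using prob_negative_bounds \<sigma>(1)
    by (intro cSUP_upper bdd_aboveI2[where M = 1]) auto
  with \<sigma>(2) show "1 / 2 < Pr_max M 0 (eventually_negative M 0)"
    by simp
qed

theorem Pr_min_iff: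
  assumes "sg"
  shows "Pr_min M 0 (eventually_negative M 0) < 1 / 2 \<longleftrightarrow> (\<exists>n. lrs as bs n < 0)"
proof
  have c: "c = - 1"
    using assms unfolding c_def by simp
  assume less: "Pr_min M 0 (eventually_negative M 0) < 1 / 2"
  show "\<exists>n. lrs as bs n < 0"
  proof (rule ccontr)
    assume "\<nexists>n. lrs as bs n < 0"
    then have "1 / 2 \<le> prob_negative \<sigma>" if "\<sigma> \<in> schedulers M" for \<sigma>
      using prob_negative_le[OF that] c by (simp add: not_less)
    then have "1 / 2 \<le> Pr_min M 0 (eventually_negative M 0)"
      unfolding Pr_min_def using ex_scheduler by (intro cINF_greatest) auto
    with less show False
      by simp
  qed
next
  have c: "c = - 1"
    using assms unfolding c_def by simp
  assume "\<exists>n. lrs as bs n < 0"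
  then obtain \<sigma> where \<sigma>: "\<sigma> \<in> schedulers M" "prob_negative \<sigma> < 1 / 2"
    using prob_negative_greater c by auto
  have "Pr_min M 0 (eventually_negative M 0) \<le> prob_negative \<sigma>"
    unfolding Pr_min_def using prob_negative_bounds \<sigma>(1)
    by (intro cINF_lower bdd_belowI2[where m = 0]) auto
  with \<sigma>(2) show "Pr_min M 0 (eventually_negative M 0) < 1 / 2"
    by simp
qed

end

section \<open>Parsing\<close>

text \<open>The flag tells whether the first list has been completed. Because the codes are
  self-delimiting, a finite automaton determines the class of every input letter.\<close>

datatype parse_state =
  List_Start bool | Num_Sign bool | Num_Start bool | Num_Bit bool
| Den_Sign bool | Den_Start bool | Den_Bit bool | Finished

fun parse_step :: "parse_state \<Rightarrow> bool \<Rightarrow> parse_state" where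
  "parse_step (List_Start f) b = (if b then Num_Sign f else if f then Finished else List_Start True)"
| "parse_step (Num_Sign f) b = Num_Start f"
| "parse_step (Num_Start f) b = (if b then Num_Bit f else Den_Sign f)"
| "parse_step (Num_Bit f) b = Num_Start f"
| "parse_step (Den_Sign f) b = Den_Start f"
| "parse_step (Den_Start f) b = (if b then Den_Bit f else List_Start f)"
| "parse_step (Den_Bit f) b = Den_Start f"
| "parse_step Finished b = Finished"

fun class_of :: "parse_state \<Rightarrow> bool \<Rightarrow> pos_class" where
  "class_of (List_Start f) b =
     (if f then if b then Beta_Item else Beta_End else if b then Alpha_Item else Alpha_End)"
| "class_of (Num_Sign f) b = Sign b"
| "class_of (Num_Start f) b = (if b then Neutral else Num_End)"
| "class_of (Num_Bit f) b = Num_Digit b"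
| "class_of (Den_Start f) b = (if b then Neutral else Den_End)"
| "class_of (Den_Bit f) b = Den_Digit b"
| "class_of _ b = Neutral"

fun classes_from :: "parse_state \<Rightarrow> bool list \<Rightarrow> pos_class list" where
  "classes_from q [] = []"
| "classes_from q (b # w) = class_of q b # classes_from (parse_step q b) w"

definition classes :: "bool list \<Rightarrow> pos_class list" where
  "classes = classes_from (List_Start False)"

lemma length_classes_from [simp]: "length (classes_from q w) = length w"
  by (induction w arbitrary: q) auto

lemma length_classes [simp]: "length (classes w) = length w"
  by (simp add: classes_def)

lemma classes_from_append:
  "classes_from q (u @ w) = classes_from q u @ classes_from (foldl parse_step q u) w"
  by (induction u arbitrary: q) auto

lemma enc_nat_eq: "enc_nat n = concat (map (\<lambda>b. [True, b]) (bits n)) @ [False]"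
  by (simp add: enc_nat_def enc_list_def)

lemma classes_num:
  "classes_from (Num_Start f) (enc_nat n @ w) =
     digit_classes Num_Digit (bits n) @ Num_End # classes_from (Den_Sign f) w"
proof -
  have "classes_from (Num_Start f) ((concat (map (\<lambda>b. [True, b]) bs) @ [False]) @ w) =
      digit_classes Num_Digit bs @ Num_End # classes_from (Den_Sign f) w" for bs
    by (induction bs) (auto simp: digit_classes_def)
  then show ?thesis
    unfolding enc_nat_eq .
qed

lemma classes_den:
  "classes_from (Den_Start f) (enc_nat n @ w) =
     digit_classes Den_Digit (bits n) @ Den_End # classes_from (List_Start f) w"
proof -
  have "classes_from (Den_Start f) ((concat (map (\<lambda>b. [True, b]) bs) @ [False]) @ w) =
      digit_classes Den_Digit bs @ Den_End # classes_from (List_Start f) w" for bs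
    by (induction bs) (auto simp: digit_classes_def)
  then show ?thesis
    unfolding enc_nat_eq .
qed

lemma classes_list:
  "classes_from (List_Start f) (enc_list enc_rat rs @ w) =
     list_classes (if f then Beta_Item else Alpha_Item) rs @ (if f then Beta_End else Alpha_End) #
     classes_from (if f then Finished else List_Start True) w"
proof (induction rs)
  case (Cons r rs)
  have "enc_list enc_rat (r # rs) @ w = True # (fst (quotient_of r) < 0) # enc_nat (nat \<bar>fst (quotient_of r)\<bar>) @
      (snd (quotient_of r) < 0) # enc_nat (nat \<bar>snd (quotient_of r)\<bar>) @ enc_list enc_rat rs @ w"
    by (simp add: enc_list_def enc_rat_def enc_int_def)
  then show ?case
    using Cons
    by (simp add: classes_num classes_den list_classes_Cons item_classes_def num_bits_def den_bits_def)
qed (auto simp: enc_list_def list_classes_def)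

lemma classes_enc_lrs: "classes (enc_lrs as bs) = input_classes as bs"
  using classes_list[of False as "enc_list enc_rat bs"] classes_list[of True bs "[]"]
  by (simp add: classes_def enc_lrs_def input_classes_def)

text \<open>A denominator is positive and so has a digit; hence an item takes at least seven
  letters: marker, sign, \<open>Num_End\<close>, sign of the denominator, two letters for a digit,
  \<open>Den_End\<close>. Four items already exceed 22, the number of control states.\<close>

lemma length_input_classes_ge:
  assumes "2 \<le> length as" "length bs = length as"
  shows "22 \<le> length (input_classes as bs)"
proof -
  have item: "7 \<le> length (item_classes c r)" for c r
  proof -
    have "nat \<bar>snd (quotient_of r)\<bar> \<noteq> 0"
      using quotient_of_denom_pos'[of r] by simp
    then have "den_bits r \<noteq> []"
      unfolding den_bits_def by (subst bits.simps) simp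
    then have "1 \<le> length (den_bits r)"
      by (simp add: Suc_le_eq)
    then show ?thesis
      by (simp add: item_classes_def)
  qed
  have list: "7 * length rs \<le> length (list_classes c rs)" for c rs
  proof (induction rs)
    case (Cons r rs)
    then show ?case
      using item[of c r] by (simp add: list_classes_Cons)
  qed simp
  show ?thesis
    using list[of as Alpha_Item] list[of bs Beta_Item] assms by (simp add: input_classes_def)
qed

section \<open>Regularity of the transition table\<close>

lemma finite_parse_state: "finite (UNIV :: parse_state set)"
proof (rule finite_subset)
  show "UNIV \<subseteq> range List_Start \<union> range Num_Sign \<union> range Num_Start \<union> range Num_Bit \<union>
      range Den_Sign \<union> range Den_Start \<union> range Den_Bit \<union> {Finished}"
  proof
    fix q
    show "q \<in> range List_Start \<union> range Num_Sign \<union> range Num_Start \<union> range Num_Bit \<union>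
        range Den_Sign \<union> range Den_Start \<union> range Den_Bit \<union> {Finished}"
      by (cases q) auto
  qed
qed simp

lemma finite_pos_class: "finite (UNIV :: pos_class set)"
proof (rule finite_subset)
  show "UNIV \<subseteq> range Sign \<union> range Num_Digit \<union> range Den_Digit \<union>
      {Alpha_Item, Alpha_End, Beta_Item, Beta_End, Num_End, Den_End, Neutral}"
  proof
    fix c
    show "c \<in> range Sign \<union> range Num_Digit \<union> range Den_Digit \<union>
        {Alpha_Item, Alpha_End, Beta_Item, Beta_End, Num_End, Den_End, Neutral}"
      by (cases c) auto
  qed
qed simp

text \<open>For \<open>r < m\<close>, mark \<open>r\<close> occurs exactly once in a nonempty
  \<open>mark_word\<close>, so the following predicates express equality, succession, maximality and
  constant values of digits: all the comparisons that coordinate updates require.\<close>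

definition meet :: "nat \<Rightarrow> nat \<Rightarrow> letter list \<Rightarrow> bool" where
  "meet r r' v \<longleftrightarrow> (\<exists>a \<in> set v. r \<in> snd a \<and> r' \<in> snd a)"

definition adjacent :: "nat \<Rightarrow> nat \<Rightarrow> letter list \<Rightarrow> bool" where
  "adjacent r r' v \<longleftrightarrow> (\<exists>p. Suc p < length v \<and> r \<in> snd (v ! p) \<and> r' \<in> snd (v ! Suc p))"

definition at_last :: "nat \<Rightarrow> letter list \<Rightarrow> bool" where
  "at_last r v \<longleftrightarrow> v \<noteq> [] \<and> r \<in> snd (last v)"

definition at_pos :: "nat \<Rightarrow> nat \<Rightarrow> letter list \<Rightarrow> bool" where
  "at_pos c r v \<longleftrightarrow> c < length v \<and> r \<in> snd (v ! c)"

definition class_step :: "nat \<Rightarrow> parse_state \<times> pos_class \<Rightarrow> letter \<Rightarrow> parse_state \<times> pos_class" where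
  "class_step r = (\<lambda>(q, c) a. (parse_step q (fst a), if r \<in> snd a then class_of q (fst a) else c))"

definition mark_class :: "nat \<Rightarrow> letter list \<Rightarrow> pos_class" where
  "mark_class r v = snd (foldl (class_step r) (List_Start False, Neutral) v)"

lemma regular_meet: "regular (meet r r')"
proof (rule regular_foldl[where Q = UNIV and g = id])
  show "meet r r' v = id (foldl (\<lambda>q a. q \<or> r \<in> snd a \<and> r' \<in> snd a) False v)" for v
    by (induction v rule: rev_induct) (auto simp: meet_def)
qed auto

lemma regular_at_last: "regular (at_last r)"
proof (rule regular_foldl[where Q = UNIV and g = id])
  show "at_last r v = id (foldl (\<lambda>q a. r \<in> snd a) False v)" for v
    by (cases v rule: rev_cases) (auto simp: at_last_def)
qed auto

lemma adjacent_snoc: "adjacent r r' (v @ [a]) \<longleftrightarrow> adjacent r r' v \<or> at_last r v \<and> r' \<in> snd a"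
proof (cases v rule: rev_cases)
  case Nil
  then show ?thesis
    by (simp add: adjacent_def at_last_def)
next
  case (snoc u b)
  have "adjacent r r' ((u @ [b]) @ [a]) \<longleftrightarrow> adjacent r r' (u @ [b]) \<or> r \<in> snd b \<and> r' \<in> snd a"
  proof
    assume "adjacent r r' ((u @ [b]) @ [a])"
    then obtain p where p: "Suc p < length ((u @ [b]) @ [a])" "r \<in> snd (((u @ [b]) @ [a]) ! p)"
      "r' \<in> snd (((u @ [b]) @ [a]) ! Suc p)"
      by (auto simp: adjacent_def)
    show "adjacent r r' (u @ [b]) \<or> r \<in> snd b \<and> r' \<in> snd a"
    proof (cases "Suc p < length (u @ [b])")
      case True
      then have "r \<in> snd ((u @ [b]) ! p)" "r' \<in> snd ((u @ [b]) ! Suc p)"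
        using p(2,3) by (simp_all only: nth_append_left Suc_lessD)
      then show ?thesis
        using True by (auto simp: adjacent_def)
    next
      case False
      then have "p = length u"
        using p(1) by simp
      then show ?thesis
        using p(2,3) by (simp add: nth_append)
    qed
  next
    assume "adjacent r r' (u @ [b]) \<or> r \<in> snd b \<and> r' \<in> snd a"
    then show "adjacent r r' ((u @ [b]) @ [a])"
    proof
      assume "adjacent r r' (u @ [b])"
      then obtain p where p: "Suc p < length (u @ [b])" "r \<in> snd ((u @ [b]) ! p)" "r' \<in> snd ((u @ [b]) ! Suc p)"
        by (auto simp: adjacent_def)
      then have "((u @ [b]) @ [a]) ! p = (u @ [b]) ! p" "((u @ [b]) @ [a]) ! Suc p = (u @ [b]) ! Suc p"
        by (simp_all only: nth_append_left Suc_lessD)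
      then show ?thesis
        using p unfolding adjacent_def by (intro exI[of _ p]) (simp only: length_append, simp)
    next
      assume "r \<in> snd b \<and> r' \<in> snd a"
      then show ?thesis
        unfolding adjacent_def by (intro exI[of _ "length u"]) (simp add: nth_append)
    qed
  qed
  then show ?thesis
    by (simp add: snoc at_last_def)
qed

lemma regular_adjacent: "regular (adjacent r r')"
proof (rule regular_foldl[where Q = UNIV and g = fst])
  have "foldl (\<lambda>(f, q) a. (f \<or> q \<and> r' \<in> snd a, r \<in> snd a)) (False, False) v = (adjacent r r' v, at_last r v)" for v
    by (induction v rule: rev_induct) (auto simp: adjacent_snoc, auto simp: adjacent_def at_last_def)
  then show "adjacent r r' v = fst (foldl (\<lambda>(f, q) a. (f \<or> q \<and> r' \<in> snd a, r \<in> snd a)) (False, False) v)" for v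
    by simp
qed auto

text \<open>A position counter saturated at \<open>Suc c\<close> suffices.\<close>

lemma regular_at_pos: "regular (at_pos c r)"
proof (rule regular_foldl[where Q = "{..Suc c} \<times> UNIV" and g = snd])
  let ?d = "\<lambda>(n, b) a. (min (Suc n) (Suc c), b \<or> n = c \<and> r \<in> snd a)"
  have "foldl ?d (0, False) v = (min (length v) (Suc c), at_pos c r v)" for v
  proof (induction v rule: rev_induct)
    case (snoc a v)
    then show ?case
      by (cases "length v" c rule: linorder_cases) (auto simp: at_pos_def nth_append)
  qed (simp add: at_pos_def)
  then show "at_pos c r v = snd (foldl ?d (0, False) v)" for v
    by simp
qed auto

lemma regular_mark_class: "regular (mark_class r)"
proof (rule regular_foldl[where Q = UNIV and g = snd])
  show "finite (UNIV :: (parse_state \<times> pos_class) set)"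
    using finite_parse_state finite_pos_class by (simp add: finite_prod)
qed (auto simp: mark_class_def)

context
  fixes m :: nat and w :: "bool list" and N :: nat
  assumes w: "w \<noteq> []"
begin

abbreviation "mw \<equiv> mark_word m w N"
abbreviation "dg r \<equiv> digit (length w) r N"

lemma digit_less: "dg r < length w"
  using w by (simp add: digit_def)

lemma nth_mark_word: "p < length w \<Longrightarrow> mw ! p = (w ! p, {r. r < m \<and> dg r = p})"
  by (simp add: mark_word_def)

lemma meet_mark_word: "r < m \<Longrightarrow> r' < m \<Longrightarrow> meet r r' mw \<longleftrightarrow> dg r = dg r'"
  using digit_less[of r] by (force simp: meet_def mark_word_def)

lemma adjacent_mark_word: "r < m \<Longrightarrow> r' < m \<Longrightarrow> adjacent r r' mw \<longleftrightarrow> dg r' = Suc (dg r)"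
  using digit_less[of r'] by (auto simp: adjacent_def nth_mark_word)

lemma at_last_mark_word: "r < m \<Longrightarrow> at_last r mw \<longleftrightarrow> dg r = length w - 1"
  using w last_mark_word[OF w, of m N] by (auto simp: at_last_def simp flip: length_greater_0_conv)

lemma at_pos_mark_word: "r < m \<Longrightarrow> at_pos c r mw \<longleftrightarrow> dg r = c"
  using digit_less[of r] by (auto simp: at_pos_def nth_mark_word)

lemma mark_class_mark_word:
  assumes "r < m"
  shows "mark_class r mw = classes w ! dg r"
proof -
  have fold: "foldl (class_step r) (List_Start False, Neutral) (take n mw) =
    (foldl parse_step (List_Start False) (take n w), if dg r < n then classes w ! dg r else Neutral)"
    if "n \<le> length w" for n
    using that
  proof (induction n)
    case (Suc n)
    have n: "n < length w"
      using Suc.prems by simp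
    have "classes w = classes_from (List_Start False) (take n w @ w ! n # drop (Suc n) w)"
      unfolding classes_def using n by (simp flip: id_take_nth_drop)
    then have "classes w ! n = class_of (foldl parse_step (List_Start False) (take n w)) (w ! n)"
      using n by (simp add: classes_from_append nth_append)
    then show ?case
      using Suc n assms by (auto simp: take_Suc_conv_app_nth nth_mark_word class_step_def)
  qed simp
  show ?thesis
    using fold[of "length w"] digit_less[of r] by (simp add: mark_class_def mark_word_def)
qed

end

text \<open>
  In the marked words below, the marks \<open>0, \<dots>, 7\<close> stand for the target state, the mark \<open>8\<close> for the action
  and the marks \<open>9, \<dots>, 16\<close> for the source state of an entry of the transition table.
\<close>

definition upd_holds :: "upd \<Rightarrow> nat \<Rightarrow> letter list \<Rightarrow> bool" where
  "upd_holds u r v = (case u of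
     Keep \<Rightarrow> meet (9 + r) r v
   | Incr \<Rightarrow> adjacent (9 + r) r v \<or> at_last (9 + r) v \<and> meet (9 + r) r v
   | Const c \<Rightarrow> at_pos c r v)"

text \<open>The position of mark \<open>9\<close>, cut off at 22 to keep the range finite; all
  larger control values have the same slots and the same weight.\<close>

definition control :: "letter list \<Rightarrow> nat" where
  "control v = length (takeWhile (\<lambda>b. \<not> b) (map (\<lambda>c. at_pos c 9 v) [0..<22]))"

definition word_slots :: "bool \<Rightarrow> letter list \<Rightarrow> upd list list" where
  "word_slots sg v = slots sg (\<not> at_pos 0 8 v) (control v) (\<not> at_pos 0 10 v) (\<not> at_pos 0 11 v)
     (\<not> at_pos 0 12 v) (\<not> at_pos 0 13 v) (mark_class 14 v) (mark_class 15 v) (mark_class 16 v)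
     (meet 16 14 v) (meet 16 15 v)"

definition word_count :: "upd list list \<Rightarrow> letter list \<Rightarrow> nat" where
  "word_count uss v = (\<Sum>b \<leftarrow> map (\<lambda>us. list_all id (map (\<lambda>r. upd_holds (us ! r) r v) [0..<8])) uss. of_bool b)"

text \<open>The brackets of the nested lists are attached to extreme entries: the first target opens
  an action, with action 0 also a state, and carries the weight; the last target closes the list of
  targets, with the last action also that of actions.\<close>

definition word_entry :: "bool \<Rightarrow> letter list \<Rightarrow> bool list" where
  "word_entry sg v =
     (if list_all id (map (\<lambda>r. at_pos 0 r v) [0..<8])
      then (if at_pos 0 8 v then [True] else []) @
        True # enc_int (weight (control v) (\<not> at_pos 0 10 v) (\<not> at_pos 0 11 v))
      else []) @
     True # enc_rat (of_nat (word_count (word_slots sg v) v) / 4) @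
     (if list_all id (map (\<lambda>r. at_last r v) [0..<8])
      then False # (if at_last 8 v then [False] else []) else [])"

lemma regular_upd_holds: "regular (upd_holds u r)"
proof (cases u)
  case Incr
  have "regular (\<lambda>v. adjacent (9 + r) r v \<or> (at_last (9 + r) v \<and> meet (9 + r) r v))"
    by (rule regular_comp2[where g = "(\<or>)", OF regular_adjacent
          regular_comp2[where g = "(\<and>)", OF regular_at_last regular_meet]])
  then show ?thesis
    by (simp add: upd_holds_def[abs_def] Incr)
qed (simp_all add: upd_holds_def[abs_def] regular_meet regular_at_pos)

lemma regular_control: "regular control"
proof -
  have "regular (\<lambda>v. map (\<lambda>c. at_pos c 9 v) [0..<22])"
    by (rule regular_map) (rule regular_at_pos)
  from regular_comp[OF this, of "\<lambda>bs. length (takeWhile (\<lambda>b. \<not> b) bs)"] show ?thesis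
    unfolding control_def[abs_def] .
qed

lemma regular_word_slots: "regular (word_slots sg)"
proof -
  have "regular (\<lambda>v. (at_pos 0 8 v, control v, at_pos 0 10 v, at_pos 0 11 v, at_pos 0 12 v, at_pos 0 13 v,
      mark_class 14 v, mark_class 15 v, mark_class 16 v, meet 16 14 v, meet 16 15 v))"
    by (intro regular_comp2[where g = Pair] regular_control regular_at_pos regular_mark_class regular_meet)
  from regular_comp[OF this, of "\<lambda>(a, k, m, g, x, s, ci, cj, cp, ei, ej).
      slots sg (\<not> a) k (\<not> m) (\<not> g) (\<not> x) (\<not> s) ci cj cp ei ej"]
  show ?thesis
    unfolding word_slots_def[abs_def] by simp
qed

lemma regular_word_count: "regular (word_count uss)"
proof -
  have "regular (\<lambda>v. map (\<lambda>us. list_all id (map (\<lambda>r. upd_holds (us ! r) r v) [0..<8])) uss)"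
    by (intro regular_map regular_comp[where g = "list_all id"] regular_upd_holds)
  from regular_comp[OF this, of "\<lambda>bs. \<Sum>b \<leftarrow> bs. of_bool b"] show ?thesis
    unfolding word_count_def[abs_def] .
qed

lemma regular_word_entry: "regular (word_entry sg)"
proof -
  have 1: "regular (\<lambda>v. word_count (word_slots sg v) v)"
    by (rule regular_bind[OF regular_word_slots regular_word_count])
  have 2: "regular (\<lambda>v. list_all id (map (\<lambda>r. at_pos 0 r v) [0..<8]))"
    by (intro regular_comp[where g = "list_all id"] regular_map regular_at_pos)
  have 3: "regular (\<lambda>v. list_all id (map (\<lambda>r. at_last r v) [0..<8]))"
    by (intro regular_comp[where g = "list_all id"] regular_map regular_at_last)
  have "regular (\<lambda>v. (list_all id (map (\<lambda>r. at_pos 0 r v) [0..<8]), at_pos 0 8 v, control v, at_pos 0 10 v,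
      at_pos 0 11 v, word_count (word_slots sg v) v, list_all id (map (\<lambda>r. at_last r v) [0..<8]), at_last 8 v))"
    by (intro regular_comp2[where g = Pair] 1 2 3 regular_control regular_at_pos regular_at_last)
  from regular_comp[OF this, of "\<lambda>(z, y, k, m, g, c, l, l'). (if z then (if y then [True] else []) @
        True # enc_int (weight k (\<not> m) (\<not> g)) else []) @
     True # enc_rat (of_nat c / 4) @ (if l then False # (if l' then [False] else []) else [])"]
  show ?thesis
    unfolding word_entry_def[abs_def] by simp
qed

section \<open>The encoded process is the output of the sweeping machine\<close>

lemma digit_mod: "r < m \<Longrightarrow> digit L r (N mod L ^ m) = digit L r N"
proof -
  assume r: "r < m"
  show ?thesis
  proof (cases "L = 0")
    case False
    let ?K = "L * L ^ (m - Suc r)"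
    have "N mod L ^ m = L ^ r * (N div L ^ r mod ?K) + N mod L ^ r"
      unfolding power_split_less[OF r] by (rule mod_mult2_eq)
    then have "N mod L ^ m div L ^ r = N div L ^ r mod ?K"
      using False by simp
    then show ?thesis
      unfolding digit_def by (simp add: mod_mod_cancel)
  qed (use r in \<open>simp add: digit_def power_0_left\<close>)
qed

lemma digit_add: "digit L (m + r) N = digit L r (N div L ^ m)"
  by (simp add: digit_def power_add div_mult2_eq)

lemma length_takeWhile_neq: "length (takeWhile (\<lambda>b. \<not> b) (map (\<lambda>c. p = c) [0..<n])) = min p n"
proof (induction n)
  case (Suc n)
  show ?case
  proof (cases "p < n")
    case True
    then have "True \<in> set (map (\<lambda>c. p = c) [0..<n])"
      by auto
    then show ?thesis
      using Suc True takeWhile_append1[of True "map (\<lambda>c. p = c) [0..<n]" "\<lambda>b. \<not> b"] by simp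
  next
    case False
    then have "\<forall>b \<in> set (map (\<lambda>c. p = c) [0..<n]). \<not> b"
      by auto
    then have "takeWhile (\<lambda>b. \<not> b) (map (\<lambda>c. p = c) [0..<n] @ [p = n]) =
        map (\<lambda>c. p = c) [0..<n] @ takeWhile (\<lambda>b. \<not> b) [p = n]"
      by (intro takeWhile_append2) auto
    then show ?thesis
      using False by (auto simp: comp_def)
  qed
qed simp

lemma slots_min: "slots sg a (min k 22) m g x s ci cj cp ei ej = slots sg a k m g x s ci cj cp ei ej"
  by (cases "k < 22") (simp_all add: slots_def)

lemma weight_min: "weight (min k 22) m g = weight k m g"
  by (cases "k < 22") (simp_all add: weight_def)

context mdp_chain
begin

lemma dig_eq_iff: "t < L ^ 8 \<Longrightarrow> u < L ^ 8 \<Longrightarrow> dig t = dig u \<longleftrightarrow> t = u"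
  using num_dig by metis

lemma dig_eq_list_iff: "length d = 8 \<Longrightarrow> d = dig t \<longleftrightarrow> (\<forall>r < 8. d ! r = digit L r t)"
  by (auto simp: dig_def list_eq_iff_nth_eq)

lemma dig_0: "dig 0 = replicate 8 0"
  by (simp add: dig_def digits_def digit_def map_replicate_const)

lemma dig_last: "dig (L ^ 8 - 1) = replicate 8 (L - 1)"
proof -
  have v: "valid (replicate 8 (L - 1))"
    using L_pos by (auto simp: valid_def)
  define t where "t = num (replicate 8 (L - 1))"
  have t: "dig t = replicate 8 (L - 1)" "t < L ^ 8"
    using v by (simp_all add: t_def dig_num num_less)
  have "digit L r t = L - 1" if "r < 8" for r
    using arg_cong[OF t(1), of "\<lambda>d. d ! r"] that by (simp add: dig_def)
  then have "t mod L ^ 8 = L ^ 8 - 1"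
    using L_pos by (intro mod_power_eq_digits) auto
  then show ?thesis
    using t by simp
qed

definition entry :: "nat \<Rightarrow> nat \<Rightarrow> nat \<Rightarrow> bool list" where
  "entry s a t =
     (if t = 0 then (if a = 0 then [True] else []) @ True # enc_int (wgt M s a) else []) @
     True # enc_rat (tprob M s a t) @
     (if t = L ^ 8 - 1 then False # (if a = L - 1 then [False] else []) else [])"

text \<open>The odometer runs through \<open>N = (s * L + a) * L ^ 8 + t\<close> with the target in
  the lowest digits, which is the order of entries in \<open>enc_mdp\<close>.\<close>

lemma word_entry_eq_entry:
  assumes cs: "cs = classes w" and N: "N < L ^ 17"
  shows "word_entry sg (mark_word 17 w N) = entry (N div L ^ 9) (N div L ^ 8 mod L) (N mod L ^ 8)"
proof -
  define s a t where "s = N div L ^ 9" and "a = N div L ^ 8 mod L" and "t = N mod L ^ 8"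
  have w: "w \<noteq> []" and L: "length w = L"
    using L_pos by (auto simp: cs)
  let ?v = "mark_word 17 w N"
  have t: "t < L ^ 8"
    using L_pos by (simp add: t_def)
  have dt: "digit L r N = digit L r t" if "r < 8" for r
    using that by (simp add: t_def digit_mod)
  have da: "digit L 8 N = a"
    by (simp add: a_def digit_def)
  have ds: "digit L (9 + r) N = digit L r s" for r
    by (simp add: s_def digit_add)
  have nth_s: "dig s ! r = digit L r s" if "r < 8" for r
    using that by (simp add: dig_def)
  have at: "at_pos c r ?v \<longleftrightarrow> digit L r N = c" if "r < 17" for r c
    using at_pos_mark_word[OF w that] by (simp add: L)
  have meet: "meet r r' ?v \<longleftrightarrow> digit L r N = digit L r' N" if "r < 17" "r' < 17" for r r'
    using meet_mark_word[OF w that] by (simp add: L)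
  have last: "at_last r ?v \<longleftrightarrow> digit L r N = L - 1" if "r < 17" for r
    using at_last_mark_word[OF w that] by (simp add: L)
  have adj: "adjacent r r' ?v \<longleftrightarrow> digit L r' N = Suc (digit L r N)" if "r < 17" "r' < 17" for r r'
    using adjacent_mark_word[OF w that] by (simp add: L)
  have cls: "mark_class r ?v = cs ! digit L r N" if "r < 17" for r
    by (simp only: mark_class_mark_word[OF w that] L cs[symmetric])
  have d: "digit L 9 N = dig s ! 0" "digit L 10 N = dig s ! 1" "digit L 11 N = dig s ! 2"
    "digit L 12 N = dig s ! 3" "digit L 13 N = dig s ! 4" "digit L 14 N = dig s ! 5"
    "digit L 15 N = dig s ! 6" "digit L 16 N = dig s ! 7"
    using ds[of 0] ds[of 1] ds[of 2] ds[of 3] ds[of 4] ds[of 5] ds[of 6] ds[of 7] by (simp_all add: nth_s)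
  have control: "control ?v = min (dig s ! 0) 22"
    unfolding control_def using length_takeWhile_neq[of "dig s ! 0" 22] by (simp add: at d cong: map_cong)
  have slots: "map (\<lambda>us. map2 (apply_upd L) us (dig s)) (word_slots sg ?v) = succs sg cs (a \<noteq> 0) (dig s)"
    unfolding word_slots_def control slots_min succs_def
    by (simp add: at meet cls d da)
  have holds: "upd_holds u r ?v \<longleftrightarrow> apply_upd L u (digit L r s) = digit L r t" if "r < 8" for u r
  proof (cases u)
    case Incr
    have "digit L r s < L" "digit L r t < L"
      using L_pos by (simp_all add: digit_def)
    then show ?thesis
      using that ds[of r] dt[of r] by (auto simp: upd_holds_def Incr adj meet last)
  qed (use that ds[of r] dt[of r] in \<open>auto simp: upd_holds_def meet at\<close>)
  have count: "word_count uss ?v = count_list (map (\<lambda>us. map2 (apply_upd L) us (dig s)) uss) (dig t)"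
    if "\<And>us. us \<in> set uss \<Longrightarrow> length us = 8" for uss
    using that
  proof (induction uss)
    case (Cons us uss)
    have "list_all id (map (\<lambda>r. upd_holds (us ! r) r ?v) [0..<8]) \<longleftrightarrow>
        (\<forall>r < 8. map2 (apply_upd L) us (dig s) ! r = digit L r t)"
      using Cons.prems[of us] by (auto simp: list_all_iff holds dig_def)
    also have "\<dots> \<longleftrightarrow> map2 (apply_upd L) us (dig s) = dig t"
      using Cons.prems[of us] by (intro dig_eq_list_iff[symmetric]) (simp add: dig_def)
    finally have "word_count (us # uss) ?v = of_bool (map2 (apply_upd L) us (dig s) = dig t) + word_count uss ?v"
      by (simp add: word_count_def)
    then show ?case
      using Cons by simp
  qed (simp add: word_count_def)
  have "length us = 8" if "us \<in> set (word_slots sg ?v)" for us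
    using that unfolding word_slots_def by (rule set_slots(1))
  from count[OF this] have tprob: "of_nat (word_count (word_slots sg ?v) ?v) / 4 = tprob M s a t"
    by (simp add: slots tprob_M)
  have weight: "weight (control ?v) (\<not> at_pos 0 10 ?v) (\<not> at_pos 0 11 ?v) = wgt M s a"
    by (simp add: control weight_min wgt_M state_weight_def at d)
  have "list_all id (map (\<lambda>r. at_pos 0 r ?v) [0..<8]) \<longleftrightarrow> replicate 8 0 = dig t"
    by (subst dig_eq_list_iff) (auto simp: list_all_iff at dt)
  also have "\<dots> \<longleftrightarrow> t = 0"
    using dig_eq_iff[of 0 t] t L_pos by (auto simp: dig_0)
  finally have first: "list_all id (map (\<lambda>r. at_pos 0 r ?v) [0..<8]) \<longleftrightarrow> t = 0" .
  have "list_all id (map (\<lambda>r. at_last r ?v) [0..<8]) \<longleftrightarrow> replicate 8 (L - 1) = dig t"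
    by (subst dig_eq_list_iff) (auto simp: list_all_iff last dt)
  also have "\<dots> \<longleftrightarrow> t = L ^ 8 - 1"
    using dig_eq_iff[of "L ^ 8 - 1" t] t L_pos unfolding dig_last by auto
  finally have final: "list_all id (map (\<lambda>r. at_last r ?v) [0..<8]) \<longleftrightarrow> t = L ^ 8 - 1" .
  show ?thesis
    unfolding word_entry_def first final tprob weight entry_def s_def[symmetric] a_def[symmetric] t_def[symmetric]
    by (simp add: at[of 8] last[of 8] da)
qed

end

lemma mult_add_div: "x < K \<Longrightarrow> (s * K + x) div K = s" for K :: nat
  by simp

lemma concat_map_upt_mult:
  "concat (map F [0..<A * B]) = concat (map (\<lambda>i. concat (map (\<lambda>j. F (i * B + j)) [0..<B])) [0..<A])"
proof (induction A)
  case (Suc A)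
  have "[0..<A * B + B] = [0..<A * B] @ [A * B..<A * B + B]"
    by (rule upt_add_eq_append) simp
  moreover have "[A * B..<A * B + B] = map (\<lambda>j. A * B + j) [0..<B]"
    using map_add_upt[of "A * B" B] by (simp add: add.commute)
  ultimately have upt: "[0..<Suc A * B] = [0..<A * B] @ map (\<lambda>j. A * B + j) [0..<B]"
    by (simp add: add.commute)
  show ?case
    unfolding upt map_append concat_append Suc by (simp add: comp_def)
qed simp

lemma concat_map_brackets:
  assumes "0 < B"
  shows "concat (map (\<lambda>t. (if t = 0 then P else []) @ G t @ (if t = B - 1 then Q else [])) [0..<B]) =
    P @ concat (map G [0..<B]) @ Q"
proof -
  have "concat (map (\<lambda>t. (if t = 0 then P else []) @ G t @ (if t = B - 1 then Q else [])) [0..<n]) =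
      (if n = 0 then [] else P) @ concat (map G [0..<n]) @ (if n = B then Q else [])" if "n \<le> B" for n
    using that
  proof (induction n)
    case (Suc n)
    have "(n = B - 1) = (Suc n = B)"
      using assms by auto
    then show ?case
      using Suc by (cases "n = 0") simp_all
  qed (use assms in simp)
  from this[of B] show ?thesis
    using assms by simp
qed

context mdp_chain
begin

text \<open>The single \<open>False\<close> closes the list of states, which no entry does, and
  \<open>enc_nat 0\<close> is the initial state.\<close>

lemma concat_entries:
  "concat (map (\<lambda>N. entry (N div L ^ 9) (N div L ^ 8 mod L) (N mod L ^ 8)) [0..<L ^ 17]) @ [False] @ enc_nat 0 =
   enc_mdp M"
proof -
  let ?T = "L ^ 8"
  have T: "0 < ?T"
    using L_pos by simp
  let ?E = "\<lambda>N. entry (N div L ^ 9) (N div L ^ 8 mod L) (N mod L ^ 8)"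
  have row: "concat (map (entry s a) [0..<?T]) = (if a = 0 then [True] else []) @
      (True # enc_int (wgt M s a) @ enc_list (\<lambda>t. enc_rat (tprob M s a t)) [0..<?T]) @
      (if a = L - 1 then [False] else [])" for s a
    unfolding entry_def[abs_def]
    using concat_map_brackets[OF T, of "(if a = 0 then [True] else []) @ True # enc_int (wgt M s a)"
        "\<lambda>t. True # enc_rat (tprob M s a t)" "False # (if a = L - 1 then [False] else [])"]
    by (simp add: enc_list_def)
  have state: "concat (map (\<lambda>a. concat (map (entry s a) [0..<?T])) [0..<L]) =
      True # enc_list (\<lambda>a. enc_int (wgt M s a) @ enc_list (\<lambda>t. enc_rat (tprob M s a t)) [0..<?T]) [0..<L]" for s
    unfolding row
    using concat_map_brackets[OF L_pos, of "[True]"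
        "\<lambda>a. True # enc_int (wgt M s a) @ enc_list (\<lambda>t. enc_rat (tprob M s a t)) [0..<?T]" "[False]"]
    by (simp add: enc_list_def)
  have pow: "L ^ 17 = ?T * (L * ?T)" "L ^ 9 = L * ?T"
    by (simp_all flip: power_Suc power_add)
  have "concat (map ?E [0..<L ^ 17]) =
      concat (map (\<lambda>s. concat (map (\<lambda>j. ?E (s * (L * ?T) + j)) [0..<L * ?T])) [0..<?T])"
    unfolding pow(1) by (rule concat_map_upt_mult)
  also have "\<dots> = concat (map (\<lambda>s. concat (map (\<lambda>a. concat (map (\<lambda>t. ?E (s * (L * ?T) + (a * ?T + t))) [0..<?T])) [0..<L])) [0..<?T])"
    unfolding concat_map_upt_mult[of _ L ?T] ..
  also have "\<dots> = concat (map (\<lambda>s. concat (map (\<lambda>a. concat (map (entry s a) [0..<?T])) [0..<L])) [0..<?T])"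
  proof -
    have "?E (s * (L * ?T) + (a * ?T + t)) = entry s a t" if "a < L" "t < ?T" for s a t
    proof -
      have "a * ?T + t < L * ?T"
      proof -
        have "a * ?T + t < Suc a * ?T"
          using that by simp
        also have "\<dots> \<le> L * ?T"
          using that by (intro mult_right_mono) auto
        finally show ?thesis .
      qed
      then have "(s * (L * ?T) + (a * ?T + t)) div (L * ?T) = s"
        by (rule mult_add_div)
      moreover have "(s * (L * ?T) + (a * ?T + t)) = (s * L + a) * ?T + t"
        by (simp add: algebra_simps)
      moreover have "((s * L + a) * ?T + t) div ?T = s * L + a" "((s * L + a) * ?T + t) mod ?T = t"
        using that(2) by (rule mult_add_div, simp)
      ultimately show ?thesis
        using that unfolding pow(2) by (simp only:) simp
    qed
    then show ?thesis
      by (intro arg_cong[where f = concat] map_cong refl) simp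
  qed
  also have "\<dots> @ [False] @ enc_nat 0 = enc_mdp M"
    unfolding state by (simp add: enc_mdp_def Let_def enc_list_def)
  finally show ?thesis
    by simp
qed

end

section \<open>Codes determine hitting probabilities\<close>

text \<open>Self-delimiting codes are prefix-free. Two encoders and a relation occur because the
  encoding of a row depends on the process and the row, and equal codes yield entrywise agreement of
  two such rows.\<close>

lemma enc_list_prefix_free:
  assumes "\<And>x y u u'. x \<in> set xs \<Longrightarrow> y \<in> set ys \<Longrightarrow> e x @ u = e' y @ u' \<Longrightarrow> R x y \<and> u = u'"
    and "enc_list e xs @ u = enc_list e' ys @ u'"
  shows "list_all2 R xs ys \<and> u = u'"
  using assms
proof (induction xs arbitrary: ys)
  case Nil
  then show ?case
    by (cases ys) (auto simp: enc_list_def)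
next
  case (Cons x xs)
  obtain y ys' where ys: "ys = y # ys'"
    using Cons.prems(2) by (cases ys) (auto simp: enc_list_def)
  have "e x @ enc_list e xs @ u = e' y @ enc_list e' ys' @ u'"
    using Cons.prems(2) by (simp add: ys enc_list_def)
  then have "R x y" "enc_list e xs @ u = enc_list e' ys' @ u'"
    using Cons.prems(1)[of x y] by (auto simp: ys)
  moreover from this(2) have "list_all2 R xs ys' \<and> u = u'"
    using Cons.prems(1) by (intro Cons.IH) (auto simp: ys)
  ultimately show ?case
    by (simp add: ys)
qed

lemma enc_nat_prefix_free:
  assumes "enc_nat m @ u = enc_nat n @ u'"
  shows "m = n \<and> u = u'"
proof -
  have "list_all2 (=) (bits m) (bits n) \<and> u = u'"
    by (rule enc_list_prefix_free[OF _ assms[unfolded enc_nat_def]]) auto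
  then show ?thesis
    using bit_value_bits by (metis list.rel_eq)
qed

lemma enc_int_prefix_free: "enc_int y @ u = enc_int z @ u' \<Longrightarrow> y = z \<and> u = u'"
  unfolding enc_int_def by (auto dest!: enc_nat_prefix_free split: if_splits)

lemma enc_rat_prefix_free:
  assumes "enc_rat q @ u = enc_rat r @ u'"
  shows "q = r \<and> u = u'"
proof -
  have "fst (quotient_of q) = fst (quotient_of r)" and *: "enc_int (snd (quotient_of q)) @ u = enc_int (snd (quotient_of r)) @ u'"
    using assms enc_int_prefix_free unfolding enc_rat_def append_assoc by blast+
  moreover have "snd (quotient_of q) = snd (quotient_of r) \<and> u = u'"
    using enc_int_prefix_free[OF *] .
  ultimately show ?thesis
    by (metis prod_eqI quotient_of_inject)
qed

text \<open>A code fixes weights and probabilities only on the listed states and actions; as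
  functions, two processes with the same code may differ elsewhere.\<close>

definition mdp_agree :: "('s, 'a) mdp \<Rightarrow> ('s, 'a) mdp \<Rightarrow> bool" where
  "mdp_agree M M' \<longleftrightarrow> states M = states M' \<and> actions M = actions M' \<and> init M = init M' \<and>
     (\<forall>s \<in> states M. \<forall>a \<in> actions M. wgt M s a = wgt M' s a \<and> (\<forall>t \<in> states M. tprob M s a t = tprob M' s a t))"

lemma enc_threshold_inj:
  assumes "threshold_instance M \<theta>" "threshold_instance M' \<theta>'"
    and eq: "enc_threshold M \<theta> = enc_threshold M' \<theta>'"
  shows "mdp_agree M M' \<and> \<theta> = \<theta>'"
proof -
  obtain n m n' m' where M: "states M = {0..<n}" "actions M = {0..<m}" "init M \<in> states M"
    and M': "states M' = {0..<n'}" "actions M' = {0..<m'}"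
    using assms(1,2) by (auto simp: threshold_instance_def finite_mdp_def)
  let ?row = "\<lambda>M n s a. enc_int (wgt M s a) @ enc_list (\<lambda>t. enc_rat (tprob M s a t)) [0..<n]"
  have row: "(wgt M s a = wgt M' s' a' \<and> list_all2 (\<lambda>t t'. tprob M s a t = tprob M' s' a' t') [0..<n] [0..<n']) \<and> u = u'"
    if "?row M n s a @ u = ?row M' n' s' a' @ u'" for s a s' a' u u'
  proof -
    have "wgt M s a = wgt M' s' a'" and *: "enc_list (\<lambda>t. enc_rat (tprob M s a t)) [0..<n] @ u =
        enc_list (\<lambda>t. enc_rat (tprob M' s' a' t)) [0..<n'] @ u'"
      using that enc_int_prefix_free unfolding append_assoc by blast+
    moreover have "list_all2 (\<lambda>t t'. tprob M s a t = tprob M' s' a' t') [0..<n] [0..<n'] \<and> u = u'"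
      by (rule enc_list_prefix_free[OF _ *]) (rule enc_rat_prefix_free)
    ultimately show ?thesis
      by blast
  qed
  let ?R = "\<lambda>s s' a a'. wgt M s a = wgt M' s' a' \<and> list_all2 (\<lambda>t t'. tprob M s a t = tprob M' s' a' t') [0..<n] [0..<n']"
  have "enc_list (\<lambda>s. enc_list (\<lambda>a. ?row M n s a) [0..<m]) [0..<n] @ enc_nat (init M) @ enc_rat \<theta> =
      enc_list (\<lambda>s. enc_list (\<lambda>a. ?row M' n' s a) [0..<m']) [0..<n'] @ enc_nat (init M') @ enc_rat \<theta>'"
    using eq by (simp add: enc_threshold_def enc_mdp_def Let_def M M')
  then have all: "list_all2 (\<lambda>s s'. list_all2 (?R s s') [0..<m] [0..<m']) [0..<n] [0..<n'] \<and>
      enc_nat (init M) @ enc_rat \<theta> = enc_nat (init M') @ enc_rat \<theta>'"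
  proof (rule enc_list_prefix_free[rotated])
    fix s s' u u'
    assume "enc_list (\<lambda>a. ?row M n s a) [0..<m] @ u = enc_list (\<lambda>a. ?row M' n' s' a) [0..<m'] @ u'"
    then show "list_all2 (?R s s') [0..<m] [0..<m'] \<and> u = u'"
      by (rule enc_list_prefix_free[rotated]) (rule row)
  qed
  then have tail: "enc_nat (init M) @ enc_rat \<theta> = enc_nat (init M') @ enc_rat \<theta>'"
    by (rule conjunct2)
  have "init M = init M'" "enc_rat \<theta> = enc_rat \<theta>'"
    using enc_nat_prefix_free[OF tail] by auto
  then have "\<theta> = \<theta>'"
    using enc_rat_prefix_free[of \<theta> "[]" \<theta>' "[]"] by simp
  have n: "n = n'"
    using all by (auto dest: list_all2_lengthD)
  have rows: "list_all2 (?R s s) [0..<m] [0..<m']" if "s < n" for s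
    using list_all2_nthD2[of _ "[0..<n]" "[0..<n']" s] all that n by auto
  have m: "m = m'"
    using rows[of "init M"] M by (auto dest: list_all2_lengthD)
  have entries: "?R s s a a" if "s < n" "a < m" for s a
    using list_all2_nthD2[OF rows[OF that(1)], of a] that m by auto
  have "tprob M s a t = tprob M' s a t" if "s < n" "a < m" "t < n" for s a t
    using list_all2_nthD2[OF entries[OF that(1,2), THEN conjunct2], of t] that n by auto
  then show ?thesis
    using entries n m \<open>init M = init M'\<close> \<open>\<theta> = \<theta>'\<close> by (auto simp: mdp_agree_def M M')
qed

section \<open>Invariance of the probabilities under agreement\<close>

context
  fixes M M' :: "('s, 'a) mdp"
  assumes agree: "mdp_agree M M'"
begin

lemma agree_enabled: "s \<in> states M \<Longrightarrow> enabled M s = enabled M' s"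
  using agree by (auto simp: mdp_agree_def enabled_def cong: sum.cong)

lemma agree_finite_paths: "finite_paths M s = finite_paths M' s"
proof -
  have "\<pi> \<in> finite_paths M s \<longleftrightarrow> \<pi> \<in> finite_paths M' s" for \<pi>
  proof (induction \<pi> rule: path_induct)
    case (Nil t)
    then show ?case
      using agree by (simp add: finite_paths_Nil mdp_agree_def)
  next
    case (snoc \<pi> x)
    have "valid_step M (last_state \<pi>) x \<longleftrightarrow> valid_step M' (last_state \<pi>) x" if "\<pi> \<in> finite_paths M s"
      using last_state_finite_paths[OF that] agree
      by (auto simp: valid_step_def mdp_agree_def agree_enabled[symmetric] enabled_def[of M])
    then show ?case
      using snoc by (auto simp: finite_paths_snoc)
  qed
  then show ?thesis
    by blast
qed

lemma agree_acc_weight: "\<pi> \<in> finite_paths M s \<Longrightarrow> acc_weight M \<pi> = acc_weight M' \<pi>"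
proof (induction \<pi> rule: path_induct)
  case (snoc \<pi> x)
  then have \<pi>: "\<pi> \<in> finite_paths M s" "fst x \<in> enabled M (last_state \<pi>)"
    by (auto simp: finite_paths_snoc valid_step_def)
  then have "wgt M (last_state \<pi>) (fst x) = wgt M' (last_state \<pi>) (fst x)"
    using agree last_state_finite_paths[OF \<pi>(1)] by (auto simp: mdp_agree_def enabled_def)
  then show ?case
    using snoc.IH \<pi>(1) by (simp add: acc_weight_snoc)
qed simp

lemma agree_path_prob: "\<pi> \<in> finite_paths M s \<Longrightarrow> path_prob M \<sigma> \<pi> = path_prob M' \<sigma> \<pi>"
proof (induction \<pi> rule: path_induct)
  case (snoc \<pi> x)
  then have \<pi>: "\<pi> \<in> finite_paths M s" "fst x \<in> enabled M (last_state \<pi>)" "snd x \<in> states M"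
    by (auto simp: finite_paths_snoc valid_step_def)
  then have "tprob M (last_state \<pi>) (fst x) (snd x) = tprob M' (last_state \<pi>) (fst x) (snd x)"
    using agree last_state_finite_paths[OF \<pi>(1)] by (auto simp: mdp_agree_def enabled_def)
  then show ?case
    using snoc.IH \<pi>(1) by (simp add: path_prob_snoc)
qed simp

lemma agree_maximal_paths: "maximal_paths M s = maximal_paths M' s"
proof -
  have "ends_terminal M \<zeta> \<longleftrightarrow> ends_terminal M' \<zeta>"
    if "\<And>\<pi>. path_prefix \<pi> \<zeta> \<Longrightarrow> \<pi> \<in> finite_paths M s" for \<zeta>
  proof (cases \<zeta>)
    case (Finite_Path t xs)
    then have "(t, xs) \<in> finite_paths M s"
      using that[of "(t, xs)"] by simp
    then show ?thesis
      using agree_enabled[OF last_state_finite_paths] by (simp add: Finite_Path)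
  qed simp
  then show ?thesis
    unfolding maximal_paths_def agree_finite_paths[symmetric] by blast
qed

lemma agree_schedulers: "schedulers M = schedulers M'"
proof -
  have "states M = states M'"
    using agree by (simp add: mdp_agree_def)
  then show ?thesis
    using agree_enabled[OF last_state_finite_paths]
    unfolding schedulers_def agree_finite_paths[symmetric] by (auto 0 3)
qed

lemma agree_path_measure: "path_measure M \<sigma> s = path_measure M' \<sigma> s"
proof -
  have cyl: "cylinder M s = cylinder M' s"
    by (intro ext) (simp add: cylinder_def agree_maximal_paths)
  \<comment> \<open>\<open>extend_measure\<close> chooses some measure, but the prescribed values
    enter only through statements of this kind over the index set, so both processes get the same
    choice.\<close>
  have prob: "(\<forall>\<pi> \<in> finite_paths M s. f \<pi> (ennreal (path_prob M \<sigma> \<pi>))) \<longleftrightarrow>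
      (\<forall>\<pi> \<in> finite_paths M s. f \<pi> (ennreal (path_prob M' \<sigma> \<pi>)))" for f :: "('s, 'a) fpath \<Rightarrow> ennreal \<Rightarrow> bool"
    using agree_path_prob by auto
  show ?thesis
    unfolding path_measure_def extend_measure_def agree_finite_paths[symmetric]
      agree_maximal_paths[symmetric] cyl[symmetric]
    using prob[of "\<lambda>\<pi> x. _ (cylinder M s \<pi>) = x"] prob[of "\<lambda>\<pi> x. x = 0"] by (simp only:)
qed

lemma agree_eventually_negative: "eventually_negative M s = eventually_negative M' s"
proof -
  have "(\<exists>\<pi>. path_prefix \<pi> \<zeta> \<and> acc_weight M \<pi> < 0) \<longleftrightarrow> (\<exists>\<pi>. path_prefix \<pi> \<zeta> \<and> acc_weight M' \<pi> < 0)"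
    if "\<zeta> \<in> maximal_paths M s" for \<zeta>
  proof -
    have "acc_weight M \<pi> = acc_weight M' \<pi>" if "path_prefix \<pi> \<zeta>" for \<pi>
      using that \<open>\<zeta> \<in> maximal_paths M s\<close> unfolding maximal_paths_def by (intro agree_acc_weight[of _ s]) blast
    then show ?thesis
      by metis
  qed
  then show ?thesis
    unfolding eventually_negative_def agree_maximal_paths[symmetric] by blast
qed

lemma agree_Pr:
  "Pr_max M s (eventually_negative M s) = Pr_max M' s (eventually_negative M' s)"
  "Pr_min M s (eventually_negative M s) = Pr_min M' s (eventually_negative M' s)"
  unfolding Pr_max_def Pr_min_def
  by (simp_all only: agree_schedulers agree_path_measure agree_eventually_negative)

end

section \<open>The reductions\<close>

text \<open>The flag is the fixed sign: \<open>False\<close> for the maximum, where flipping has to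
  raise the probability, and \<open>True\<close> for the minimum, where it has to lower it.\<close>

definition reduction :: "bool \<Rightarrow> bool list \<Rightarrow> bool list" where
  "reduction sg w = enc_threshold (recurrence_mdp sg (classes w)) (1 / 2)"

context
  fixes as bs :: "rat list" and sg :: bool
  assumes lrs: "lrs_instance as bs"
begin

lemma lrs_mdp_instance: "lrs_mdp (classes (enc_lrs as bs)) as bs (length as)"
  using lrs length_input_classes_ge[of as bs]
  by unfold_locales (auto simp: classes_enc_lrs lrs_instance_def)

interpretation lrs_mdp sg "classes (enc_lrs as bs)" as bs "length as"
  by (rule lrs_mdp_instance)

lemma reduction_threshold_instance:
  "threshold_instance (recurrence_mdp sg (classes (enc_lrs as bs))) (1 / 2)"
  using finite_mdp_M unfolding threshold_instance_def by (auto simp: states_M actions_M)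

lemma reduction_eq_table:
  "reduction sg (enc_lrs as bs) = concat (map (\<lambda>N. word_entry sg (mark_word 17 (enc_lrs as bs) N))
     [0..<length (enc_lrs as bs) ^ 17]) @ [False] @ enc_nat 0 @ enc_rat (1 / 2)"
proof -
  let ?w = "enc_lrs as bs" and ?L = "length (enc_lrs as bs)"
  have eq: "map (\<lambda>N. word_entry sg (mark_word 17 ?w N)) [0..<?L ^ 17] =
      map (\<lambda>N. entry (N div ?L ^ 9) (N div ?L ^ 8 mod ?L) (N mod ?L ^ 8)) [0..<?L ^ 17]"
    using word_entry_eq_entry[of ?w] by (intro map_cong) auto
  show ?thesis
    unfolding reduction_def enc_threshold_def eq concat_entries[symmetric] by simp
qed

lemma reduction_Pr:
  "\<not> sg \<Longrightarrow> real_of_rat (1 / 2) < Pr_max (recurrence_mdp sg (classes (enc_lrs as bs))) 0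
      (eventually_negative (recurrence_mdp sg (classes (enc_lrs as bs))) 0) \<longleftrightarrow> (\<exists>n. lrs as bs n < 0)"
  "sg \<Longrightarrow> Pr_min (recurrence_mdp sg (classes (enc_lrs as bs))) 0
      (eventually_negative (recurrence_mdp sg (classes (enc_lrs as bs))) 0) < real_of_rat (1 / 2) \<longleftrightarrow>
    (\<exists>n. lrs as bs n < 0)"
  using Pr_max_iff Pr_min_iff by (simp_all add: of_rat_divide)

end

lemma poly_time_reduction: "poly_time_computable_on (instances positivity_problem) (reduction sg)"
proof (rule poly_time_computable_marks[OF regular_word_entry])
  fix w
  assume "w \<in> instances positivity_problem"
  then obtain as bs where w: "w = enc_lrs as bs" "lrs_instance as bs"
    by (auto simp: positivity_problem_def)
  show "w \<noteq> []"
    by (simp add: w enc_lrs_def enc_list_def)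
  show "reduction sg w = concat (map (\<lambda>N. word_entry sg (mark_word 17 w N)) [0..<length w ^ 17]) @
      ([False] @ enc_nat 0 @ enc_rat (1 / 2))"
    unfolding w(1) by (rule reduction_eq_table[OF w(2)])
qed

text \<open>
  The probabilities depend on the code only, so that two instances with the same code agree about the
  existence of a negative term; it is not necessary to decode instances.
\<close>

lemma reduction_correct:
  fixes sg :: bool and Q :: "(nat, nat) mdp \<Rightarrow> rat \<Rightarrow> bool"
  defines "Y \<equiv> {enc_threshold M \<theta> | M \<theta>. threshold_instance M \<theta> \<and> Q M \<theta>}"
  assumes agree: "\<And>M M' \<theta>. mdp_agree M M' \<Longrightarrow> Q M \<theta> = Q M' \<theta>"
    and Q: "\<And>as bs. lrs_instance as bs \<Longrightarrow>
      Q (recurrence_mdp sg (classes (enc_lrs as bs))) (1 / 2) \<longleftrightarrow> (\<exists>n. lrs as bs n < 0)"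
    and w: "w \<in> instances positivity_problem"
  shows "w \<notin> yes_instances positivity_problem \<longleftrightarrow> reduction sg w \<in> Y"
proof -
  obtain as bs where ab: "w = enc_lrs as bs" "lrs_instance as bs"
    using w by (auto simp: positivity_problem_def)
  let ?M = "recurrence_mdp sg (classes w)"
  have inst: "threshold_instance ?M (1 / 2)"
    unfolding ab(1) by (rule reduction_threshold_instance[OF ab(2)])
  have "reduction sg w \<in> Y \<longleftrightarrow> Q ?M (1 / 2)"
  proof
    assume "reduction sg w \<in> Y"
    then obtain M \<theta> where M: "enc_threshold ?M (1 / 2) = enc_threshold M \<theta>" "threshold_instance M \<theta>" "Q M \<theta>"
      by (auto simp: Y_def reduction_def)
    have "mdp_agree ?M M" "1 / 2 = \<theta>"
      using enc_threshold_inj[OF inst M(2,1)] by auto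
    then show "Q ?M (1 / 2)"
      using M(3) agree by metis
  next
    assume "Q ?M (1 / 2)"
    then show "reduction sg w \<in> Y"
      using inst unfolding Y_def reduction_def by blast
  qed
  also have "\<dots> \<longleftrightarrow> w \<notin> yes_instances positivity_problem"
  proof
    assume q: "Q ?M (1 / 2)"
    show "w \<notin> yes_instances positivity_problem"
    proof
      assume "w \<in> yes_instances positivity_problem"
      then obtain as' bs' where ab': "w = enc_lrs as' bs'" "lrs_instance as' bs'" "\<forall>n. 0 \<le> lrs as' bs' n"
        by (auto simp: positivity_problem_def)
      then obtain n where "lrs as' bs' n < 0"
        using q Q[of as' bs'] by blast
      with ab'(3) show False
        by (metis not_less)
    qed
  next
    assume "w \<notin> yes_instances positivity_problem"
    then have "\<not> (\<forall>n. 0 \<le> lrs as bs n)"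
      using ab by (auto simp: positivity_problem_def)
    then show "Q ?M (1 / 2)"
      using Q[OF ab(2)] unfolding ab(1) by (simp add: not_le)
  qed
  finally show ?thesis ..
qed

lemma reduction_instance:
  assumes "w \<in> instances positivity_problem"
  shows "reduction sg w \<in> {enc_threshold M \<theta> | M \<theta>. threshold_instance M \<theta>}"
proof -
  obtain as bs where "w = enc_lrs as bs" "lrs_instance as bs"
    using assms by (auto simp: positivity_problem_def)
  then show ?thesis
    using reduction_threshold_instance[of as bs sg] by (auto simp: reduction_def)
qed

theorem theorem1:
  shows "poly_time_reducible (complement_problem positivity_problem) max_negative_weight_problem \<and>
         poly_time_reducible (complement_problem positivity_problem) min_negative_weight_problem"
proof
  have init: "init M = init M'" if "mdp_agree M M'" for M M' :: "(nat, nat) mdp"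
    using that by (simp add: mdp_agree_def)
  have init_0: "init (recurrence_mdp sg cs) = 0" for sg cs
    by (simp add: recurrence_mdp_def)
  have "w \<notin> yes_instances positivity_problem \<longleftrightarrow> reduction False w \<in> yes_instances max_negative_weight_problem"
    if "w \<in> instances positivity_problem" for w
    unfolding max_negative_weight_problem_def decision_problem.simps
    by (rule reduction_correct[OF _ _ that]) (simp_all add: agree_Pr init init_0 reduction_Pr(1))
  then show "poly_time_reducible (complement_problem positivity_problem) max_negative_weight_problem"
    unfolding poly_time_reducible_def using poly_time_reduction[of False] reduction_instance[of _ False]
    by (intro exI[of _ "reduction False"]) (auto simp: complement_problem_def max_negative_weight_problem_def)
  have "w \<notin> yes_instances positivity_problem \<longleftrightarrow> reduction True w \<in> yes_instances min_negative_weight_problem"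
    if "w \<in> instances positivity_problem" for w
    unfolding min_negative_weight_problem_def decision_problem.simps
    by (rule reduction_correct[OF _ _ that]) (simp_all add: agree_Pr init init_0 reduction_Pr(2))
  then show "poly_time_reducible (complement_problem positivity_problem) min_negative_weight_problem"
    unfolding poly_time_reducible_def using poly_time_reduction[of True] reduction_instance[of _ True]
    by (intro exI[of _ "reduction True"]) (auto simp: complement_problem_def min_negative_weight_problem_def)
qed

end
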